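(* Let $G$ be a non-amenable locally compact group. Then no $G$-$C^*$-algebra admitting a $G$-invariant state has the $G$-QWEP. In particular, $C^*(G)$ does not have the $G$-QWEP.
   Context: A $G$-$C^*$-algebra is a $C^*$-algebra $A$ with a homomorphism $\alpha:G\to\mathrm{Aut}(A)$ such that $s\mapsto\alpha_s(a)$ is norm continuous for each $a\in A$. $A^{**}$ carries the bidual action. $C^*(G)$ is the full group $C^*$-algebra, with $G$ acting by conjugation by the canonical unitaries of $G$ in $M(C^*(G))$. $G$-WEP: a $G$-$C^*$-algebra $A$ has the $G$-WEP if for every $G$-equivariant inclusion $A\subseteq B$ into a $G$-$C^*$-algebra $B$ there is a $G$-equivariant completely positive contraction $E:B\to A^{**}$ which restricts to the canonical inclusion on $A$. $G$-QWEP: a $G$-$C^*$-algebra has the $G$-QWEP if it is the image under a $G$-equivariant $*$-homomorphism of a $G$-$C^*$-algebra with the $G$-WEP. *)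

theory Defs
  imports "HOL-Algebra.Module" "HOL-Analysis.Analysis"
begin

text \<open>
  A group is a type of class \<open>topological_group_add\<close>. The class is not commutative;
  the product \<open>gh\<close> is written \<open>g + h\<close> and the inverse \<open>- g\<close>. Hausdorffness is the class
  \<open>t2_space\<close>. Algebras live on carrier sets, so that one can quantify over all of them inside
  a formula.
\<close>

section \<open>C*-algebras\<close>

definition complex_cring :: "complex ring" where
  "complex_cring = \<lparr>carrier = UNIV, monoid.mult = (*), one = 1, zero = 0, add = (+)\<rparr>"

text \<open>
  C*-algebras need not be unital. The field \<open>one\<close>, inherited from the record of rings, carries
  no meaning and is never constrained.
\<close>

record 'a cstar_alg = "(complex, 'a) module" +
  adj :: "'a \<Rightarrow> 'a"
  cnorm :: "'a \<Rightarrow> real"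

definition cstar_algebra :: "'a cstar_alg \<Rightarrow> bool" where
  "cstar_algebra A \<longleftrightarrow>
     Module.module complex_cring A \<and>
     (\<forall>x\<in>carrier A. \<forall>y\<in>carrier A. x \<otimes>\<^bsub>A\<^esub> y \<in> carrier A) \<and>
     (\<forall>x\<in>carrier A. \<forall>y\<in>carrier A. \<forall>z\<in>carrier A.
        (x \<otimes>\<^bsub>A\<^esub> y) \<otimes>\<^bsub>A\<^esub> z = x \<otimes>\<^bsub>A\<^esub> (y \<otimes>\<^bsub>A\<^esub> z) \<and>
        (x \<oplus>\<^bsub>A\<^esub> y) \<otimes>\<^bsub>A\<^esub> z = (x \<otimes>\<^bsub>A\<^esub> z) \<oplus>\<^bsub>A\<^esub> (y \<otimes>\<^bsub>A\<^esub> z) \<and>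
        z \<otimes>\<^bsub>A\<^esub> (x \<oplus>\<^bsub>A\<^esub> y) = (z \<otimes>\<^bsub>A\<^esub> x) \<oplus>\<^bsub>A\<^esub> (z \<otimes>\<^bsub>A\<^esub> y)) \<and>
     (\<forall>c. \<forall>x\<in>carrier A. \<forall>y\<in>carrier A.
        (c \<odot>\<^bsub>A\<^esub> x) \<otimes>\<^bsub>A\<^esub> y = c \<odot>\<^bsub>A\<^esub> (x \<otimes>\<^bsub>A\<^esub> y) \<and>
        x \<otimes>\<^bsub>A\<^esub> (c \<odot>\<^bsub>A\<^esub> y) = c \<odot>\<^bsub>A\<^esub> (x \<otimes>\<^bsub>A\<^esub> y)) \<and>
     (\<forall>x\<in>carrier A. adj A x \<in> carrier A \<and> adj A (adj A x) = x) \<and>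
     (\<forall>x\<in>carrier A. \<forall>y\<in>carrier A.
        adj A (x \<oplus>\<^bsub>A\<^esub> y) = adj A x \<oplus>\<^bsub>A\<^esub> adj A y \<and>
        adj A (x \<otimes>\<^bsub>A\<^esub> y) = adj A y \<otimes>\<^bsub>A\<^esub> adj A x) \<and>
     (\<forall>c. \<forall>x\<in>carrier A. adj A (c \<odot>\<^bsub>A\<^esub> x) = cnj c \<odot>\<^bsub>A\<^esub> adj A x) \<and>
     (\<forall>x\<in>carrier A. 0 \<le> cnorm A x \<and> (cnorm A x = 0 \<longleftrightarrow> x = \<zero>\<^bsub>A\<^esub>)) \<and>
     (\<forall>c. \<forall>x\<in>carrier A. cnorm A (c \<odot>\<^bsub>A\<^esub> x) = cmod c * cnorm A x) \<and>
     (\<forall>x\<in>carrier A. \<forall>y\<in>carrier A.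
        cnorm A (x \<oplus>\<^bsub>A\<^esub> y) \<le> cnorm A x + cnorm A y \<and>
        cnorm A (x \<otimes>\<^bsub>A\<^esub> y) \<le> cnorm A x * cnorm A y) \<and>
     (\<forall>x\<in>carrier A. cnorm A (adj A x \<otimes>\<^bsub>A\<^esub> x) = (cnorm A x)\<^sup>2) \<and>
     (\<forall>X::nat \<Rightarrow> 'a. (\<forall>n. X n \<in> carrier A) \<longrightarrow>
        (\<forall>e>0. \<exists>N. \<forall>m\<ge>N. \<forall>n\<ge>N. cnorm A (X m \<ominus>\<^bsub>A\<^esub> X n) < e) \<longrightarrow>
        (\<exists>x\<in>carrier A. (\<lambda>n. cnorm A (X n \<ominus>\<^bsub>A\<^esub> x)) \<longlonglongrightarrow> 0))"

definition linear_map :: "'a cstar_alg \<Rightarrow> 'b cstar_alg \<Rightarrow> ('a \<Rightarrow> 'b) \<Rightarrow> bool" where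
  "linear_map A B T \<longleftrightarrow>
     (\<forall>x\<in>carrier A. T x \<in> carrier B) \<and>
     (\<forall>x\<in>carrier A. \<forall>y\<in>carrier A. T (x \<oplus>\<^bsub>A\<^esub> y) = T x \<oplus>\<^bsub>B\<^esub> T y) \<and>
     (\<forall>c. \<forall>x\<in>carrier A. T (c \<odot>\<^bsub>A\<^esub> x) = c \<odot>\<^bsub>B\<^esub> T x)"

definition star_hom :: "'a cstar_alg \<Rightarrow> 'b cstar_alg \<Rightarrow> ('a \<Rightarrow> 'b) \<Rightarrow> bool" where
  "star_hom A B T \<longleftrightarrow>
     linear_map A B T \<and>
     (\<forall>x\<in>carrier A. \<forall>y\<in>carrier A. T (x \<otimes>\<^bsub>A\<^esub> y) = T x \<otimes>\<^bsub>B\<^esub> T y) \<and>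
     (\<forall>x\<in>carrier A. T (adj A x) = adj B (T x))"

text \<open>
  Positivity in the matrix algebra \<open>M_n(A)\<close>: an \<open>n \<times> n\<close> matrix is positive iff it equals \<open>Y* Y\<close>
  for some \<open>n \<times> n\<close> matrix \<open>Y\<close> over \<open>A\<close>. Only the entries with indices below \<open>n\<close> matter.
\<close>

definition matrix_positive :: "'a cstar_alg \<Rightarrow> nat \<Rightarrow> (nat \<Rightarrow> nat \<Rightarrow> 'a) \<Rightarrow> bool" where
  "matrix_positive A n X \<longleftrightarrow>
     (\<exists>Y. (\<forall>i<n. \<forall>j<n. Y i j \<in> carrier A) \<and>
          (\<forall>i<n. \<forall>j<n. X i j = (\<Oplus>\<^bsub>A\<^esub>k\<in>{..<n}. adj A (Y k i) \<otimes>\<^bsub>A\<^esub> Y k j)))"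

definition completely_positive :: "'a cstar_alg \<Rightarrow> 'b cstar_alg \<Rightarrow> ('a \<Rightarrow> 'b) \<Rightarrow> bool" where
  "completely_positive A B E \<longleftrightarrow>
     linear_map A B E \<and>
     (\<forall>n X. matrix_positive A n X \<longrightarrow> matrix_positive B n (\<lambda>i j. E (X i j)))"

definition contraction :: "'a cstar_alg \<Rightarrow> 'b cstar_alg \<Rightarrow> ('a \<Rightarrow> 'b) \<Rightarrow> bool" where
  "contraction A B E \<longleftrightarrow> (\<forall>x\<in>carrier A. cnorm B (E x) \<le> cnorm A x)"

section \<open>Dual, states and bidual\<close>

text \<open>
  Functionals are total functions. They are required to vanish off the carrier, so that equality
  of functionals is equality of functions.
\<close>

definition cdual :: "'a cstar_alg \<Rightarrow> ('a \<Rightarrow> complex) set" where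
  "cdual A = {\<phi>.
     (\<forall>x\<in>carrier A. \<forall>y\<in>carrier A. \<phi> (x \<oplus>\<^bsub>A\<^esub> y) = \<phi> x + \<phi> y) \<and>
     (\<forall>c. \<forall>x\<in>carrier A. \<phi> (c \<odot>\<^bsub>A\<^esub> x) = c * \<phi> x) \<and>
     (\<exists>K. \<forall>x\<in>carrier A. cmod (\<phi> x) \<le> K * cnorm A x) \<and>
     (\<forall>x. x \<notin> carrier A \<longrightarrow> \<phi> x = 0)}"

definition dual_norm :: "'a cstar_alg \<Rightarrow> ('a \<Rightarrow> complex) \<Rightarrow> real" where
  "dual_norm A \<phi> = Sup {cmod (\<phi> x) | x. x \<in> carrier A \<and> cnorm A x \<le> 1}"

definition state :: "'a cstar_alg \<Rightarrow> ('a \<Rightarrow> complex) \<Rightarrow> bool" where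
  "state A \<phi> \<longleftrightarrow> \<phi> \<in> cdual A \<and>
     (\<forall>x\<in>carrier A. \<phi> (adj A x \<otimes>\<^bsub>A\<^esub> x) \<in> \<real>\<^sub>\<ge>\<^sub>0) \<and> dual_norm A \<phi> = 1"

definition on_carrier :: "'a cstar_alg \<Rightarrow> ('a \<Rightarrow> complex) \<Rightarrow> 'a \<Rightarrow> complex" where
  "on_carrier A f = (\<lambda>x. if x \<in> carrier A then f x else 0)"

definition on_dual :: "'a cstar_alg \<Rightarrow> (('a \<Rightarrow> complex) \<Rightarrow> complex) \<Rightarrow> ('a \<Rightarrow> complex) \<Rightarrow> complex" where
  "on_dual A F = (\<lambda>\<phi>. if \<phi> \<in> cdual A then F \<phi> else 0)"

definition bidual_carrier :: "'a cstar_alg \<Rightarrow> (('a \<Rightarrow> complex) \<Rightarrow> complex) set" where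
  "bidual_carrier A = {\<Phi>.
     (\<forall>\<phi>\<in>cdual A. \<forall>\<psi>\<in>cdual A. \<Phi> (\<lambda>x. \<phi> x + \<psi> x) = \<Phi> \<phi> + \<Phi> \<psi>) \<and>
     (\<forall>c. \<forall>\<phi>\<in>cdual A. \<Phi> (\<lambda>x. c * \<phi> x) = c * \<Phi> \<phi>) \<and>
     (\<exists>K. \<forall>\<phi>\<in>cdual A. cmod (\<Phi> \<phi>) \<le> K * dual_norm A \<phi>) \<and>
     (\<forall>\<phi>. \<phi> \<notin> cdual A \<longrightarrow> \<Phi> \<phi> = 0)}"

text \<open>
  The product of \<open>A**\<close> is the first Arens product
  \<open>(\<Phi>\<Psi>)(\<phi>) = \<Phi>(\<Psi>\<cdot>\<phi>)\<close>, where \<open>(\<Psi>\<cdot>\<phi>)(a) = \<Psi>(\<phi>\<cdot>a)\<close> and \<open>(\<phi>\<cdot>a)(b) = \<phi>(ab)\<close>; the involution is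
  \<open>\<Phi>*(\<phi>) = cnj (\<Phi>(\<phi>*))\<close>, where \<open>\<phi>*(a) = cnj (\<phi>(a*))\<close>. These turn \<open>A**\<close> into the usual
  enveloping von Neumann algebra.
\<close>

definition bidual_mult :: "'a cstar_alg \<Rightarrow> (('a \<Rightarrow> complex) \<Rightarrow> complex) \<Rightarrow>
    (('a \<Rightarrow> complex) \<Rightarrow> complex) \<Rightarrow> ('a \<Rightarrow> complex) \<Rightarrow> complex" where
  "bidual_mult A \<Phi> \<Psi> = on_dual A (\<lambda>\<phi>.
     \<Phi> (on_carrier A (\<lambda>a. \<Psi> (on_carrier A (\<lambda>b. \<phi> (a \<otimes>\<^bsub>A\<^esub> b))))))"

definition bidual_adj :: "'a cstar_alg \<Rightarrow> (('a \<Rightarrow> complex) \<Rightarrow> complex) \<Rightarrow>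
    ('a \<Rightarrow> complex) \<Rightarrow> complex" where
  "bidual_adj A \<Phi> = on_dual A (\<lambda>\<phi>. cnj (\<Phi> (on_carrier A (\<lambda>a. cnj (\<phi> (adj A a))))))"

definition bidual :: "'a cstar_alg \<Rightarrow> (('a \<Rightarrow> complex) \<Rightarrow> complex) cstar_alg" where
  "bidual A = \<lparr>
     carrier = bidual_carrier A,
     monoid.mult = bidual_mult A,
     one = undefined,
     zero = (\<lambda>\<phi>. 0),
     add = (\<lambda>\<Phi> \<Psi> \<phi>. \<Phi> \<phi> + \<Psi> \<phi>),
     module.smult = (\<lambda>c \<Phi> \<phi>. c * \<Phi> \<phi>),
     adj = bidual_adj A,
     cnorm = (\<lambda>\<Phi>. Sup {cmod (\<Phi> \<phi>) | \<phi>. \<phi> \<in> cdual A \<and> dual_norm A \<phi> \<le> 1})\<rparr>"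

definition bidual_emb :: "'a cstar_alg \<Rightarrow> 'a \<Rightarrow> ('a \<Rightarrow> complex) \<Rightarrow> complex" where
  "bidual_emb A a = on_dual A (\<lambda>\<phi>. \<phi> a)"

definition bidual_action :: "'a cstar_alg \<Rightarrow> ('g \<Rightarrow> 'a \<Rightarrow> 'a) \<Rightarrow>
    'g \<Rightarrow> (('a \<Rightarrow> complex) \<Rightarrow> complex) \<Rightarrow> ('a \<Rightarrow> complex) \<Rightarrow> complex" where
  "bidual_action A \<alpha> g \<Phi> = on_dual A (\<lambda>\<phi>. \<Phi> (on_carrier A (\<lambda>a. \<phi> (\<alpha> g a))))"

section \<open>G-C*-algebras, the G-WEP and the G-QWEP\<close>

definition G_cstar_algebra ::
    "'a cstar_alg \<Rightarrow> ('g::topological_group_add \<Rightarrow> 'a \<Rightarrow> 'a) \<Rightarrow> bool" where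
  "G_cstar_algebra A \<alpha> \<longleftrightarrow>
     cstar_algebra A \<and>
     (\<forall>g. star_hom A A (\<alpha> g) \<and> bij_betw (\<alpha> g) (carrier A) (carrier A)) \<and>
     (\<forall>g h. \<forall>a\<in>carrier A. \<alpha> (g + h) a = \<alpha> g (\<alpha> h a)) \<and>
     (\<forall>a\<in>carrier A. \<forall>t. ((\<lambda>s. cnorm A (\<alpha> s a \<ominus>\<^bsub>A\<^esub> \<alpha> t a)) \<longlongrightarrow> 0) (at t))"

definition equivariant :: "'a cstar_alg \<Rightarrow> ('g \<Rightarrow> 'a \<Rightarrow> 'a) \<Rightarrow> ('g \<Rightarrow> 'b \<Rightarrow> 'b) \<Rightarrow>
    ('a \<Rightarrow> 'b) \<Rightarrow> bool" where
  "equivariant A \<alpha> \<beta> T \<longleftrightarrow> (\<forall>g. \<forall>a\<in>carrier A. T (\<alpha> g a) = \<beta> g (T a))"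

definition invariant_state :: "'a cstar_alg \<Rightarrow> ('g \<Rightarrow> 'a \<Rightarrow> 'a) \<Rightarrow> ('a \<Rightarrow> complex) \<Rightarrow> bool" where
  "invariant_state A \<alpha> \<phi> \<longleftrightarrow> state A \<phi> \<and> (\<forall>g. \<forall>a\<in>carrier A. \<phi> (\<alpha> g a) = \<phi> a)"

text \<open>
  HOL cannot quantify over all types inside a formula, so the algebras \<open>B\<close> containing a copy of
  \<open>A\<close> have their carriers in the type \<open>('g \<times> 'a) set\<close>. This loses nothing. Represent \<open>A\<close> faithfully
  on a Hilbert space \<open>H\<close>, the sum of the GNS spaces of \<open>|A|\<close> many states. Let \<open>B\<^sub>0\<close> be the algebra
  of bounded functions \<open>G \<rightarrow> B(H)\<close> on which translation is norm continuous. It contains \<open>A\<close>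
  equivariantly, and every equivariant completely positive contraction \<open>A \<rightarrow> B\<^sub>0\<close> extends to any
  G-C*-algebra containing \<open>A\<close>. So the existence of \<open>E\<close> for \<open>B\<^sub>0\<close> implies it for all \<open>B\<close>,
  and for \<open>A \<noteq> 0\<close> the algebra \<open>B\<^sub>0\<close> has at most \<open>2 ^ |G \<times> A|\<close> elements.
  Moreover, admitting fewer algebras \<open>B\<close> can only weaken the G-WEP, which makes the failure of
  G-WEP and G-QWEP a stronger assertion.
\<close>

definition G_WEP :: "'a cstar_alg \<Rightarrow> ('g::topological_group_add \<Rightarrow> 'a \<Rightarrow> 'a) \<Rightarrow> bool" where
  "G_WEP A \<alpha> \<longleftrightarrow>
     G_cstar_algebra A \<alpha> \<and>
     (\<forall>(B :: ('g \<times> 'a) set cstar_alg) \<beta> j.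
        G_cstar_algebra B \<beta> \<and> star_hom A B j \<and> inj_on j (carrier A) \<and> equivariant A \<alpha> \<beta> j \<longrightarrow>
        (\<exists>E. completely_positive B (bidual A) E \<and> contraction B (bidual A) E \<and>
             equivariant B \<beta> (bidual_action A \<alpha>) E \<and>
             (\<forall>a\<in>carrier A. E (j a) = bidual_emb A a)))"

text \<open>
  The first argument names the type on which the algebra \<open>D\<close> mapping onto \<open>A\<close> lives; the absolute
  notion is obtained by letting it range over all types.
\<close>

definition G_QWEP :: "'d itself \<Rightarrow> 'a cstar_alg \<Rightarrow>
    ('g::topological_group_add \<Rightarrow> 'a \<Rightarrow> 'a) \<Rightarrow> bool" where
  "G_QWEP T A \<alpha> \<longleftrightarrow>
     (\<exists>(D :: 'd cstar_alg) \<delta> q.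
        G_WEP D \<delta> \<and> star_hom D A q \<and> equivariant D \<delta> \<alpha> q \<and> q ` carrier D = carrier A)"

section \<open>Amenability\<close>

text \<open>
  Amenability is the existence of a left-invariant mean on \<open>UCB(G)\<close>, the bounded functions \<open>f\<close> for
  which \<open>g \<mapsto> g.f\<close>, where \<open>(g.f)(x) = f(g\<^sup>-\<^sup>1 x)\<close>, is continuous in the supremum norm (this forces
  \<open>f\<close> to be continuous). This is the definition of Bekka, de la Harpe and Valette; it
  needs no Haar measure, and for locally compact groups it agrees with the one by means on
  \<open>L\<^sup>\<infinity>(G)\<close>.
\<close>

definition UCB :: "('g::topological_group_add \<Rightarrow> complex) set" where
  "UCB = {f. bounded (range f) \<and>
     (\<forall>s. uniform_limit UNIV (\<lambda>g x. f (- g + x)) (\<lambda>x. f (- s + x)) (at s))}"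

definition amenable :: "'g::topological_group_add itself \<Rightarrow> bool" where
  "amenable T \<longleftrightarrow> (\<exists>m :: ('g \<Rightarrow> complex) \<Rightarrow> complex.
     (\<forall>f\<in>UCB. \<forall>h\<in>UCB. m (\<lambda>x. f x + h x) = m f + m h) \<and>
     (\<forall>c. \<forall>f\<in>UCB. m (\<lambda>x. c * f x) = c * m f) \<and>
     (\<forall>f\<in>UCB. (\<forall>x. f x \<in> \<real>\<^sub>\<ge>\<^sub>0) \<longrightarrow> m f \<in> \<real>\<^sub>\<ge>\<^sub>0) \<and>
     m (\<lambda>x. 1) = 1 \<and>
     (\<forall>g. \<forall>f\<in>UCB. m (\<lambda>x. f (- g + x)) = m f))"

section \<open>The full group C*-algebra\<close>

definition left_haar_measure ::
    "'g::{topological_group_add, t2_space} measure \<Rightarrow> bool" where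
  "left_haar_measure \<mu> \<longleftrightarrow>
     sets \<mu> = sets borel \<and>
     emeasure \<mu> UNIV \<noteq> 0 \<and>
     (\<forall>K. compact K \<longrightarrow> emeasure \<mu> K < \<infinity>) \<and>
     (\<forall>S\<in>sets borel. emeasure \<mu> S = (INF U\<in>{U. open U \<and> S \<subseteq> U}. emeasure \<mu> U)) \<and>
     (\<forall>U. open U \<longrightarrow> emeasure \<mu> U = (SUP K\<in>{K. compact K \<and> K \<subseteq> U}. emeasure \<mu> K)) \<and>
     (\<forall>g. \<forall>S\<in>sets borel. emeasure \<mu> ((\<lambda>x. g + x) ` S) = emeasure \<mu> S)"

definition modular_function ::
    "'g::{topological_group_add, t2_space} measure \<Rightarrow> ('g \<Rightarrow> real) \<Rightarrow> bool" where
  "modular_function \<mu> \<Delta> \<longleftrightarrow>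
     (\<forall>s. 0 < \<Delta> s \<and>
       (\<forall>S\<in>sets borel. emeasure \<mu> ((\<lambda>x. x + s) ` S) = ennreal (\<Delta> s) * emeasure \<mu> S))"

definition Cc :: "('g::topological_space \<Rightarrow> complex) set" where
  "Cc = {f. continuous_on UNIV f \<and> compact (closure {x. f x \<noteq> 0})}"

definition convolution :: "'g::{topological_group_add, t2_space} measure \<Rightarrow>
    ('g \<Rightarrow> complex) \<Rightarrow> ('g \<Rightarrow> complex) \<Rightarrow> 'g \<Rightarrow> complex" where
  "convolution \<mu> f h = (\<lambda>s. LINT t|\<mu>. f t * h (- t + s))"

definition involution :: "('g::topological_group_add \<Rightarrow> real) \<Rightarrow> ('g \<Rightarrow> complex) \<Rightarrow>
    'g \<Rightarrow> complex" where
  "involution \<Delta> f = (\<lambda>s. of_real (\<Delta> (- s)) * cnj (f (- s)))"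

definition Cc_cstar_seminorm :: "'g::{topological_group_add, t2_space} measure \<Rightarrow>
    ('g \<Rightarrow> real) \<Rightarrow> (('g \<Rightarrow> complex) \<Rightarrow> real) \<Rightarrow> bool" where
  "Cc_cstar_seminorm \<mu> \<Delta> p \<longleftrightarrow>
     (\<forall>f\<in>Cc. 0 \<le> p f \<and> p f \<le> (LINT s|\<mu>. cmod (f s))) \<and>
     (\<forall>f\<in>Cc. \<forall>h\<in>Cc. p (\<lambda>s. f s + h s) \<le> p f + p h) \<and>
     (\<forall>c. \<forall>f\<in>Cc. p (\<lambda>s. c * f s) = cmod c * p f) \<and>
     (\<forall>f\<in>Cc. \<forall>h\<in>Cc. p (convolution \<mu> f h) \<le> p f * p h) \<and>
     (\<forall>f\<in>Cc. p (convolution \<mu> (involution \<Delta> f) f) = (p f)\<^sup>2)"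

definition full_group_norm :: "'g::{topological_group_add, t2_space} measure \<Rightarrow>
    ('g \<Rightarrow> real) \<Rightarrow> ('g \<Rightarrow> complex) \<Rightarrow> real" where
  "full_group_norm \<mu> \<Delta> f = Sup {p f | p. Cc_cstar_seminorm \<mu> \<Delta> p}"

text \<open>
  \<open>C*(G)\<close> is the completion of the convolution algebra \<open>C_c(G)\<close> in its largest C*-seminorm
  dominated by the \<open>L\<^sup>1\<close>-norm. It is given here as a C*-algebra \<open>C\<close> together with the canonical map
  \<open>\<iota> : C_c(G) \<rightarrow> C\<close>; the pair is determined up to isomorphism.
\<close>

definition full_group_cstar_algebra :: "'g::{topological_group_add, t2_space} measure \<Rightarrow>
    ('g \<Rightarrow> real) \<Rightarrow> 'c cstar_alg \<Rightarrow> (('g \<Rightarrow> complex) \<Rightarrow> 'c) \<Rightarrow> bool" where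
  "full_group_cstar_algebra \<mu> \<Delta> C \<iota> \<longleftrightarrow>
     cstar_algebra C \<and>
     (\<forall>f\<in>Cc. \<iota> f \<in> carrier C) \<and>
     (\<forall>f\<in>Cc. \<forall>h\<in>Cc. \<iota> (\<lambda>s. f s + h s) = \<iota> f \<oplus>\<^bsub>C\<^esub> \<iota> h) \<and>
     (\<forall>c. \<forall>f\<in>Cc. \<iota> (\<lambda>s. c * f s) = c \<odot>\<^bsub>C\<^esub> \<iota> f) \<and>
     (\<forall>f\<in>Cc. \<forall>h\<in>Cc. \<iota> (convolution \<mu> f h) = \<iota> f \<otimes>\<^bsub>C\<^esub> \<iota> h) \<and>
     (\<forall>f\<in>Cc. \<iota> (involution \<Delta> f) = adj C (\<iota> f)) \<and>
     (\<forall>f\<in>Cc. cnorm C (\<iota> f) = full_group_norm \<mu> \<Delta> f) \<and>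
     (\<forall>x\<in>carrier C. \<forall>e>0. \<exists>f\<in>Cc. cnorm C (x \<ominus>\<^bsub>C\<^esub> \<iota> f) < e)"

text \<open>
  Elements of \<open>M(C)\<close> are double centralizers \<open>m = (L, R)\<close>; \<open>L x\<close> is the product \<open>m x\<close> and \<open>R x\<close>
  is \<open>x m\<close>. The adjoint is \<open>m* = (R*, L*)\<close>, where \<open>T* x = (T x*)*\<close>, and \<open>m n\<close> has components
  \<open>L\<^sub>m \<circ> L\<^sub>n\<close> and \<open>R\<^sub>n \<circ> R\<^sub>m\<close>.
\<close>

definition multiplier :: "'c cstar_alg \<Rightarrow> ('c \<Rightarrow> 'c) \<times> ('c \<Rightarrow> 'c) \<Rightarrow> bool" where
  "multiplier C m \<longleftrightarrow>
     linear_map C C (fst m) \<and> linear_map C C (snd m) \<and>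
     (\<exists>K. \<forall>x\<in>carrier C. cnorm C (fst m x) \<le> K * cnorm C x \<and> cnorm C (snd m x) \<le> K * cnorm C x) \<and>
     (\<forall>x\<in>carrier C. \<forall>y\<in>carrier C.
        fst m (x \<otimes>\<^bsub>C\<^esub> y) = fst m x \<otimes>\<^bsub>C\<^esub> y \<and>
        snd m (x \<otimes>\<^bsub>C\<^esub> y) = x \<otimes>\<^bsub>C\<^esub> snd m y \<and>
        snd m x \<otimes>\<^bsub>C\<^esub> y = x \<otimes>\<^bsub>C\<^esub> fst m y)"

definition multiplier_adj :: "'c cstar_alg \<Rightarrow> ('c \<Rightarrow> 'c) \<times> ('c \<Rightarrow> 'c) \<Rightarrow> ('c \<Rightarrow> 'c) \<times> ('c \<Rightarrow> 'c)" where
  "multiplier_adj C m = (\<lambda>x. adj C (snd m (adj C x)), \<lambda>x. adj C (fst m (adj C x)))"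

definition unitary_multiplier :: "'c cstar_alg \<Rightarrow> ('c \<Rightarrow> 'c) \<times> ('c \<Rightarrow> 'c) \<Rightarrow> bool" where
  "unitary_multiplier C m \<longleftrightarrow> multiplier C m \<and>
     (\<forall>x\<in>carrier C.
        fst m (fst (multiplier_adj C m) x) = x \<and> fst (multiplier_adj C m) (fst m x) = x \<and>
        snd m (snd (multiplier_adj C m) x) = x \<and> snd (multiplier_adj C m) (snd m x) = x)"

text \<open>The canonical unitaries are determined by \<open>u\<^sub>g \<iota>(f) = \<iota>(g.f)\<close>, where \<open>(g.f)(s) = f(g\<^sup>-\<^sup>1 s)\<close>.\<close>

definition canonical_unitaries :: "'c cstar_alg \<Rightarrow> (('g::topological_group_add \<Rightarrow> complex) \<Rightarrow> 'c) \<Rightarrow>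
    ('g \<Rightarrow> ('c \<Rightarrow> 'c) \<times> ('c \<Rightarrow> 'c)) \<Rightarrow> bool" where
  "canonical_unitaries C \<iota> u \<longleftrightarrow>
     (\<forall>g. unitary_multiplier C (u g) \<and>
          (\<forall>f\<in>Cc. fst (u g) (\<iota> f) = \<iota> (\<lambda>s. f (- g + s))))"

text \<open>\<open>x \<mapsto> u\<^sub>g x u\<^sub>g*\<close>\<close>

definition conjugation_action :: "'c cstar_alg \<Rightarrow> ('g \<Rightarrow> ('c \<Rightarrow> 'c) \<times> ('c \<Rightarrow> 'c)) \<Rightarrow>
    'g \<Rightarrow> 'c \<Rightarrow> 'c" where
  "conjugation_action C u g x = snd (multiplier_adj C (u g)) (fst (u g) x)"

end

theory Submission
  imports Defs
begin

text \<open>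
  Let \<open>D\<close> have the G-WEP and map onto \<open>A\<close>. An invariant state of \<open>A\<close> pulls back to a nonzero
  invariant functional on \<open>D\<close>, bounded because *-homomorphisms are contractive; scale it to a
  functional \<open>\<psi>\<close> of norm \<open>1\<close>. Embed \<open>D\<close> into the algebra \<open>B\<close> of bounded, left uniformly continuous
  functions \<open>G \<rightarrow> D\<close> by \<open>d \<mapsto> (x \<mapsto> \<alpha>\<^sub>x\<^sup>-\<^sup>1(d))\<close>; then \<open>G\<close> acts on \<open>B\<close> by translation. The map
  \<open>E : B \<rightarrow> D**\<close> followed by evaluation at \<open>\<psi>\<close> is an invariant contractive functional \<open>\<tau>\<close> on \<open>B\<close>
  that extends \<open>\<psi>\<close>. For contractions \<open>d, e\<close> with \<open>\<psi>(d), \<psi>(e)\<close> close to \<open>1\<close> and \<open>0 \<le> f \<le> 1\<close>, the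
  element \<open>f d + (1 - f) e\<close> of \<open>B\<close> is a contraction, so \<open>\<tau>(f d) - \<tau>(f e)\<close> is small. Hence
  \<open>m(f) = lim \<tau>(f d\<^sub>n)\<close> exists whenever \<open>\<psi>(d\<^sub>n) \<rightarrow> 1\<close>, it does not change when \<open>d\<^sub>n\<close> is replaced by
  \<open>\<alpha>\<^sub>g(d\<^sub>n)\<close>, and it is an invariant mean. For \<open>C*(G)\<close> the invariant functional is the trivial character \<open>f \<mapsto> \<integral> f d\<mu>\<close>.
\<close>

section \<open>Quasi-inverses and automatic contractivity\<close>

text \<open>The obstacle is that \<open>D\<close> may have no unit. If it had one with
  \<open>\<psi>(1) = 1\<close>, the mean would be \<open>f \<mapsto> \<tau>(f 1)\<close>. Instead 1
  is replaced by contractions on which \<open>\<psi>\<close> is almost 1, and everything rests on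
  \<open>\<tau>(f d)\<close> hardly depending on which of them is taken. The reason is the shape of
  the unit disc: with \<open>z = \<tau>(f d) - \<tau>(f e)\<close>, both
  \<open>\<psi>(e) + z\<close> and, after exchanging \<open>d\<close> and \<open>e\<close>,
  \<open>\<psi>(d) - z\<close> have modulus at most 1, while \<open>\<psi>(d)\<close> and
  \<open>\<psi>(e)\<close> are close to the boundary point 1. So \<open>z\<close> is small, its
  imaginary part only of the order of a square root. The pulled-back functional must be bounded,
  hence the long proof that *-homomorphisms are contractive; it has to work with neither a unit nor
  a spectral theory. The same result shows that the action is isometric, which makes the embedding
  into \<open>B\<close> uniformly continuous. For the group algebra, the work lies in showing that
  the integral is multiplicative and *-preserving on \<open>C_c(G)\<close>: then it is one of the
  seminorms over which the full norm is a supremum, so it extends to the completion.\<close>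

lemma complex_cring_simps [simp]:
  "carrier complex_cring = UNIV" "\<one>\<^bsub>complex_cring\<^esub> = 1" "\<zero>\<^bsub>complex_cring\<^esub> = 0"
  "x \<otimes>\<^bsub>complex_cring\<^esub> y = x * y" "x \<oplus>\<^bsub>complex_cring\<^esub> y = x + y"
  by (simp_all add: complex_cring_def)

lemma cring_complex_cring: "cring complex_cring"
proof (rule cringI)
  show "abelian_group complex_cring"
    by (rule abelian_groupI) (auto simp: algebra_simps intro: exI[of _ "- x" for x])
  show "comm_monoid complex_cring"
    by unfold_locales (auto simp: algebra_simps)
qed (simp add: algebra_simps)

lemma complex_cring_minus [simp]: "\<ominus>\<^bsub>complex_cring\<^esub> x = - x"
proof -
  interpret cring complex_cring by (rule cring_complex_cring)
  show ?thesis by (rule minus_equality) simp_all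
qed

section \<open>Arithmetic and norm estimates in a C*-algebra\<close>

locale cstar =
  fixes A :: "'a cstar_alg" (structure)
  assumes cstar: "cstar_algebra A"
begin

sublocale Module.module complex_cring A
  using cstar by (simp add: cstar_algebra_def)

lemma mult_closed [simp, intro]: "x \<in> carrier A \<Longrightarrow> y \<in> carrier A \<Longrightarrow> x \<otimes> y \<in> carrier A"
  using cstar by (simp add: cstar_algebra_def)

lemma mult_assoc:
  "x \<in> carrier A \<Longrightarrow> y \<in> carrier A \<Longrightarrow> z \<in> carrier A \<Longrightarrow> (x \<otimes> y) \<otimes> z = x \<otimes> (y \<otimes> z)"
  using cstar by (simp add: cstar_algebra_def)

lemma distr_r: "x \<in> carrier A \<Longrightarrow> y \<in> carrier A \<Longrightarrow> z \<in> carrier A \<Longrightarrow>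
    (x \<oplus> y) \<otimes> z = (x \<otimes> z) \<oplus> (y \<otimes> z)"
  using cstar by (simp add: cstar_algebra_def)

lemma distr_l: "x \<in> carrier A \<Longrightarrow> y \<in> carrier A \<Longrightarrow> z \<in> carrier A \<Longrightarrow>
    z \<otimes> (x \<oplus> y) = (z \<otimes> x) \<oplus> (z \<otimes> y)"
  using cstar by (simp add: cstar_algebra_def)

lemma smult_mult_l: "x \<in> carrier A \<Longrightarrow> y \<in> carrier A \<Longrightarrow> (c \<odot> x) \<otimes> y = c \<odot> (x \<otimes> y)"
  using cstar by (simp add: cstar_algebra_def)

lemma smult_mult_r: "x \<in> carrier A \<Longrightarrow> y \<in> carrier A \<Longrightarrow> x \<otimes> (c \<odot> y) = c \<odot> (x \<otimes> y)"
  using cstar by (simp add: cstar_algebra_def)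

lemma adj_closed [simp, intro]: "x \<in> carrier A \<Longrightarrow> adj A x \<in> carrier A"
  using cstar by (simp add: cstar_algebra_def)

lemma adj_adj [simp]: "x \<in> carrier A \<Longrightarrow> adj A (adj A x) = x"
  using cstar by (simp add: cstar_algebra_def)

lemma adj_add: "x \<in> carrier A \<Longrightarrow> y \<in> carrier A \<Longrightarrow> adj A (x \<oplus> y) = adj A x \<oplus> adj A y"
  using cstar by (simp add: cstar_algebra_def)

lemma adj_mult: "x \<in> carrier A \<Longrightarrow> y \<in> carrier A \<Longrightarrow> adj A (x \<otimes> y) = adj A y \<otimes> adj A x"
  using cstar by (simp add: cstar_algebra_def)

lemma adj_smult: "x \<in> carrier A \<Longrightarrow> adj A (c \<odot> x) = cnj c \<odot> adj A x"
  using cstar by (simp add: cstar_algebra_def)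

lemma norm_ge_0 [simp]: "x \<in> carrier A \<Longrightarrow> 0 \<le> cnorm A x"
  using cstar by (simp add: cstar_algebra_def)

lemma norm_eq_0 [simp]: "x \<in> carrier A \<Longrightarrow> cnorm A x = 0 \<longleftrightarrow> x = \<zero>"
  using cstar by (simp add: cstar_algebra_def)

lemma norm_smult: "x \<in> carrier A \<Longrightarrow> cnorm A (c \<odot> x) = cmod c * cnorm A x"
  using cstar by (simp add: cstar_algebra_def)

lemma norm_triangle: "x \<in> carrier A \<Longrightarrow> y \<in> carrier A \<Longrightarrow> cnorm A (x \<oplus> y) \<le> cnorm A x + cnorm A y"
  using cstar by (simp add: cstar_algebra_def)

lemma norm_mult: "x \<in> carrier A \<Longrightarrow> y \<in> carrier A \<Longrightarrow> cnorm A (x \<otimes> y) \<le> cnorm A x * cnorm A y"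
  using cstar by (simp add: cstar_algebra_def)

lemma norm_adj_mult: "x \<in> carrier A \<Longrightarrow> cnorm A (adj A x \<otimes> x) = (cnorm A x)\<^sup>2"
  using cstar by (simp add: cstar_algebra_def)

lemma complete: "(\<And>n::nat. X n \<in> carrier A) \<Longrightarrow>
     (\<And>e. e > 0 \<Longrightarrow> \<exists>N. \<forall>m\<ge>N. \<forall>n\<ge>N. cnorm A (X m \<ominus> X n) < e) \<Longrightarrow>
     \<exists>x\<in>carrier A. (\<lambda>n. cnorm A (X n \<ominus> x)) \<longlonglongrightarrow> 0"
  using cstar unfolding cstar_algebra_def by (elim conjE) (drule spec[where x = X], blast)

lemma norm_zero [simp]: "cnorm A \<zero> = 0" by simp

lemma smult_1 [simp]: "x \<in> carrier A \<Longrightarrow> 1 \<odot> x = x"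
  using smult_one[of x] by simp

lemma smult_0 [simp]: "x \<in> carrier A \<Longrightarrow> 0 \<odot> x = \<zero>"
  using smult_l_null[of x] by simp

lemma minus_smult: "x \<in> carrier A \<Longrightarrow> \<ominus> x = (-1) \<odot> x"
  using smult_l_minus[of 1 x] by simp

lemma norm_minus [simp]: "x \<in> carrier A \<Longrightarrow> cnorm A (\<ominus> x) = cnorm A x"
  by (simp add: minus_smult norm_smult)

lemma smult_smult: "x \<in> carrier A \<Longrightarrow> a \<odot> (b \<odot> x) = (a * b) \<odot> x"
  using smult_assoc1[of a b x] by simp

lemma smult_add_l: "x \<in> carrier A \<Longrightarrow> (a + b) \<odot> x = a \<odot> x \<oplus> b \<odot> x"
  using smult_l_distr[of a b x] by simp

lemma smult_diff_l: "x \<in> carrier A \<Longrightarrow> (a - b) \<odot> x = a \<odot> x \<ominus> b \<odot> x"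
  using smult_add_l[of x a "-b"] by (simp add: a_minus_def minus_smult smult_smult)

lemma smult_add_r: "x \<in> carrier A \<Longrightarrow> y \<in> carrier A \<Longrightarrow> c \<odot> (x \<oplus> y) = c \<odot> x \<oplus> c \<odot> y"
  by (simp add: smult_r_distr)

lemma mult_minus_r: "x \<in> carrier A \<Longrightarrow> y \<in> carrier A \<Longrightarrow> x \<otimes> (\<ominus> y) = \<ominus> (x \<otimes> y)"
  by (simp add: minus_smult smult_mult_r)

lemma mult_minus_l: "x \<in> carrier A \<Longrightarrow> y \<in> carrier A \<Longrightarrow> (\<ominus> x) \<otimes> y = \<ominus> (x \<otimes> y)"
  by (simp add: minus_smult smult_mult_l)

lemma diff_distr_l: "x \<in> carrier A \<Longrightarrow> y \<in> carrier A \<Longrightarrow> z \<in> carrier A \<Longrightarrow>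
    z \<otimes> (x \<ominus> y) = z \<otimes> x \<ominus> z \<otimes> y"
  by (simp add: a_minus_def distr_l mult_minus_r)

lemma diff_distr_r: "x \<in> carrier A \<Longrightarrow> y \<in> carrier A \<Longrightarrow> z \<in> carrier A \<Longrightarrow>
    (x \<ominus> y) \<otimes> z = x \<otimes> z \<ominus> y \<otimes> z"
  by (simp add: a_minus_def distr_r mult_minus_l)

lemma smult_diff_r: "x \<in> carrier A \<Longrightarrow> y \<in> carrier A \<Longrightarrow> c \<odot> (x \<ominus> y) = c \<odot> x \<ominus> c \<odot> y"
  by (simp add: a_minus_def smult_add_r minus_smult smult_smult mult.commute)

lemma adj_minus: "x \<in> carrier A \<Longrightarrow> adj A (\<ominus> x) = \<ominus> adj A x"
  by (simp add: minus_smult adj_smult)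

lemma adj_diff: "x \<in> carrier A \<Longrightarrow> y \<in> carrier A \<Longrightarrow> adj A (x \<ominus> y) = adj A x \<ominus> adj A y"
  by (simp add: a_minus_def adj_add adj_minus)

lemma diff_add_diff:
  "x \<in> carrier A \<Longrightarrow> y \<in> carrier A \<Longrightarrow> z \<in> carrier A \<Longrightarrow> (x \<ominus> y) \<oplus> (y \<ominus> z) = x \<ominus> z"
  by (simp add: a_minus_def a_assoc r_neg1)

lemma minus_diff: "x \<in> carrier A \<Longrightarrow> y \<in> carrier A \<Longrightarrow> \<ominus> (x \<ominus> y) = y \<ominus> x"
  by (simp add: a_minus_def minus_add a_comm)

lemma diff_add_cancel: "x \<in> carrier A \<Longrightarrow> y \<in> carrier A \<Longrightarrow> (x \<ominus> y) \<oplus> y = x"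
  by (simp add: a_minus_def a_assoc l_neg)

lemma diff_eq_zero: "x \<in> carrier A \<Longrightarrow> y \<in> carrier A \<Longrightarrow> x \<ominus> y = \<zero> \<longleftrightarrow> x = y"
  by (metis diff_add_cancel l_zero a_minus_def r_neg)

lemma add_diff_add: "x \<in> carrier A \<Longrightarrow> y \<in> carrier A \<Longrightarrow> z \<in> carrier A \<Longrightarrow> w \<in> carrier A \<Longrightarrow>
    (x \<oplus> y) \<ominus> (z \<oplus> w) = (x \<ominus> z) \<oplus> (y \<ominus> w)"
  by (simp add: a_minus_def minus_add a_ac)

lemma add_diff_cancel_l: "x \<in> carrier A \<Longrightarrow> y \<in> carrier A \<Longrightarrow> z \<in> carrier A \<Longrightarrow>
    (x \<oplus> y) \<ominus> (x \<oplus> z) = y \<ominus> z"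
  by (simp add: add_diff_add) (simp add: a_minus_def r_neg)

lemma norm_diff_commute: "x \<in> carrier A \<Longrightarrow> y \<in> carrier A \<Longrightarrow> cnorm A (x \<ominus> y) = cnorm A (y \<ominus> x)"
  by (metis minus_closed minus_diff norm_minus)

lemma norm_diff_triangle: "x \<in> carrier A \<Longrightarrow> y \<in> carrier A \<Longrightarrow> z \<in> carrier A \<Longrightarrow>
    cnorm A (x \<ominus> z) \<le> cnorm A (x \<ominus> y) + cnorm A (y \<ominus> z)"
  by (metis diff_add_diff minus_closed norm_triangle)

lemma norm_diff_le: "x \<in> carrier A \<Longrightarrow> y \<in> carrier A \<Longrightarrow> cnorm A (x \<ominus> y) \<le> cnorm A x + cnorm A y"
  using norm_triangle[of x "\<ominus> y"] by (simp add: a_minus_def)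

lemma norm_le_diff: "x \<in> carrier A \<Longrightarrow> y \<in> carrier A \<Longrightarrow> cnorm A x \<le> cnorm A (x \<ominus> y) + cnorm A y"
  using norm_triangle[of "x \<ominus> y" y] by (simp add: diff_add_cancel)

lemma norm_le_add: "x \<in> carrier A \<Longrightarrow> y \<in> carrier A \<Longrightarrow> cnorm A x \<le> cnorm A (x \<oplus> y) + cnorm A y"
  using norm_le_diff[of x "\<ominus> y"] by (simp add: a_minus_def)

text \<open>The C*-identity gives \<open>||y||^2 = ||y* y|| <= ||y*|| ||y||\<close>; cancel
  \<open>||y||\<close>, then exchange \<open>y\<close> and \<open>y*\<close>.\<close>

lemma norm_adj [simp]: assumes "x \<in> carrier A" shows "cnorm A (adj A x) = cnorm A x"
proof -
  have le: "cnorm A y \<le> cnorm A (adj A y)" if y: "y \<in> carrier A" for y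
  proof (cases "cnorm A y = 0")
    case False
    have "cnorm A y * cnorm A y \<le> cnorm A (adj A y) * cnorm A y"
      using norm_mult[of "adj A y" y] norm_adj_mult[OF y] y by (simp add: power2_eq_square)
    then show ?thesis using False norm_ge_0[OF y] by (simp add: mult_le_cancel_right)
  qed (use y in simp)
  show ?thesis using le[OF assms] le[of "adj A x"] assms by simp
qed

lemma tendsto_unique_norm:
  assumes "\<And>n::nat. X n \<in> carrier A" "x \<in> carrier A" "y \<in> carrier A"
    "(\<lambda>n. cnorm A (X n \<ominus> x)) \<longlonglongrightarrow> 0" "(\<lambda>n. cnorm A (X n \<ominus> y)) \<longlonglongrightarrow> 0"
  shows "x = y"
proof -
  have "(\<lambda>n. cnorm A (X n \<ominus> x) + cnorm A (X n \<ominus> y)) \<longlonglongrightarrow> 0"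
    using tendsto_add[OF assms(4,5)] by simp
  moreover have "cnorm A (x \<ominus> y) \<le> cnorm A (X n \<ominus> x) + cnorm A (X n \<ominus> y)" for n
    using norm_diff_triangle[of x "X n" y] norm_diff_commute[of x "X n"] assms by simp
  ultimately have "cnorm A (x \<ominus> y) \<le> 0"
    by (intro LIMSEQ_le_const) auto
  then have "cnorm A (x \<ominus> y) = 0"
    using norm_ge_0[of "x \<ominus> y"] minus_closed[OF assms(2,3)] by linarith
  then show ?thesis using assms by (simp add: diff_eq_zero)
qed

text \<open>Without a unit \<open>1 - y\<close> makes no sense. Multiplying out
  \<open>(1 - y)(1 + s) = 1\<close> and \<open>(1 + s)(1 - y) = 1\<close> leaves exactly these two
  equations.\<close>

definition quasi_inv :: "'a \<Rightarrow> 'a \<Rightarrow> bool" where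
  "quasi_inv y s \<longleftrightarrow> s \<in> carrier A \<and> s = y \<oplus> y \<otimes> s \<and> s = y \<oplus> s \<otimes> y"

text \<open>The Neumann series \<open>y + y^2 + ...\<close>, with partial sums \<open>X n\<close>
  computed by Horner's rule; successive differences are powers of \<open>y\<close>, so a geometric
  series bounds the tails.\<close>

lemma quasi_inv_exists:
  assumes y: "y \<in> carrier A" and less: "cnorm A y < 1"
  shows "\<exists>s. quasi_inv y s"
proof -
  define r where "r = cnorm A y"
  have r: "0 \<le> r" "r < 1" using y less by (auto simp: r_def)
  define X where "X = rec_nat y (\<lambda>_ s. y \<oplus> y \<otimes> s)"
  have X0: "X 0 = y" and XS: "X (Suc n) = y \<oplus> y \<otimes> X n" for n by (simp_all add: X_def)
  have X: "X n \<in> carrier A" for n by (induct n) (use y in \<open>auto simp: X0 XS\<close>)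
  \<comment> \<open>The partial sums commute with \<open>y\<close>. This second recursion yields the
    right-hand equation in the limit, as \<open>XS\<close> yields the left-hand one.\<close>
  have XS': "X (Suc n) = y \<oplus> X n \<otimes> y" for n
  proof (induct n)
    case (Suc n)
    have "X (Suc (Suc n)) = y \<oplus> y \<otimes> (y \<oplus> X n \<otimes> y)" by (simp only: XS[of "Suc n"] Suc)
    also have "\<dots> = y \<oplus> (y \<oplus> y \<otimes> X n) \<otimes> y"
      using y X[of n] by (simp add: distr_l distr_r mult_assoc)
    finally show ?case by (simp only: XS[of n])
  qed (simp add: XS X0)
  have step: "cnorm A (X (Suc n) \<ominus> X n) \<le> r ^ Suc n" for n
  proof (induct n)
    case 0
    have "X (Suc 0) \<ominus> X 0 = y \<otimes> y"
      using y by (simp add: XS X0 a_minus_def a_ac r_neg2 r_neg1)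
    then show ?case using norm_mult[OF y y] r y
      by (simp add: r_def) (smt (verit) less mult_left_le norm_ge_0)
  next
    case (Suc n)
    have "X (Suc (Suc n)) \<ominus> X (Suc n) = y \<otimes> (X (Suc n) \<ominus> X n)"
      unfolding XS[of "Suc n"] using y X[of n] X[of "Suc n"]
      by (subst (2) XS) (simp add: add_diff_cancel_l diff_distr_l)
    then show ?case
      using norm_mult[of y "X (Suc n) \<ominus> X n"] Suc r X y
      by (simp add: r_def[symmetric]) (smt (verit) mult_left_mono)
  qed
  have dist: "cnorm A (X (n + k) \<ominus> X n) \<le> r ^ n / (1 - r)" for n k
  proof -
    have "cnorm A (X (n + k) \<ominus> X n) \<le> (\<Sum>i<k. r ^ (n + i))"
    proof (induct k)
      case 0 then show ?case using X[of n] by (simp add: a_minus_def r_neg)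
    next
      case (Suc k)
      have "cnorm A (X (n + Suc k) \<ominus> X n) \<le>
          cnorm A (X (Suc (n + k)) \<ominus> X (n + k)) + cnorm A (X (n + k) \<ominus> X n)"
        using norm_diff_triangle X by simp
      also have "\<dots> \<le> r ^ Suc (n + k) + (\<Sum>i<k. r ^ (n + i))"
        by (intro add_mono step Suc)
      also have "r ^ Suc (n + k) \<le> r ^ (n + k)"
        using r by (simp add: mult_left_le_one_le)
      finally show ?case by simp
    qed
    also have "\<dots> = r ^ n * (\<Sum>i<k. r ^ i)" by (simp add: power_add sum_distrib_left)
    also have "(\<Sum>i<k. r ^ i) \<le> 1 / (1 - r)"
      using r by (simp add: sum_gp_strict divide_right_mono)
    finally show ?thesis using r by (simp add: mult_left_mono)
  qed
  have "\<exists>s\<in>carrier A. (\<lambda>n. cnorm A (X n \<ominus> s)) \<longlonglongrightarrow> 0"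
  proof (rule complete[OF X])
    fix e :: real assume e: "e > 0"
    have "(\<lambda>n. r ^ n / (1 - r)) \<longlonglongrightarrow> 0"
      using r tendsto_divide[OF LIMSEQ_realpow_zero tendsto_const, of r "1 - r"] by simp
    then obtain N where N: "\<And>n. n \<ge> N \<Longrightarrow> r ^ n / (1 - r) < e"
      using e order_tendstoD(2)[of _ 0 sequentially e] by (auto simp: eventually_sequentially)
    have main: "cnorm A (X m \<ominus> X n) < e" if "n \<ge> N" "n \<le> m" for m n
      using dist[of n "m - n"] N[of n] that by simp
    then have "cnorm A (X m \<ominus> X n) < e" if "n \<ge> N" "m \<ge> N" for m n
      using that by (metis X nle_le norm_diff_commute)
    then show "\<exists>N. \<forall>m\<ge>N. \<forall>n\<ge>N. cnorm A (X m \<ominus> X n) < e" by blast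
  qed
  then obtain s where s: "s \<in> carrier A" and lim: "(\<lambda>n. cnorm A (X n \<ominus> s)) \<longlonglongrightarrow> 0"
    by blast
  have lim': "(\<lambda>n. cnorm A (X (Suc n) \<ominus> s)) \<longlonglongrightarrow> 0" using LIMSEQ_Suc[OF lim] .
  have "s = y \<oplus> y \<otimes> s"
  proof (rule tendsto_unique_norm[of "\<lambda>n. X (Suc n)"])
    have "X (Suc n) \<ominus> (y \<oplus> y \<otimes> s) = y \<otimes> (X n \<ominus> s)" for n
      unfolding XS using y s X by (simp add: add_diff_cancel_l diff_distr_l)
    then have "cnorm A (X (Suc n) \<ominus> (y \<oplus> y \<otimes> s)) \<le> r * cnorm A (X n \<ominus> s)" for n
      using norm_mult[of y "X n \<ominus> s"] y s X by (simp add: r_def)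
    then show "(\<lambda>n. cnorm A (X (Suc n) \<ominus> (y \<oplus> y \<otimes> s))) \<longlonglongrightarrow> 0"
      using y s X by (intro Lim_null_comparison[OF _ tendsto_mult_right_zero[OF lim, of r]]) simp
  qed (use y s X lim' in auto)
  moreover have "s = y \<oplus> s \<otimes> y"
  proof (rule tendsto_unique_norm[of "\<lambda>n. X (Suc n)"])
    have "X (Suc n) \<ominus> (y \<oplus> s \<otimes> y) = (X n \<ominus> s) \<otimes> y" for n
      unfolding XS' using y s X by (simp add: add_diff_cancel_l diff_distr_r)
    then have "cnorm A (X (Suc n) \<ominus> (y \<oplus> s \<otimes> y)) \<le> cnorm A (X n \<ominus> s) * r" for n
      using norm_mult[of "X n \<ominus> s" y] y s X by (simp add: r_def)
    then show "(\<lambda>n. cnorm A (X (Suc n) \<ominus> (y \<oplus> s \<otimes> y))) \<longlonglongrightarrow> 0"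
      using y s X by (intro Lim_null_comparison[OF _ tendsto_mult_left_zero[OF lim, of r]]) simp
  qed (use y s X lim' in auto)
  ultimately show ?thesis using s unfolding quasi_inv_def by blast
qed

text \<open>The difference \<open>d\<close> of two solutions satisfies \<open>d = y d\<close>, so
  \<open>||d|| <= ||y|| ||d||\<close> with \<open>||y|| < 1\<close>.\<close>

lemma quasi_inv_unique:
  assumes y: "y \<in> carrier A" "cnorm A y < 1"
    and s: "s \<in> carrier A" "s = y \<oplus> y \<otimes> s" and t: "t \<in> carrier A" "t = y \<oplus> y \<otimes> t"
  shows "s = t"
proof -
  have "s \<ominus> t = (y \<oplus> y \<otimes> s) \<ominus> (y \<oplus> y \<otimes> t)"
    by (rule arg_cong2[OF s(2) t(2)])
  also have "\<dots> = y \<otimes> (s \<ominus> t)" using y s(1) t(1) by (simp add: add_diff_cancel_l diff_distr_l)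
  finally have "cnorm A (s \<ominus> t) \<le> cnorm A y * cnorm A (s \<ominus> t)"
    using norm_mult[of y "s \<ominus> t"] y s(1) t(1) by simp
  moreover have "cnorm A (s \<ominus> t) \<ge> 0" using s(1) t(1) by simp
  ultimately have "cnorm A (s \<ominus> t) = 0" using y(2)
    by (smt (verit) mult_le_cancel_right1)
  then show ?thesis using s(1) t(1) by (simp add: diff_eq_zero)
qed

text \<open>With \<open>s\<close> standing for \<open>(1 - y)\<^sup>-\<^sup>1 - 1\<close>, this is
  \<open>1 / (1 - y\<^sup>2) = (1 / (1 - y) + 1 / (1 + y)) / 2\<close>.\<close>

lemma quasi_inv_square:
  assumes y: "y \<in> carrier A" and less: "cnorm A (y \<otimes> y) < 1"
    and s: "quasi_inv y s" and t: "quasi_inv (\<ominus> y) t" and v: "quasi_inv (y \<otimes> y) v"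
  shows "v = (1/2) \<odot> (s \<oplus> t)"
proof (rule quasi_inv_unique[of "y \<otimes> y"])
  have sc: "s \<in> carrier A" and tc: "t \<in> carrier A" using s t by (auto simp: quasi_inv_def)
  have s1: "s = y \<oplus> y \<otimes> s" using s unfolding quasi_inv_def by blast
  have t1: "t = \<ominus> y \<oplus> \<ominus> (y \<otimes> t)"
    using t unfolding quasi_inv_def mult_minus_l[OF y tc] by blast
  have ys: "y \<otimes> s = s \<oplus> \<ominus> y" by (subst (2) s1) (use y sc in \<open>simp add: a_ac r_neg1 r_neg2\<close>)
  have yt: "y \<otimes> t = \<ominus> t \<oplus> \<ominus> y"
    by (subst (2) t1) (use y tc in \<open>simp add: minus_add a_ac r_neg1 r_neg2\<close>)
  let ?a = "(1/2) \<odot> (s \<oplus> t)"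
  have yy: "(1/2) \<odot> (y \<otimes> y \<oplus> y \<otimes> y) = y \<otimes> y"
    using y by (simp add: smult_add_r smult_add_l[symmetric])
  \<comment> \<open>Replacing \<open>y s\<close> by \<open>s - y\<close> and \<open>y t\<close> by
    \<open>- t - y\<close>, twice, gives \<open>y^2 (s + t) = (s + t) - 2 y^2\<close>. Halved, this
    is the equation that determines the quasi-inverse of \<open>y^2\<close>.\<close>
  have "(y \<otimes> y) \<otimes> (s \<oplus> t) = y \<otimes> (y \<otimes> s) \<oplus> y \<otimes> (y \<otimes> t)"
    using y sc tc by (simp add: distr_l mult_assoc)
  also have "\<dots> = (y \<otimes> s \<oplus> \<ominus> (y \<otimes> y)) \<oplus> (\<ominus> (y \<otimes> t) \<oplus> \<ominus> (y \<otimes> y))"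
    unfolding ys yt using y sc tc by (simp add: distr_l mult_minus_r ys yt)
  also have "\<dots> = (s \<oplus> t) \<oplus> \<ominus> (y \<otimes> y \<oplus> y \<otimes> y)"
    unfolding ys yt using y sc tc by (simp add: minus_add a_ac r_neg1 r_neg2)
  finally have sum: "(y \<otimes> y) \<otimes> (s \<oplus> t) = (s \<oplus> t) \<ominus> (y \<otimes> y \<oplus> y \<otimes> y)"
    by (simp only: a_minus_def)
  have c: "s \<oplus> t \<in> carrier A" "y \<otimes> y \<in> carrier A" "?a \<in> carrier A"
    "y \<otimes> y \<oplus> y \<otimes> y \<in> carrier A" using y sc tc by auto
  have "y \<otimes> y \<otimes> ?a = ?a \<ominus> y \<otimes> y"
    unfolding smult_mult_r[OF c(2,1)] sum smult_diff_r[OF c(1,4)] yy ..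
  then show "?a = y \<otimes> y \<oplus> y \<otimes> y \<otimes> ?a"
    using diff_add_cancel[OF c(3,2)] a_comm[OF c(2) minus_closed[OF c(3,2)]] by argo
next
  show "v = y \<otimes> y \<oplus> y \<otimes> y \<otimes> v" using v unfolding quasi_inv_def by blast
  show "v \<in> carrier A" using v unfolding quasi_inv_def by blast
  show "(1/2) \<odot> (s \<oplus> t) \<in> carrier A" using s t unfolding quasi_inv_def by simp
qed (use y less in simp_all)

text \<open>The resolvent identity \<open>1 / (1 - k) - 1 / (1 - l) = (1 / (1 - k)) (k - l) (1 / (1 - l))\<close>.\<close>

lemma quasi_inv_diff_le:
  assumes k: "k \<in> carrier A" and l: "l \<in> carrier A" and s: "quasi_inv k s" and t: "quasi_inv l t"
  shows "cnorm A (s \<ominus> t) \<le> cnorm A (k \<ominus> l) * (1 + cnorm A s) * (1 + cnorm A t)"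
proof -
  have sc: "s \<in> carrier A" and tc: "t \<in> carrier A" using s t by (auto simp: quasi_inv_def)
  have s1: "k \<oplus> s \<otimes> k = s" using s unfolding quasi_inv_def by metis
  have t1: "l \<oplus> l \<otimes> t = t" using t unfolding quasi_inv_def by metis
  define d where "d = k \<ominus> l"
  \<comment> \<open>\<open>P\<close> is left multiplication by \<open>1 + s\<close>, and
    \<open>w\<close> below is \<open>(k - l)(1 + t)\<close>; so \<open>P w\<close> is the right-hand
    side of the resolvent identity.\<close>
  define P where "P = (\<lambda>y. y \<oplus> s \<otimes> y)"
  have dc: "d \<in> carrier A" using k l by (simp add: d_def)
  define w where "w = d \<oplus> d \<otimes> t"
  have wc: "w \<in> carrier A" using dc tc by (simp add: w_def)
  have "w = (k \<oplus> k \<otimes> t) \<ominus> (l \<oplus> l \<otimes> t)"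
    using k l tc by (simp add: w_def d_def diff_distr_r add_diff_add)
  then have w: "w = (k \<oplus> k \<otimes> t) \<ominus> t" by (simp add: t1)
  have "P w = (k \<oplus> s \<otimes> k) \<oplus> (k \<oplus> s \<otimes> k) \<otimes> t \<ominus> (t \<oplus> s \<otimes> t)"
    unfolding P_def w using k l sc tc
    by (simp add: a_minus_def distr_l distr_r minus_add mult_minus_r mult_assoc a_ac)
  also have "\<dots> = s \<ominus> t" unfolding s1 using sc tc
    by (metis a_comm add_diff_cancel_l mult_closed)
  finally have "cnorm A (s \<ominus> t) \<le> cnorm A w + cnorm A s * cnorm A w"
    unfolding P_def using norm_triangle[of w "s \<otimes> w"] norm_mult[of s w] wc sc by simp
  moreover have "cnorm A w \<le> cnorm A d + cnorm A d * cnorm A t"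
    unfolding w_def using norm_triangle[of d "d \<otimes> t"] norm_mult[of d t] dc tc by simp
  then have "cnorm A w * (1 + cnorm A s) \<le> (cnorm A d * (1 + cnorm A t)) * (1 + cnorm A s)"
    using sc by (intro mult_right_mono) (auto simp: algebra_simps)
  ultimately show ?thesis by (simp add: d_def algebra_simps)
qed

end

section \<open>Powers with exponent a power of two\<close>

context cstar
begin

text \<open>This is \<open>x^(2^k)\<close>. Repeated squaring is the kind of power whose norm the
  C*-identity computes exactly.\<close>

definition dyadic_power :: "nat \<Rightarrow> 'a \<Rightarrow> 'a" where
  "dyadic_power k x = ((\<lambda>y. y \<otimes> y) ^^ k) x"

lemma dyadic_power_0 [simp]: "dyadic_power 0 x = x"
  and dyadic_power_Suc [simp]: "dyadic_power (Suc k) x = dyadic_power k x \<otimes> dyadic_power k x"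
  by (simp_all add: dyadic_power_def)

lemma dyadic_power_closed [simp, intro]: "x \<in> carrier A \<Longrightarrow> dyadic_power k x \<in> carrier A"
  by (induct k) auto

lemma dyadic_power_smult:
  "x \<in> carrier A \<Longrightarrow> dyadic_power k (c \<odot> x) = c ^ (2 ^ k) \<odot> dyadic_power k x"
  by (induct k) (simp_all add: smult_mult_l smult_mult_r smult_smult mult_2 power_add)

lemma norm_dyadic_power_le: "x \<in> carrier A \<Longrightarrow> cnorm A (dyadic_power k x) \<le> cnorm A x ^ (2 ^ k)"
proof (induct k)
  case (Suc k)
  have "cnorm A (dyadic_power (Suc k) x) \<le> cnorm A (dyadic_power k x) * cnorm A (dyadic_power k x)"
    using Suc by (simp add: norm_mult)
  also have "\<dots> \<le> cnorm A x ^ 2 ^ k * cnorm A x ^ 2 ^ k"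
    using Suc by (intro mult_mono) auto
  finally show ?case by (simp add: mult_2 power_add)
qed simp

lemma adj_dyadic_power:
  "x \<in> carrier A \<Longrightarrow> adj A x = x \<Longrightarrow> adj A (dyadic_power k x) = dyadic_power k x"
  by (induct k) (simp_all add: adj_mult)

text \<open>For self-adjoint \<open>y\<close> the C*-identity reads
  \<open>||y^2|| = ||y||^2\<close>, and \<open>y^2\<close> is again self-adjoint.\<close>

lemma norm_dyadic_power:
  "x \<in> carrier A \<Longrightarrow> adj A x = x \<Longrightarrow> cnorm A (dyadic_power k x) = cnorm A x ^ (2 ^ k)"
proof (induct k)
  case (Suc k)
  then show ?case
    using norm_adj_mult[of "dyadic_power k x"] adj_dyadic_power[of x k]
    by (simp add: power2_eq_square mult_2 power_add)
qed simp

end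

section \<open>Automatic contractivity of *-homomorphisms\<close>

locale cstar_hom = D: cstar D + A: cstar A
  for D :: "'d cstar_alg" and A :: "'a cstar_alg" +
  fixes q :: "'d \<Rightarrow> 'a"
  assumes star_hom: "star_hom D A q"
begin

lemma hom_closed [simp, intro]: "x \<in> carrier D \<Longrightarrow> q x \<in> carrier A"
  and hom_add: "x \<in> carrier D \<Longrightarrow> y \<in> carrier D \<Longrightarrow> q (x \<oplus>\<^bsub>D\<^esub> y) = q x \<oplus>\<^bsub>A\<^esub> q y"
  and hom_smult: "x \<in> carrier D \<Longrightarrow> q (c \<odot>\<^bsub>D\<^esub> x) = c \<odot>\<^bsub>A\<^esub> q x"
  and hom_mult: "x \<in> carrier D \<Longrightarrow> y \<in> carrier D \<Longrightarrow> q (x \<otimes>\<^bsub>D\<^esub> y) = q x \<otimes>\<^bsub>A\<^esub> q y"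
  and hom_adj: "x \<in> carrier D \<Longrightarrow> q (adj D x) = adj A (q x)"
  using star_hom by (simp_all add: star_hom_def linear_map_def)

lemma hom_minus: "x \<in> carrier D \<Longrightarrow> q (\<ominus>\<^bsub>D\<^esub> x) = \<ominus>\<^bsub>A\<^esub> q x"
  by (simp add: D.minus_smult A.minus_smult hom_smult)

lemma hom_diff: "x \<in> carrier D \<Longrightarrow> y \<in> carrier D \<Longrightarrow> q (x \<ominus>\<^bsub>D\<^esub> y) = q x \<ominus>\<^bsub>A\<^esub> q y"
  by (simp add: a_minus_def hom_add hom_minus)

lemma hom_dyadic_power: "x \<in> carrier D \<Longrightarrow> q (D.dyadic_power k x) = A.dyadic_power k (q x)"
  by (induct k) (simp_all add: hom_mult)

lemma hom_quasi_inv: "y \<in> carrier D \<Longrightarrow> D.quasi_inv y s \<Longrightarrow> A.quasi_inv (q y) (q s)"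
  unfolding D.quasi_inv_def A.quasi_inv_def
  by (metis D.mult_closed hom_add hom_closed hom_mult)

text \<open>Rickart's argument for the spectral radius: the quasi-inverses \<open>P k l\<close> of \<open>(l h)\<^sup>N\<close>, where
  \<open>h = q x\<close> and \<open>N = 2\<^sup>k\<close>, exist on the closed unit disc because those of \<open>(l x)\<^sup>N\<close> do. Averaging
  \<open>P k l\<close> and \<open>P k (w l)\<close>, where \<open>w\<^sup>N = -1\<close>, passes a Lipschitz bound from \<open>P k\<close> to \<open>P (k + 1)\<close>, uniformly in \<open>k\<close>.
  But \<open>P k l \<rightarrow> 0\<close> for \<open>|l| < 1\<close>, whereas \<open>P k 1\<close> stays away from \<open>0\<close> since \<open>\<parallel>h\<^sup>N\<parallel> = 1\<close>.\<close>

lemma norm_hom_neq_1: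
  assumes x: "x \<in> carrier D" and sa: "adj D x = x" and less: "cnorm D x < 1"
  shows "cnorm A (q x) \<noteq> 1"
proof
  assume one: "cnorm A (q x) = 1"
  define h where "h = q x"
  have h: "h \<in> carrier A" "adj A h = h" "cnorm A h = 1"
    using x sa one by (auto simp: h_def hom_adj[symmetric])
  define S where "S = (\<lambda>y. SOME s. D.quasi_inv y s)"
  have S: "D.quasi_inv y (S y)" if "y \<in> carrier D" "cnorm D y < 1" for y
    unfolding S_def using D.quasi_inv_exists[OF that] by (rule someI_ex)
  define P where "P = (\<lambda>k l. q (S (D.dyadic_power k (l \<odot>\<^bsub>D\<^esub> x))))"
  have nx: "cnorm D (D.dyadic_power k (l \<odot>\<^bsub>D\<^esub> x)) < 1" if "cmod l \<le> 1" for k l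
  proof -
    have "cnorm D (l \<odot>\<^bsub>D\<^esub> x) < 1"
      using x less that mult_mono[of "cmod l" 1 "cnorm D x" "cnorm D x"]
      by (simp add: D.norm_smult)
    moreover have "0 \<le> cnorm D (l \<odot>\<^bsub>D\<^esub> x)" using x by simp
    ultimately have "cnorm D (l \<odot>\<^bsub>D\<^esub> x) ^ 2 ^ k < 1"
      by (intro power_less_one_iff[THEN iffD2]) auto
    then show ?thesis
      using D.norm_dyadic_power_le[of "l \<odot>\<^bsub>D\<^esub> x" k] x by simp
  qed
  have quasiD: "D.quasi_inv (D.dyadic_power k (l \<odot>\<^bsub>D\<^esub> x)) (S (D.dyadic_power k (l \<odot>\<^bsub>D\<^esub> x)))"
    if "cmod l \<le> 1" for k l
    using S nx[OF that] x by simp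
  then have Sc: "S (D.dyadic_power k (l \<odot>\<^bsub>D\<^esub> x)) \<in> carrier D" if "cmod l \<le> 1" for k l
    using that by (auto simp: D.quasi_inv_def)
  have quasi: "A.quasi_inv (A.dyadic_power k (l \<odot>\<^bsub>A\<^esub> h)) (P k l)" if "cmod l \<le> 1" for k l
    using hom_quasi_inv[OF _ quasiD[OF that]] x
    by (simp add: P_def h_def hom_dyadic_power hom_smult)
  have Pc: "P k l \<in> carrier A" if "cmod l \<le> 1" for k l
    using quasi[OF that] by (simp add: A.quasi_inv_def)
  have rec: "\<exists>w. cmod w = 1 \<and> (\<forall>l. cmod l \<le> 1 \<longrightarrow>
      P (Suc k) l = (1/2) \<odot>\<^bsub>A\<^esub> (P k l \<oplus>\<^bsub>A\<^esub> P k (w * l)))" for k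
  proof (intro exI conjI allI impI)
    define w where "w = cis (pi / 2 ^ k)"
    show "cmod w = 1" by (simp add: w_def)
    have w: "w ^ 2 ^ k = -1" by (simp add: w_def Complex.DeMoivre)
    fix l assume l: "cmod l \<le> 1"
    then have wl: "cmod (w * l) \<le> 1" by (simp add: w_def Real_Vector_Spaces.norm_mult)
    let ?y = "D.dyadic_power k (l \<odot>\<^bsub>D\<^esub> x)"
    have neg: "D.dyadic_power k ((w * l) \<odot>\<^bsub>D\<^esub> x) = \<ominus>\<^bsub>D\<^esub> ?y"
      using x by (simp add: D.dyadic_power_smult power_mult_distrib w D.minus_smult D.smult_smult)
    have "S (D.dyadic_power (Suc k) (l \<odot>\<^bsub>D\<^esub> x)) =
        (1/2) \<odot>\<^bsub>D\<^esub> (S ?y \<oplus>\<^bsub>D\<^esub> S (D.dyadic_power k ((w * l) \<odot>\<^bsub>D\<^esub> x)))"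
    proof (rule D.quasi_inv_square[of ?y])
      show "D.quasi_inv (\<ominus>\<^bsub>D\<^esub> ?y) (S (D.dyadic_power k ((w * l) \<odot>\<^bsub>D\<^esub> x)))"
        using quasiD[OF wl, of k] unfolding neg .
    qed (use x quasiD[OF l, of k] quasiD[OF l, of "Suc k"] nx[OF l, of "Suc k"] in auto)
    then show "P (Suc k) l = (1/2) \<odot>\<^bsub>A\<^esub> (P k l \<oplus>\<^bsub>A\<^esub> P k (w * l))"
      using Sc[OF l, of k] Sc[OF wl, of k] by (simp add: P_def hom_smult hom_add)
  qed
  have res: "cnorm A (P 0 l \<ominus>\<^bsub>A\<^esub> P 0 m) \<le>
      cmod (l - m) * (1 + cnorm A (P 0 l)) * (1 + cnorm A (P 0 m))"
    if "cmod l \<le> 1" "cmod m \<le> 1" for l m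
    using A.quasi_inv_diff_le[of "l \<odot>\<^bsub>A\<^esub> h" "m \<odot>\<^bsub>A\<^esub> h" "P 0 l" "P 0 m"]
      quasi[OF that(1), of 0] quasi[OF that(2), of 0] h
    by (simp add: A.smult_diff_l[symmetric] A.norm_smult)
  \<comment> \<open>The resolvent estimate bounds the difference of \<open>||P 0 l||\<close> and
    \<open>||P 0 m||\<close> by \<open>|l - m|\<close> times the product of the two denominators.
    Taking reciprocals cancels that product, so \<open>c\<close> is 1-Lipschitz before any bound on
    \<open>P 0\<close> is known. Its positive minimum on the compact disc then supplies this
    bound.\<close>
  define c where "c = (\<lambda>l. 1 / (1 + cnorm A (P 0 l)))"
  have c_lip: "\<bar>c l - c m\<bar> \<le> dist l m" if lm: "cmod l \<le> 1" "cmod m \<le> 1" for l m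
  proof -
    define a where "a = cnorm A (P 0 l)"
    define b where "b = cnorm A (P 0 m)"
    have ab: "0 \<le> a" "0 \<le> b" using Pc lm by (auto simp: a_def b_def)
    have "\<bar>b - a\<bar> \<le> cnorm A (P 0 l \<ominus>\<^bsub>A\<^esub> P 0 m)"
      using A.norm_le_diff[of "P 0 l" "P 0 m"] A.norm_le_diff[of "P 0 m" "P 0 l"]
        A.norm_diff_commute[of "P 0 m" "P 0 l"] Pc lm by (simp add: a_def b_def)
    also have "\<dots> \<le> cmod (l - m) * ((1 + a) * (1 + b))"
      using res[OF lm] by (simp add: a_def b_def mult.assoc)
    finally have "\<bar>b - a\<bar> / ((1 + a) * (1 + b)) \<le> cmod (l - m)"
      using ab by (subst pos_divide_le_eq) auto
    moreover have "c l - c m = (b - a) / ((1 + a) * (1 + b))"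
      using ab by (simp add: c_def a_def[symmetric] b_def[symmetric] divide_simps)
    ultimately show ?thesis using ab by (simp add: abs_divide abs_mult dist_norm)
  qed
  have "continuous_on (cball 0 1) c"
    unfolding continuous_on_iff
    using c_lip by (metis dist_real_def dist_commute mem_cball_0 order_le_less_trans)
  then obtain l0 where l0: "cmod l0 \<le> 1" and min: "\<And>l. cmod l \<le> 1 \<Longrightarrow> c l0 \<le> c l"
    using continuous_attains_inf[of "cball 0 1" c] by force
  have c0: "0 < c l0" using A.norm_ge_0[OF Pc[OF l0, of 0]] by (simp add: c_def)
  have bd: "1 + cnorm A (P 0 l) \<le> 1 / c l0" if "cmod l \<le> 1" for l
    using min[OF that] c0 A.norm_ge_0[OF Pc[OF that, of 0]]
    by (simp add: c_def field_simps)
  have L0: "cnorm A (P 0 l \<ominus>\<^bsub>A\<^esub> P 0 m) \<le> (1 / c l0)\<^sup>2 * cmod (l - m)"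
    if lm: "cmod l \<le> 1" "cmod m \<le> 1" for l m
  proof -
    have "(1 + cnorm A (P 0 l)) * (1 + cnorm A (P 0 m)) \<le> (1 / c l0)\<^sup>2"
      unfolding power2_eq_square using lm bd c0 A.norm_ge_0[OF Pc[OF lm(1), of 0]]
        A.norm_ge_0[OF Pc[OF lm(2), of 0]] by (intro mult_mono) auto
    then have "cmod (l - m) * ((1 + cnorm A (P 0 l)) * (1 + cnorm A (P 0 m))) \<le>
        cmod (l - m) * (1 / c l0)\<^sup>2" by (rule mult_left_mono) simp
    then show ?thesis
      using order_trans[OF res[OF lm, unfolded mult.assoc]] unfolding mult.commute[of "(1 / c l0)\<^sup>2"]
      by blast
  qed
  define L where "L = (1 / c l0)\<^sup>2"
  note L0 = L0[folded L_def]
  have L: "cnorm A (P k l \<ominus>\<^bsub>A\<^esub> P k m) \<le> L * cmod (l - m)"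
    if "cmod l \<le> 1" "cmod m \<le> 1" for k l m
    using that
  proof (induct k arbitrary: l m)
    case 0 then show ?case by (rule L0)
  next
    case (Suc k)
    obtain w where w: "cmod w = 1" and e: "\<And>l. cmod l \<le> 1 \<Longrightarrow>
      P (Suc k) l = (1/2) \<odot>\<^bsub>A\<^esub> (P k l \<oplus>\<^bsub>A\<^esub> P k (w * l))" using rec[of k] by blast
    have wl: "cmod (w * l) \<le> 1" "cmod (w * m) \<le> 1"
      using Suc w by (simp_all add: Real_Vector_Spaces.norm_mult)
    have "P (Suc k) l \<ominus>\<^bsub>A\<^esub> P (Suc k) m =
       (1/2) \<odot>\<^bsub>A\<^esub> ((P k l \<ominus>\<^bsub>A\<^esub> P k m) \<oplus>\<^bsub>A\<^esub> (P k (w * l) \<ominus>\<^bsub>A\<^esub> P k (w * m)))"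
      using Suc wl by (simp add: e Pc A.smult_diff_r[symmetric] A.add_diff_add)
    then have "cnorm A (P (Suc k) l \<ominus>\<^bsub>A\<^esub> P (Suc k) m) \<le> (1/2) *
       (cnorm A (P k l \<ominus>\<^bsub>A\<^esub> P k m) + cnorm A (P k (w * l) \<ominus>\<^bsub>A\<^esub> P k (w * m)))"
      using Suc(2,3) wl Pc by (simp add: A.norm_smult A.norm_triangle)
    also have "\<dots> \<le> (1/2) * (L * cmod (l - m) + L * cmod (w * l - w * m))"
      using Suc wl by (intro mult_left_mono add_mono) auto
    also have "cmod (w * l - w * m) = cmod (l - m)"
      using w by (simp add: right_diff_distrib[symmetric] Real_Vector_Spaces.norm_mult)
    finally show ?case by simp
  qed
  have dy: "cnorm A (A.dyadic_power k (l \<odot>\<^bsub>A\<^esub> h)) = cmod l ^ 2 ^ k" for k l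
    using h A.norm_dyadic_power[of h k] by (simp add: A.dyadic_power_smult A.norm_smult norm_power)
  \<comment> \<open>With \<open>||u|| = 1\<close>, the equation \<open>u = P - u P\<close> forces
    \<open>1 <= 2 ||P||\<close>.\<close>
  have lower: "1 / 2 \<le> cnorm A (P k 1)" for k
  proof -
    let ?u = "A.dyadic_power k (1 \<odot>\<^bsub>A\<^esub> h)"
    have "P k 1 = ?u \<oplus>\<^bsub>A\<^esub> ?u \<otimes>\<^bsub>A\<^esub> P k 1"
      using quasi[of 1 k] unfolding A.quasi_inv_def by simp
    then have "cnorm A ?u \<le> cnorm A (P k 1) + cnorm A ?u * cnorm A (P k 1)"
      using A.norm_le_add[of ?u "?u \<otimes>\<^bsub>A\<^esub> P k 1"] A.norm_mult[of ?u "P k 1"] h Pc[of 1 k] by simp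
    then show ?thesis using dy[of k 1] by simp
  qed
  have upper: "(1 - r ^ 2 ^ k) * cnorm A (P k (of_real r)) \<le> r ^ 2 ^ k" if r: "0 \<le> r" "r \<le> 1" for r k
  proof -
    let ?u = "A.dyadic_power k (of_real r \<odot>\<^bsub>A\<^esub> h)"
    have 1: "P k (of_real r) \<in> carrier A" using r by (intro Pc) simp
    have "P k (of_real r) = ?u \<oplus>\<^bsub>A\<^esub> ?u \<otimes>\<^bsub>A\<^esub> P k (of_real r)"
      using quasi[of "of_real r" k] r unfolding A.quasi_inv_def by simp
    then have "cnorm A (P k (of_real r)) \<le> cnorm A ?u + cnorm A ?u * cnorm A (P k (of_real r))"
      using A.norm_triangle[of ?u "?u \<otimes>\<^bsub>A\<^esub> P k (of_real r)"] A.norm_mult[of ?u "P k (of_real r)"] h 1 by simp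
    then show ?thesis using dy[of k "of_real r"] r by (simp add: algebra_simps)
  qed
  \<comment> \<open>Here \<open>r\<close> is chosen to make \<open>L' (1 - r) = 1/8\<close>. For
    large \<open>k\<close> the value at \<open>r\<close> has norm at most 1/7, and
    \<open>1/8 + 1/7 < 1/2\<close> contradicts \<open>lower\<close>. The maximum with 1 ensures
    \<open>0 <= r < 1\<close>.\<close>
  define L' where "L' = max L 1"
  define r where "r = 1 - 1 / (8 * L')"
  have r: "0 \<le> r" "r < 1" by (auto simp: r_def L'_def field_simps)
  have "(\<lambda>k. r ^ 2 ^ k) \<longlonglongrightarrow> 0"
    using LIMSEQ_subseq_LIMSEQ[OF LIMSEQ_realpow_zero[OF r], of "\<lambda>k. 2 ^ k"]
    by (simp add: strict_mono_def comp_def)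
  then have "\<forall>\<^sub>F k in sequentially. r ^ 2 ^ k < 1/8"
    by (rule order_tendstoD(2)) simp
  then obtain k where k: "r ^ 2 ^ k < 1/8"
    using eventually_happens by force
  have pos: "0 \<le> cnorm A (P k (of_real r))" using r by (intro A.norm_ge_0 Pc) simp
  have "(7/8) * cnorm A (P k (of_real r)) \<le> (1 - r ^ 2 ^ k) * cnorm A (P k (of_real r))"
    using k pos by (intro mult_right_mono) auto
  also have "\<dots> \<le> 1/8" using upper[of r k] r k by simp
  finally have u: "cnorm A (P k (of_real r)) \<le> 1/7" by simp
  have "cnorm A (P k 1 \<ominus>\<^bsub>A\<^esub> P k (of_real r)) \<le> L * cmod (1 - of_real r)"
    using r by (intro L) auto
  also have "cmod (1 - of_real r) = 1 - r"
    using r norm_of_real[of "1 - r", where 'a = complex] by simp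
  also have "L * (1 - r) \<le> L' * (1 - r)"
    using r by (intro mult_right_mono) (simp_all add: L'_def)
  also have "\<dots> = 1/8" by (simp add: r_def L'_def)
  finally have "cnorm A (P k 1) \<le> 1/8 + 1/7"
    using A.norm_le_diff[of "P k 1" "P k (of_real r)"] Pc[of 1 k] Pc[of "of_real r" k] u r by simp
  then show False using lower[of k] by simp
qed

text \<open>Excluding the single value 1 is enough by scaling: if \<open>y\<close> is self-adjoint
  and \<open>||q y|| > ||y||\<close>, then dividing \<open>y\<close> by \<open>||q y||\<close> gives
  an element of norm below 1 whose image has norm exactly 1. The general case follows by applying
  this to \<open>x* x\<close>.\<close>

lemma hom_contractive: assumes x: "x \<in> carrier D" shows "cnorm A (q x) \<le> cnorm D x"
proof -
  have sa: "cnorm A (q y) \<le> cnorm D y" if y: "y \<in> carrier D" "adj D y = y" for y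
  proof (rule ccontr)
    assume "\<not> ?thesis"
    then have gt: "cnorm D y < cnorm A (q y)" by simp
    then have pos: "0 < cnorm A (q y)" using y D.norm_ge_0[of y] by linarith
    define c where "c = 1 / cnorm A (q y)"
    have "cnorm A (q (of_real c \<odot>\<^bsub>D\<^esub> y)) \<noteq> 1"
      using y gt pos by (intro norm_hom_neq_1) (auto simp: D.adj_smult D.norm_smult norm_divide c_def)
    then show False using y pos by (auto simp: hom_smult A.norm_smult norm_divide c_def split: if_splits)
  qed
  have "(cnorm A (q x))\<^sup>2 = cnorm A (q (adj D x \<otimes>\<^bsub>D\<^esub> x))"
    using x by (simp add: hom_mult hom_adj A.norm_adj_mult)
  also have "\<dots> \<le> (cnorm D x)\<^sup>2"
    using sa[of "adj D x \<otimes>\<^bsub>D\<^esub> x"] x by (simp add: D.adj_mult D.norm_adj_mult)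
  finally show ?thesis using x by (simp add: power2_le_iff_abs_le)
qed

end

section \<open>The algebra of uniformly continuous functions\<close>

text \<open>The G-WEP quantifies over algebras with carrier in \<open>('g \<times> 'd) set\<close>,
  so functions are stored as their graphs.\<close>

definition graph :: "('g \<Rightarrow> 'd) \<Rightarrow> ('g \<times> 'd) set" where
  "graph F = range (\<lambda>x. (x, F x))"

definition ungraph :: "('g \<times> 'd) set \<Rightarrow> 'g \<Rightarrow> 'd" where
  "ungraph S x = (THE y. (x, y) \<in> S)"

lemma ungraph_graph [simp]: "ungraph (graph F) = F"
  by (rule ext) (auto simp: ungraph_def graph_def)

lemma graph_eq_iff [simp]: "graph F = graph H \<longleftrightarrow> F = H"
  by (metis ungraph_graph)

text \<open>The displacement \<open>s\<close> stands on the left, as in the translation action, so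
  the last condition is norm continuity of the orbit of \<open>F\<close> at 0. The non-strict
  \<open><= e\<close> passes to suprema over \<open>x\<close>.\<close>

definition ucb_functions :: "'d cstar_alg \<Rightarrow> ('g::topological_group_add \<Rightarrow> 'd) set" where
  "ucb_functions D = {F. (\<forall>x. F x \<in> carrier D) \<and> (\<exists>K. \<forall>x. cnorm D (F x) \<le> K) \<and>
     (\<forall>e>0. \<forall>\<^sub>F s in nhds 0. \<forall>x. cnorm D (F (s + x) \<ominus>\<^bsub>D\<^esub> F x) \<le> e)}"

definition ucb_algebra :: "'d cstar_alg \<Rightarrow> ('g::topological_group_add \<times> 'd) set cstar_alg" where
  "ucb_algebra D = \<lparr>
     carrier = graph ` ucb_functions D,
     monoid.mult = (\<lambda>S T. graph (\<lambda>x. ungraph S x \<otimes>\<^bsub>D\<^esub> ungraph T x)),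
     one = undefined,
     zero = graph (\<lambda>_. \<zero>\<^bsub>D\<^esub>),
     add = (\<lambda>S T. graph (\<lambda>x. ungraph S x \<oplus>\<^bsub>D\<^esub> ungraph T x)),
     module.smult = (\<lambda>c S. graph (\<lambda>x. c \<odot>\<^bsub>D\<^esub> ungraph S x)),
     adj = (\<lambda>S. graph (\<lambda>x. adj D (ungraph S x))),
     cnorm = (\<lambda>S. SUP x. cnorm D (ungraph S x))\<rparr>"

definition translate :: "'g::group_add \<Rightarrow> ('g \<times> 'd) set \<Rightarrow> ('g \<times> 'd) set" where
  "translate g S = graph (\<lambda>x. ungraph S (- g + x))"

lemma ucb_algebra_simps [simp]:
  "carrier (ucb_algebra D) = graph ` ucb_functions D"
  "graph F \<otimes>\<^bsub>ucb_algebra D\<^esub> graph H = graph (\<lambda>x. F x \<otimes>\<^bsub>D\<^esub> H x)"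
  "\<zero>\<^bsub>ucb_algebra D\<^esub> = graph (\<lambda>_. \<zero>\<^bsub>D\<^esub>)"
  "graph F \<oplus>\<^bsub>ucb_algebra D\<^esub> graph H = graph (\<lambda>x. F x \<oplus>\<^bsub>D\<^esub> H x)"
  "c \<odot>\<^bsub>ucb_algebra D\<^esub> graph F = graph (\<lambda>x. c \<odot>\<^bsub>D\<^esub> F x)"
  "adj (ucb_algebra D) (graph F) = graph (\<lambda>x. adj D (F x))"
  "cnorm (ucb_algebra D) (graph F) = (SUP x. cnorm D (F x))"
  "translate g (graph F) = graph (\<lambda>x. F (- g + x))"
  by (simp_all add: ucb_algebra_def translate_def)

context cstar
begin

text \<open>The free constant \<open>C\<close> absorbs the factors produced by an estimate, so that
  closure proofs need not rescale \<open>e\<close>. Dividing by \<open>\<bar>C\<bar> + 1\<close>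
  covers \<open>C <= 0\<close> as well.\<close>

lemma ucb_functionsI:
  assumes "\<And>x. F x \<in> carrier A" "\<And>x. cnorm A (F x) \<le> K"
    and "\<And>e. e > 0 \<Longrightarrow> \<forall>\<^sub>F s in nhds 0. \<forall>x. cnorm A (F (s + x) \<ominus> F x) \<le> C * e"
  shows "F \<in> ucb_functions A"
proof -
  have "\<forall>\<^sub>F s in nhds 0. \<forall>x. cnorm A (F (s + x) \<ominus> F x) \<le> e" if "e > 0" for e
  proof -
    have pos: "e / (\<bar>C\<bar> + 1) > 0" using that by (simp add: add_nonneg_pos)
    have "C * e \<le> (\<bar>C\<bar> + 1) * e" using that by (intro mult_right_mono) auto
    then have le: "C * (e / (\<bar>C\<bar> + 1)) \<le> e" by (simp add: pos_divide_le_eq add_nonneg_pos mult.commute)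
    show ?thesis using assms(3)[OF pos] by eventually_elim (meson le order_trans)
  qed
  then show ?thesis using assms(1,2) unfolding ucb_functions_def by blast
qed

lemma ucb_closed: "F \<in> ucb_functions A \<Longrightarrow> F x \<in> carrier A"
  by (simp add: ucb_functions_def)

text \<open>The bare fact would match every application on the left of \<open>\<in>\<close> and loop.\<close>

lemma ucb_closed_assumption [simp]: "ASSUMPTION (F \<in> ucb_functions A) \<Longrightarrow> F x \<in> carrier A"
  by (simp add: ASSUMPTION_def ucb_closed)

lemma ucb_bounded: "F \<in> ucb_functions A \<Longrightarrow> \<exists>K. \<forall>x. cnorm A (F x) \<le> K"
  by (simp add: ucb_functions_def)

lemma ucb_boundedE: assumes "F \<in> ucb_functions A"
  obtains K where "K \<ge> 0" "\<And>x. cnorm A (F x) \<le> K"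
  using ucb_bounded[OF assms] norm_ge_0[OF ucb_closed[OF assms]] order_trans by metis

lemma ucb_cont: "F \<in> ucb_functions A \<Longrightarrow> e > 0 \<Longrightarrow>
    \<forall>\<^sub>F s in nhds 0. \<forall>x. cnorm A (F (s + x) \<ominus> F x) \<le> e"
  by (simp add: ucb_functions_def)

lemma ucb_zero [simp]: "(\<lambda>_. \<zero>) \<in> ucb_functions A"
  by (rule ucb_functionsI[where K = 0 and C = 0]) (simp_all add: a_minus_def r_neg)

lemma ucb_add [simp]:
  assumes F: "F \<in> ucb_functions A" and H: "H \<in> ucb_functions A"
  shows "(\<lambda>x. F x \<oplus> H x) \<in> ucb_functions A"
proof -
  obtain K where K: "\<And>x. cnorm A (F x) \<le> K" using ucb_boundedE[OF F] by blast
  obtain L where L: "\<And>x. cnorm A (H x) \<le> L" using ucb_boundedE[OF H] by blast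
  show ?thesis
  proof (rule ucb_functionsI[where K = "K + L" and C = 2])
    fix e :: real assume e: "e > 0"
    show "\<forall>\<^sub>F s in nhds 0. \<forall>x. cnorm A ((F (s + x) \<oplus> H (s + x)) \<ominus> (F x \<oplus> H x)) \<le> 2 * e"
      using ucb_cont[OF F e] ucb_cont[OF H e]
    proof eventually_elim
      case (elim s)
      show ?case
      proof
        fix x
        have "cnorm A ((F (s + x) \<ominus> F x) \<oplus> (H (s + x) \<ominus> H x)) \<le> e + e"
          by (rule order_trans[OF norm_triangle add_mono]) (use elim F H in auto)
        then show "cnorm A ((F (s + x) \<oplus> H (s + x)) \<ominus> (F x \<oplus> H x)) \<le> 2 * e"
          using F H by (simp add: add_diff_add)
      qed
    qed
  next
    fix x show "cnorm A (F x \<oplus> H x) \<le> K + L"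
      using norm_triangle[of "F x" "H x"] F H K[of x] L[of x] by simp
  qed (use F H in auto)
qed

lemma ucb_mult [simp]:
  assumes F: "F \<in> ucb_functions A" and H: "H \<in> ucb_functions A"
  shows "(\<lambda>x. F x \<otimes> H x) \<in> ucb_functions A"
proof -
  obtain K where K: "K \<ge> 0" "\<And>x. cnorm A (F x) \<le> K" using ucb_boundedE[OF F] by blast
  obtain L where L: "L \<ge> 0" "\<And>x. cnorm A (H x) \<le> L" using ucb_boundedE[OF H] by blast
  show ?thesis
  proof (rule ucb_functionsI[where K = "K * L" and C = "K + L"])
    fix e :: real assume e: "e > 0"
    show "\<forall>\<^sub>F s in nhds 0. \<forall>x. cnorm A (F (s + x) \<otimes> H (s + x) \<ominus> F x \<otimes> H x) \<le> (K + L) * e"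
      using ucb_cont[OF F e] ucb_cont[OF H e]
    proof eventually_elim
      case (elim s)
      show ?case
      proof
        fix x
        have c: "F (s + x) \<in> carrier A" "H (s + x) \<in> carrier A" "F x \<in> carrier A" "H x \<in> carrier A"
          using F H by auto
        have 1: "cnorm A (F (s + x) \<otimes> (H (s + x) \<ominus> H x)) \<le> K * e"
          by (rule order_trans[OF norm_mult mult_mono]) (use elim K c in auto)
        have 2: "cnorm A ((F (s + x) \<ominus> F x) \<otimes> H x) \<le> e * L"
          by (rule order_trans[OF norm_mult mult_mono]) (use elim e L c in auto)
        have "F (s + x) \<otimes> H (s + x) \<ominus> F x \<otimes> H x =
            F (s + x) \<otimes> (H (s + x) \<ominus> H x) \<oplus> (F (s + x) \<ominus> F x) \<otimes> H x"
          using c by (simp add: diff_distr_l diff_distr_r diff_add_diff)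
        then show "cnorm A (F (s + x) \<otimes> H (s + x) \<ominus> F x \<otimes> H x) \<le> (K + L) * e"
          using norm_triangle[of "F (s + x) \<otimes> (H (s + x) \<ominus> H x)" "(F (s + x) \<ominus> F x) \<otimes> H x"] 1 2 c
          by (simp add: algebra_simps)
      qed
    qed
  next
    fix x show "cnorm A (F x \<otimes> H x) \<le> K * L"
      by (rule order_trans[OF norm_mult mult_mono]) (use F H K L in auto)
  qed (use F H in auto)
qed

lemma ucb_smult [simp]:
  assumes F: "F \<in> ucb_functions A"
  shows "(\<lambda>x. c \<odot> F x) \<in> ucb_functions A"
proof -
  obtain K where K: "K \<ge> 0" "\<And>x. cnorm A (F x) \<le> K" using ucb_boundedE[OF F] by blast
  show ?thesis
  proof (rule ucb_functionsI[where K = "cmod c * K" and C = "cmod c"])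
    fix e :: real assume e: "e > 0"
    show "\<forall>\<^sub>F s in nhds 0. \<forall>x. cnorm A (c \<odot> F (s + x) \<ominus> c \<odot> F x) \<le> cmod c * e"
      using ucb_cont[OF F e] F
      by (auto simp: smult_diff_r[symmetric] norm_smult mult_left_mono elim!: eventually_mono)
  qed (use F K in \<open>auto simp: norm_smult mult_left_mono\<close>)
qed

lemma ucb_adj [simp]:
  assumes F: "F \<in> ucb_functions A"
  shows "(\<lambda>x. adj A (F x)) \<in> ucb_functions A"
proof -
  obtain K where K: "K \<ge> 0" "\<And>x. cnorm A (F x) \<le> K" using ucb_boundedE[OF F] by blast
  show ?thesis
  proof (rule ucb_functionsI[where K = K and C = 1])
    fix e :: real assume e: "e > 0"
    show "\<forall>\<^sub>F s in nhds 0. \<forall>x. cnorm A (adj A (F (s + x)) \<ominus> adj A (F x)) \<le> 1 * e"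
      using ucb_cont[OF F e] F by (simp add: adj_diff[symmetric])
  qed (use F K in auto)
qed

lemma ucb_diff [simp]:
  assumes "F \<in> ucb_functions A" "H \<in> ucb_functions A"
  shows "(\<lambda>x. F x \<ominus> H x) \<in> ucb_functions A"
proof -
  have "(\<lambda>x. F x \<ominus> H x) = (\<lambda>x. F x \<oplus> (-1) \<odot> H x)"
    using assms(2) by (simp add: a_minus_def minus_smult)
  then show ?thesis using ucb_add[OF assms(1) ucb_smult[OF assms(2)]] by simp
qed

lemma ucb_minus [simp]: "F \<in> ucb_functions A \<Longrightarrow> (\<lambda>x. \<ominus> F x) \<in> ucb_functions A"
  using ucb_smult[of F "-1"] by (simp add: minus_smult)

text \<open>Because \<open>- g + (s + x) = (- g + s + g) + (- g + x)\<close>, a translate is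
  displaced by a conjugate of \<open>s\<close>, and conjugation by \<open>g\<close> is continuous
  and fixes 0.\<close>

lemma ucb_translate:
  fixes F :: "'g::topological_group_add \<Rightarrow> 'a"
  assumes F: "F \<in> ucb_functions A"
  shows "(\<lambda>x. F (- g + x)) \<in> ucb_functions A"
proof -
  obtain K where K: "K \<ge> 0" "\<And>x. cnorm A (F x) \<le> K" using ucb_boundedE[OF F] by blast
  have lim: "((\<lambda>s. - g + s + g) \<longlongrightarrow> 0) (nhds 0)"
  proof -
    have "((\<lambda>s. - g + s + g) \<longlongrightarrow> - g + 0 + g) (nhds 0)"
      by (intro tendsto_add tendsto_const filterlim_ident)
    then show ?thesis by simp
  qed
  show ?thesis
  proof (rule ucb_functionsI[where K = K and C = 1])
    fix e :: real assume e: "e > 0"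
    have "\<forall>\<^sub>F s in nhds 0. \<forall>x. cnorm A (F ((- g + s + g) + x) \<ominus> F x) \<le> e"
      by (rule eventually_compose_filterlim[OF ucb_cont[OF F e] lim])
    then show "\<forall>\<^sub>F s in nhds 0. \<forall>x. cnorm A (F (- g + (s + x)) \<ominus> F (- g + x)) \<le> 1 * e"
    proof eventually_elim
      case (elim s)
      show ?case
      proof
        fix x show "cnorm A (F (- g + (s + x)) \<ominus> F (- g + x)) \<le> 1 * e"
          using elim[rule_format, of "- g + x"] by (simp add: add.assoc)
      qed
    qed
  qed (use F K in auto)
qed

lemma ucb_bdd_above: "F \<in> ucb_functions A \<Longrightarrow> bdd_above (range (\<lambda>x. cnorm A (F x)))"
  using ucb_bounded by (force intro: bdd_aboveI)

lemma ucb_norm_upper: "F \<in> ucb_functions A \<Longrightarrow> cnorm A (F x) \<le> (SUP x. cnorm A (F x))"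
  by (intro cSUP_upper ucb_bdd_above) auto

lemma ucb_norm_least: "(\<And>x. cnorm A (F x) \<le> K) \<Longrightarrow> (SUP x. cnorm A (F x)) \<le> K"
  by (rule cSUP_least) auto

lemma ucb_norm_nonneg: "F \<in> ucb_functions A \<Longrightarrow> 0 \<le> (SUP x. cnorm A (F x))"
  by (metis norm_ge_0 order_trans ucb_closed ucb_norm_upper)

lemma abelian_group_ucb_algebra: "abelian_group (ucb_algebra A)"
proof (rule abelian_groupI, goal_cases)
  case (6 S)
  then obtain F where "S = graph F" "F \<in> ucb_functions A" by auto
  then show ?case
    by (intro bexI[of _ "graph (\<lambda>x. \<ominus> F x)"]) (simp_all add: l_neg)
qed (auto simp: a_ac)

lemma module_ucb_algebra: "Module.module complex_cring (ucb_algebra A)"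
  by (rule Module.moduleI[OF cring_complex_cring abelian_group_ucb_algebra])
     (auto simp: smult_add_l smult_add_r smult_smult)

lemma ucb_algebra_minus:
  assumes "F \<in> ucb_functions A" "H \<in> ucb_functions A"
  shows "graph F \<ominus>\<^bsub>ucb_algebra A\<^esub> graph H = graph (\<lambda>x. F x \<ominus> H x)"
proof -
  interpret B: abelian_group "ucb_algebra A" by (rule abelian_group_ucb_algebra)
  have "\<ominus>\<^bsub>ucb_algebra A\<^esub> graph H = graph (\<lambda>x. \<ominus> H x)"
    using assms by (intro B.minus_equality) (simp_all add: l_neg)
  then show ?thesis by (simp add: a_minus_def)
qed

text \<open>Completeness of \<open>A\<close> gives the limit pointwise; the Cauchy condition in the
  supremum norm makes the convergence uniform, and uniform limits inherit boundedness and uniform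
  continuity.\<close>

lemma ucb_complete:
  assumes F: "\<And>n::nat. F n \<in> ucb_functions A"
    and Cauchy: "\<And>e. e > 0 \<Longrightarrow> \<exists>N. \<forall>m\<ge>N. \<forall>n\<ge>N. (SUP x. cnorm A (F m x \<ominus> F n x)) < e"
  shows "\<exists>H\<in>ucb_functions A. (\<lambda>n. SUP x. cnorm A (F n x \<ominus> H x)) \<longlonglongrightarrow> 0"
proof -
  note Fc [simp] = ucb_closed[OF F]
  have C: "\<exists>N. \<forall>m\<ge>N. \<forall>n\<ge>N. \<forall>x. cnorm A (F m x \<ominus> F n x) < e" if "e > 0" for e
    using Cauchy[OF that] ucb_norm_upper[OF ucb_diff[OF F F]] by (meson le_less_trans)
  have "\<exists>y\<in>carrier A. (\<lambda>n. cnorm A (F n x \<ominus> y)) \<longlonglongrightarrow> 0" for x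
  proof (rule complete)
    show "F n x \<in> carrier A" for n by (rule ucb_closed[OF F])
    show "\<exists>N. \<forall>m\<ge>N. \<forall>n\<ge>N. cnorm A (F m x \<ominus> F n x) < e" if "e > 0" for e
      using C[OF that] by blast
  qed
  then obtain H where H: "\<And>x. H x \<in> carrier A" "\<And>x. (\<lambda>n. cnorm A (F n x \<ominus> H x)) \<longlonglongrightarrow> 0"
    by metis
  have unif: "\<exists>N. \<forall>n\<ge>N. \<forall>x. cnorm A (F n x \<ominus> H x) \<le> e" if e: "e > 0" for e
  proof -
    obtain N where N: "\<And>m n x. m \<ge> N \<Longrightarrow> n \<ge> N \<Longrightarrow> cnorm A (F m x \<ominus> F n x) < e"
      using C[OF e] by blast
    have "cnorm A (F n x \<ominus> H x) \<le> e" if n: "n \<ge> N" for n x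
    proof (rule LIMSEQ_le_const)
      show "(\<lambda>m. e + cnorm A (F m x \<ominus> H x)) \<longlonglongrightarrow> e"
        using tendsto_add[OF tendsto_const H(2)] by simp
      have "cnorm A (F n x \<ominus> H x) \<le> e + cnorm A (F m x \<ominus> H x)" if "m \<ge> N" for m
        using norm_diff_triangle[of "F n x" "F m x" "H x"] N[OF n that, of x] H(1)[of x]
        by simp
      then show "\<exists>N. \<forall>m\<ge>N. cnorm A (F n x \<ominus> H x) \<le> e + cnorm A (F m x \<ominus> H x)" by blast
    qed
    then show ?thesis by blast
  qed
  have "H \<in> ucb_functions A"
  proof -
    obtain N where N: "\<And>x. cnorm A (F N x \<ominus> H x) \<le> 1" using unif[of 1] by auto
    obtain K where K: "\<And>x. cnorm A (F N x) \<le> K" using ucb_boundedE[OF F] by blast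
    show ?thesis
    proof (rule ucb_functionsI[where K = "1 + K" and C = 3])
      fix x show "cnorm A (H x) \<le> 1 + K"
        using norm_le_diff[of "H x" "F N x"] norm_diff_commute[of "H x" "F N x"] N[of x] K[of x] H(1)[of x]
        by simp
    next
      fix e :: real assume e: "e > 0"
      obtain n where n: "\<And>x. cnorm A (F n x \<ominus> H x) \<le> e" using unif[OF e] by auto
      show "\<forall>\<^sub>F s in nhds 0. \<forall>x. cnorm A (H (s + x) \<ominus> H x) \<le> 3 * e"
        using ucb_cont[OF F e, of n]
      proof eventually_elim
        case (elim s)
        show ?case
        proof
          fix x
          have "cnorm A (H (s + x) \<ominus> F n (s + x)) \<le> e"
            using n[of "s + x"] norm_diff_commute F H by simp
          moreover have "cnorm A (H (s + x) \<ominus> H x) \<le> cnorm A (H (s + x) \<ominus> F n (s + x)) +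
              (cnorm A (F n (s + x) \<ominus> F n x) + cnorm A (F n x \<ominus> H x))"
            by (rule order_trans[OF norm_diff_triangle add_left_mono[OF norm_diff_triangle]]) (use F H in auto)
          ultimately show "cnorm A (H (s + x) \<ominus> H x) \<le> 3 * e"
            using elim n[of x] by (smt (verit))
        qed
      qed
    qed (rule H)
  qed
  moreover have "(\<lambda>n. SUP x. cnorm A (F n x \<ominus> H x)) \<longlonglongrightarrow> 0"
  proof (rule LIMSEQ_I)
    fix r :: real assume r: "r > 0"
    obtain N where N: "\<And>n x. n \<ge> N \<Longrightarrow> cnorm A (F n x \<ominus> H x) \<le> r / 2"
      using unif[of "r / 2"] r by auto
    have "norm ((SUP x. cnorm A (F n x \<ominus> H x)) - 0) < r" if "n \<ge> N" for n
      using ucb_norm_least[of "\<lambda>x. F n x \<ominus> H x" "r/2"] N[OF that] r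
        ucb_norm_nonneg[OF ucb_diff[OF F \<open>H \<in> ucb_functions A\<close>], of n] by simp
    then show "\<exists>N. \<forall>n\<ge>N. norm ((SUP x. cnorm A (F n x \<ominus> H x)) - 0) < r" by blast
  qed
  ultimately show ?thesis by blast
qed

lemma cstar_algebra_ucb_algebra: "cstar_algebra (ucb_algebra A :: ('g::topological_group_add \<times> 'a) set cstar_alg)"
  unfolding cstar_algebra_def
proof (intro conjI, goal_cases)
  \<comment> \<open>The cases are the conjuncts of \<open>cstar_algebra_def\<close>: 8 is
    definiteness of the norm, 9 homogeneity, 10 the triangle inequality and submultiplicativity, 11
    the C*-identity, 12 completeness.\<close>
  case 8
  have "(SUP x. cnorm A (F x)) = 0 \<longleftrightarrow> F = (\<lambda>_. \<zero>)" if F: "F \<in> ucb_functions A" for F :: "'g \<Rightarrow> 'a"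
  proof
    assume "(SUP x. cnorm A (F x)) = 0"
    then have "cnorm A (F x) = 0" for x
      using ucb_norm_upper[OF F, of x] norm_ge_0[OF ucb_closed[OF F], of x] by simp
    then show "F = (\<lambda>_. \<zero>)" using F by auto
  qed simp
  then show ?case using ucb_norm_nonneg by auto
next
  case 9
  have "(SUP x. cnorm A (c \<odot> F x)) = cmod c * (SUP x. cnorm A (F x))"
    if F: "F \<in> ucb_functions A" for F :: "'g \<Rightarrow> 'a" and c
  proof (cases "c = 0")
    case False
    show ?thesis
    proof (rule antisym)
      show "(SUP x. cnorm A (c \<odot> F x)) \<le> cmod c * (SUP x. cnorm A (F x))"
        using F ucb_norm_upper[OF F] by (intro ucb_norm_least) (simp add: norm_smult mult_left_mono)
      have "(SUP x. cnorm A (F x)) \<le> (SUP x. cnorm A (c \<odot> F x)) / cmod c"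
        using F False ucb_norm_upper[OF ucb_smult[OF F, of c]]
        by (intro ucb_norm_least) (simp add: norm_smult pos_le_divide_eq mult.commute)
      then show "cmod c * (SUP x. cnorm A (F x)) \<le> (SUP x. cnorm A (c \<odot> F x))"
        using False by (simp add: pos_le_divide_eq mult.commute)
    qed
  qed (use F in simp)
  then show ?case by auto
next
  case 10
  have "(SUP x. cnorm A (F x \<oplus> H x)) \<le> (SUP x. cnorm A (F x)) + (SUP x. cnorm A (H x))"
    "(SUP x. cnorm A (F x \<otimes> H x)) \<le> (SUP x. cnorm A (F x)) * (SUP x. cnorm A (H x))"
    if F: "F \<in> ucb_functions A" and H: "H \<in> ucb_functions A" for F H :: "'g \<Rightarrow> 'a"
  proof -
    show "(SUP x. cnorm A (F x \<oplus> H x)) \<le> (SUP x. cnorm A (F x)) + (SUP x. cnorm A (H x))"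
      by (rule ucb_norm_least, rule order_trans[OF norm_triangle add_mono])
         (use F H ucb_norm_upper in auto)
    show "(SUP x. cnorm A (F x \<otimes> H x)) \<le> (SUP x. cnorm A (F x)) * (SUP x. cnorm A (H x))"
      by (rule ucb_norm_least, rule order_trans[OF norm_mult mult_mono])
         (use F H ucb_norm_upper ucb_norm_nonneg in auto)
  qed
  then show ?case by auto
next
  case 11
  have "(SUP x. cnorm A (adj A (F x) \<otimes> F x)) = (SUP x. cnorm A (F x))\<^sup>2"
    if F: "F \<in> ucb_functions A" for F :: "'g \<Rightarrow> 'a"
  proof (rule antisym)
    have eq: "cnorm A (adj A (F x) \<otimes> F x) = (cnorm A (F x))\<^sup>2" for x
      using F by (simp add: norm_adj_mult)
    show "(SUP x. cnorm A (adj A (F x) \<otimes> F x)) \<le> (SUP x. cnorm A (F x))\<^sup>2"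
      using F ucb_norm_upper[OF F] by (intro ucb_norm_least) (simp add: eq power_mono)
    have "(SUP x. cnorm A (F x)) \<le> sqrt (SUP x. cnorm A (adj A (F x) \<otimes> F x))"
    proof (rule ucb_norm_least)
      fix x show "cnorm A (F x) \<le> sqrt (SUP x. cnorm A (adj A (F x) \<otimes> F x))"
        using ucb_norm_upper[of "\<lambda>x. adj A (F x) \<otimes> F x" x] F by (intro real_le_rsqrt) (simp add: eq)
    qed
    then show "(SUP x. cnorm A (F x))\<^sup>2 \<le> (SUP x. cnorm A (adj A (F x) \<otimes> F x))"
      using ucb_norm_nonneg[OF F] ucb_norm_nonneg[of "\<lambda>x. adj A (F x) \<otimes> F x"] F
      by (metis real_sqrt_le_iff real_sqrt_abs abs_of_nonneg ucb_adj ucb_mult)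
  qed
  then show ?case by auto
next
  case 12
  show ?case
  proof (intro allI impI)
    fix X :: "nat \<Rightarrow> ('g \<times> 'a) set"
    assume X: "\<forall>n. X n \<in> carrier (ucb_algebra A)"
      and Cauchy: "\<forall>e>0. \<exists>N. \<forall>m\<ge>N. \<forall>n\<ge>N. cnorm (ucb_algebra A) (X m \<ominus>\<^bsub>ucb_algebra A\<^esub> X n) < e"
    from X obtain F where F: "\<And>n. F n \<in> ucb_functions A" and XF: "\<And>n. X n = graph (F n)"
      by (simp add: image_iff) metis
    have "\<exists>H\<in>ucb_functions A. (\<lambda>n. SUP x. cnorm A (F n x \<ominus> H x)) \<longlonglongrightarrow> 0"
      by (rule ucb_complete[OF F]) (use Cauchy in \<open>simp add: XF ucb_algebra_minus F\<close>)
    then obtain H where "H \<in> ucb_functions A" "(\<lambda>n. SUP x. cnorm A (F n x \<ominus> H x)) \<longlonglongrightarrow> 0"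
      by blast
    then show "\<exists>x\<in>carrier (ucb_algebra A). (\<lambda>n. cnorm (ucb_algebra A) (X n \<ominus>\<^bsub>ucb_algebra A\<^esub> x)) \<longlonglongrightarrow> 0"
      by (intro bexI[of _ "graph H"]) (simp_all add: XF ucb_algebra_minus F)
  qed
qed (auto simp: module_ucb_algebra mult_assoc distr_l distr_r smult_mult_l smult_mult_r
       adj_add adj_mult adj_smult)

lemma G_cstar_algebra_ucb_algebra:
  "G_cstar_algebra (ucb_algebra A :: ('g::topological_group_add \<times> 'a) set cstar_alg) translate"
  unfolding G_cstar_algebra_def
proof (intro conjI allI ballI)
  fix g :: 'g
  show "star_hom (ucb_algebra A) (ucb_algebra A) (translate g)"
    by (auto simp: star_hom_def linear_map_def ucb_translate)
  show "bij_betw (translate g) (carrier (ucb_algebra A)) (carrier (ucb_algebra A))"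
    by (rule bij_betw_byWitness[where f' = "translate (- g)"])
       (use ucb_translate[of _ g] ucb_translate[of _ "- g"] in \<open>auto simp: add.assoc[symmetric]\<close>)
next
  fix g h :: 'g and S :: "('g \<times> 'a) set" assume "S \<in> carrier (ucb_algebra A)"
  then show "translate (g + h) S = translate g (translate h S)"
    by (auto simp: group_add_class.minus_add add.assoc simp del: add_uminus_conv_diff)
next
  fix S :: "('g \<times> 'a) set" and t :: 'g assume "S \<in> carrier (ucb_algebra A)"
  then obtain F where F: "F \<in> ucb_functions A" and S: "S = graph F" by auto
  have lim: "((\<lambda>s. - s + t) \<longlongrightarrow> 0) (at t)"
    using tendsto_add[OF tendsto_minus[OF tendsto_ident_at] tendsto_const[of t], of t UNIV] by simp
  show "((\<lambda>s. cnorm (ucb_algebra A) (translate s S \<ominus>\<^bsub>ucb_algebra A\<^esub> translate t S)) \<longlongrightarrow> 0) (at t)"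
  proof (rule tendstoI)
    fix e :: real assume e: "e > 0"
    have "\<forall>\<^sub>F s in at t. \<forall>x. cnorm A (F ((- s + t) + x) \<ominus> F x) \<le> e / 2"
      using e by (intro eventually_compose_filterlim[OF ucb_cont[OF F] lim]) simp
    then show "\<forall>\<^sub>F s in at t. dist (cnorm (ucb_algebra A)
        (translate s S \<ominus>\<^bsub>ucb_algebra A\<^esub> translate t S)) 0 < e"
    proof eventually_elim
      case (elim s)
      \<comment> \<open>In the variable \<open>- t + x\<close>, the difference of the two translates
        is a displacement by \<open>- s + t\<close>, which tends to 0 as \<open>s\<close> tends to
        \<open>t\<close>.\<close>
      have "- s + x = (- s + t) + (- t + x)" for x by (simp add: add.assoc)
      then have "cnorm A (F (- s + x) \<ominus> F (- t + x)) \<le> e / 2" for x using elim by metis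
      then have "(SUP x. cnorm A (F (- s + x) \<ominus> F (- t + x))) \<le> e / 2"
        by (rule ucb_norm_least)
      moreover have "(SUP x. cnorm A (F (- s + x) \<ominus> F (- t + x))) \<ge> 0"
        by (intro ucb_norm_nonneg ucb_diff ucb_translate F)
      ultimately show ?case using e by (simp add: S ucb_algebra_minus ucb_translate F)
    qed
  qed
qed (rule cstar_algebra_ucb_algebra)

end

section \<open>From an equivariant contraction to an invariant mean\<close>

text \<open>The definition of \<open>UCB\<close> uses the punctured filter and \<open>- g\<close>.
  At \<open>g = 0\<close> the difference vanishes, so the point can be filled in, and inversion is
  continuous at 0.\<close>

lemma ucb_cont_0:
  fixes f :: "'g::topological_group_add \<Rightarrow> complex"
  assumes f: "f \<in> UCB" and e: "e > 0"
  shows "\<forall>\<^sub>F s in nhds 0. \<forall>x. cmod (f (s + x) - f x) < e"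
proof -
  have "uniform_limit UNIV (\<lambda>g x. f (- g + x)) (\<lambda>x. f (- 0 + x)) (at 0)"
    using f unfolding UCB_def by blast
  then have "\<forall>\<^sub>F g in at 0. \<forall>x. cmod (f (- g + x) - f x) < e"
    using e by (simp add: uniform_limit_iff dist_norm)
  then have "\<forall>\<^sub>F g in nhds 0. \<forall>x. cmod (f (- g + x) - f x) < e"
    using e by (auto simp: eventually_at_filter elim!: eventually_mono)
  moreover have "((\<lambda>s::'g. - s) \<longlongrightarrow> 0) (nhds 0)"
    using tendsto_minus[OF filterlim_ident, of "0::'g"] by simp
  ultimately have "\<forall>\<^sub>F s in nhds 0. \<forall>x. cmod (f (- (- s) + x) - f x) < e"
    by (rule eventually_compose_filterlim)
  then show ?thesis by simp
qed

lemma UCB_bounded: "f \<in> UCB \<Longrightarrow> \<exists>K. \<forall>x. cmod (f x) \<le> K"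
  by (auto simp: UCB_def bounded_iff)

lemma UCB_const [simp]: "(\<lambda>x. c) \<in> UCB"
  by (simp add: UCB_def uniform_limit_const)

lemma UCB_add [simp]: "f \<in> UCB \<Longrightarrow> h \<in> UCB \<Longrightarrow> (\<lambda>x. f x + h x) \<in> UCB"
  by (auto simp: UCB_def uniform_limit_add intro: bounded_plus_comp)

lemma bounded_linear_UCB:
  fixes L :: "complex \<Rightarrow> complex"
  assumes L: "bounded_linear L" and f: "f \<in> UCB"
  shows "(\<lambda>x. L (f x)) \<in> UCB"
proof -
  have "bounded (range (\<lambda>x. L (f x)))"
    using bounded_linear_image[OF _ L, of "range f"] f by (simp add: UCB_def image_image)
  moreover have "uniform_limit UNIV (\<lambda>g x. L (f (- g + x))) (\<lambda>x. L (f (- s + x))) (at s)" for s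
    by (rule bounded_linear.uniform_limit[OF L]) (use f in \<open>simp add: UCB_def\<close>)
  ultimately show ?thesis by (simp add: UCB_def)
qed

lemma UCB_mult_const [simp]: "f \<in> UCB \<Longrightarrow> (\<lambda>x. c * f x) \<in> UCB"
  by (rule bounded_linear_UCB[OF bounded_linear_mult_right])

lemma UCB_Re [simp]: "f \<in> UCB \<Longrightarrow> (\<lambda>x. of_real (Re (f x))) \<in> UCB"
  by (rule bounded_linear_UCB)
     (intro bounded_linear_compose[OF bounded_linear_of_real] bounded_linear_Re)

lemma UCB_Im [simp]: "f \<in> UCB \<Longrightarrow> (\<lambda>x. of_real (Im (f x))) \<in> UCB"
  by (rule bounded_linear_UCB)
     (intro bounded_linear_compose[OF bounded_linear_of_real] bounded_linear_Im)

lemma UCB_translate [simp]: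
  fixes f :: "'g::topological_group_add \<Rightarrow> complex"
  assumes f: "f \<in> UCB" shows "(\<lambda>x. f (- g + x)) \<in> UCB"
proof -
  have "uniform_limit UNIV (\<lambda>s x. f (- g + (- s + x))) (\<lambda>x. f (- g + (- t + x))) (at t)" for t
  proof (rule uniform_limitI)
    fix e :: real assume e: "e > 0"
    \<comment> \<open>The displacement that turns \<open>- g + (- t + x)\<close> into
      \<open>- g + (- s + x)\<close> is the conjugate by \<open>g\<close> of
      \<open>- s + t\<close>.\<close>
    have "((\<lambda>s. - g + - s + t + g) \<longlongrightarrow> - g + - t + t + g) (nhds t)"
      by (intro tendsto_add tendsto_const tendsto_minus filterlim_ident)
    then have "((\<lambda>s. - g + - s + t + g) \<longlongrightarrow> 0) (nhds t)" by (simp add: add.assoc)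
    then have "\<forall>\<^sub>F s in nhds t. \<forall>x. cmod (f (- g + - s + t + g + x) - f x) < e"
      by (rule eventually_compose_filterlim[OF ucb_cont_0[OF f e]])
    then have "\<forall>\<^sub>F s in nhds t. \<forall>x\<in>UNIV. dist (f (- g + (- s + x))) (f (- g + (- t + x))) < e"
    proof eventually_elim
      case (elim s)
      show ?case
      proof
        fix x
        have "- g + - s + t + g + (- g + (- t + x)) = - g + (- s + x)"
          by (simp add: add.assoc del: add_uminus_conv_diff)
        then show "dist (f (- g + (- s + x))) (f (- g + (- t + x))) < e"
          using elim[rule_format, of "- g + (- t + x)"] by (simp add: dist_norm)
      qed
    qed
    then show "\<forall>\<^sub>F s in at t. \<forall>x\<in>UNIV. dist (f (- g + (- s + x))) (f (- g + (- t + x))) < e"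
      by (simp add: eventually_at_filter eventually_mono)
  qed
  moreover have "bounded (range (\<lambda>x. f (- g + x)))"
    using f by (auto simp: UCB_def intro: bounded_subset)
  ultimately show ?thesis by (simp add: UCB_def)
qed

text \<open>A unital functional of norm \<open>1\<close> is positive: its value at \<open>f\<close> lies in every disc that
  contains the range of \<open>f\<close>.\<close>

lemma amenableI:
  fixes m :: "('g::topological_group_add \<Rightarrow> complex) \<Rightarrow> complex"
  assumes add: "\<And>f h. f \<in> UCB \<Longrightarrow> h \<in> UCB \<Longrightarrow> m (\<lambda>x. f x + h x) = m f + m h"
    and scale: "\<And>c f. f \<in> UCB \<Longrightarrow> m (\<lambda>x. c * f x) = c * m f"
    and bound: "\<And>f K. f \<in> UCB \<Longrightarrow> (\<And>x. cmod (f x) \<le> K) \<Longrightarrow> cmod (m f) \<le> K"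
    and one: "m (\<lambda>x. 1) = 1"
    and inv: "\<And>g f. f \<in> UCB \<Longrightarrow> m (\<lambda>x. f (- g + x)) = m f"
  shows "amenable TYPE('g)"
proof -
  have "m f \<in> \<real>\<^sub>\<ge>\<^sub>0" if f: "f \<in> UCB" and pos: "\<And>x. f x \<in> \<real>\<^sub>\<ge>\<^sub>0" for f
  proof -
    obtain K where K: "\<And>x. cmod (f x) \<le> 2 * K" using UCB_bounded[OF f]
      by (metis mult.commute nonzero_mult_div_cancel_left times_divide_eq_right zero_neq_numeral)
    have K0: "K \<ge> 0" using K[of undefined] norm_ge_zero[of "f undefined"] by linarith
    have fx: "Im (f x) = 0" "0 \<le> Re (f x)" "Re (f x) \<le> 2 * K" for x
      using pos[of x] K[of x] complex_Re_le_cmod[of "f x"] by (auto simp: complex_nonneg_Reals_iff)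
    define z where "z = m f"
    \<comment> \<open>The values of \<open>f\<close> lie in the interval from 0 to
      \<open>2 * K\<close>. For every real \<open>t\<close>, the circle around
      \<open>K + i t\<close> of radius \<open>sqrt (K\<^sup>2 + t\<^sup>2)\<close> passes through
      both ends, so its disc contains the interval.\<close>
    have disc: "(Re z - K)\<^sup>2 + (Im z - t)\<^sup>2 \<le> K\<^sup>2 + t\<^sup>2" for t
    proof -
      have "m (\<lambda>x. - Complex K t * 1) = - Complex K t * m (\<lambda>x. 1)"
        by (rule scale) simp
      then have "m (\<lambda>x. f x + - Complex K t) = z - Complex K t"
        using add[OF f UCB_const, of "- Complex K t"] by (simp add: z_def one)
      moreover have "cmod (f x + - Complex K t) \<le> sqrt (K\<^sup>2 + t\<^sup>2)" for x
      proof -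
        have "(Re (f x) - K)\<^sup>2 \<le> K\<^sup>2" using fx[of x] by (intro power2_le_iff_abs_le[THEN iffD2]) auto
        then show ?thesis using fx[of x] by (simp add: cmod_def)
      qed
      ultimately have "cmod (z - Complex K t) \<le> sqrt (K\<^sup>2 + t\<^sup>2)"
        using bound[OF UCB_add[OF f UCB_const]] by metis
      then show ?thesis by (simp add: cmod_def)
    qed
    have lin: "(Re z - K)\<^sup>2 + (Im z)\<^sup>2 - 2 * t * Im z \<le> K\<^sup>2" for t
      using disc[of t] by (simp add: power2_eq_square algebra_simps)
    have "Im z = 0"
    proof (rule ccontr)
      assume ne: "Im z \<noteq> 0"
      \<comment> \<open>The inequality \<open>lin\<close> is linear in \<open>t\<close> and holds
        for all \<open>t\<close>. This choice makes the linear term \<open>K\<^sup>2 + 1\<close>,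
        which exceeds the right-hand side.\<close>
      define t where "t = - (K\<^sup>2 + 1) / (2 * Im z)"
      have "- 2 * t * Im z = K\<^sup>2 + 1" using ne by (simp add: t_def)
      then show False using lin[of t] zero_le_power2[of "Re z - K"] zero_le_power2[of "Im z"] by linarith
    qed
    moreover have "0 \<le> Re z"
      using lin[of 0] \<open>Im z = 0\<close> K0 power2_le_iff_abs_le[of K "Re z - K"] by simp
    ultimately show ?thesis by (simp add: z_def complex_nonneg_Reals_iff)
  qed
  then show ?thesis unfolding amenable_def using add scale one inv by (intro exI[of _ m]) auto
qed


section \<open>The action of the group and the embedding into the function algebra\<close>

locale G_cstar = cstar A for A :: "'a cstar_alg" (structure) +
  fixes \<alpha> :: "'g::topological_group_add \<Rightarrow> 'a \<Rightarrow> 'a"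
  assumes G_cstar: "G_cstar_algebra A \<alpha>"
begin

sublocale act: cstar_hom A A "\<alpha> g" for g
  using G_cstar by unfold_locales (simp add: G_cstar_algebra_def)

lemma act_add: "a \<in> carrier A \<Longrightarrow> \<alpha> (g + h) a = \<alpha> g (\<alpha> h a)"
  using G_cstar by (simp add: G_cstar_algebra_def)

text \<open>\<open>\<alpha> 0\<close> is idempotent and injective on the carrier, hence the identity
  there.\<close>

lemma act_0 [simp]: assumes "a \<in> carrier A" shows "\<alpha> 0 a = a"
proof -
  have "inj_on (\<alpha> 0) (carrier A)"
    using G_cstar by (simp add: G_cstar_algebra_def bij_betw_def)
  then show ?thesis using act_add[OF assms, of 0 0] assms by (simp add: inj_on_eq_iff)
qed

text \<open>\<open>\<alpha> g\<close> and its inverse \<open>\<alpha> (- g)\<close> are both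
  *-homomorphisms, hence contractive.\<close>

lemma norm_act [simp]: assumes "a \<in> carrier A" shows "cnorm A (\<alpha> g a) = cnorm A a"
proof (rule antisym)
  show "cnorm A (\<alpha> g a) \<le> cnorm A a" by (rule act.hom_contractive[OF assms])
  show "cnorm A a \<le> cnorm A (\<alpha> g a)"
    using act.hom_contractive[of "\<alpha> g a" "- g"] act_add[OF assms, of "- g" g] assms by simp
qed

lemma act_cont:
  assumes a: "a \<in> carrier A" and e: "e > 0"
  shows "\<forall>\<^sub>F s in nhds 0. cnorm A (\<alpha> (- s) a \<ominus> a) < e"
proof -
  have "((\<lambda>s. cnorm A (\<alpha> s a \<ominus> \<alpha> 0 a)) \<longlongrightarrow> 0) (at 0)"
    using G_cstar a unfolding G_cstar_algebra_def by blast
  then have "\<forall>\<^sub>F s in at 0. cnorm A (\<alpha> s a \<ominus> a) < e"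
    using order_tendstoD(2)[OF _ e] a by simp
  moreover have "cnorm A (\<alpha> 0 a \<ominus> a) < e"
    using a e by (simp add: a_minus_def r_neg)
  ultimately have "\<forall>\<^sub>F s in nhds 0. cnorm A (\<alpha> s a \<ominus> a) < e"
    by (auto simp: eventually_at_filter elim!: eventually_mono)
  moreover have "((\<lambda>s::'g. - s) \<longlongrightarrow> 0) (nhds 0)"
    using tendsto_minus[OF filterlim_ident, of "0::'g"] by simp
  ultimately show ?thesis by (rule eventually_compose_filterlim)
qed

text \<open>This is the product \<open>f d\<close> of the overview; \<open>f = 1\<close> gives the
  embedding to which the G-WEP is applied.\<close>

definition tensor :: "('g \<Rightarrow> complex) \<Rightarrow> 'a \<Rightarrow> ('g \<times> 'a) set" where
  "tensor f a = graph (\<lambda>x. f x \<odot> \<alpha> (- x) a)"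

lemma tensor_ucb:
  assumes f: "f \<in> UCB" and a: "a \<in> carrier A"
  shows "(\<lambda>x. f x \<odot> \<alpha> (- x) a) \<in> ucb_functions A"
proof -
  obtain K where K: "\<And>x. cmod (f x) \<le> K" using UCB_bounded[OF f] by blast
  then have K0: "0 \<le> K" using norm_ge_zero order_trans by blast
  show ?thesis
  proof (rule ucb_functionsI[where K = "K * cnorm A a" and C = "K + cnorm A a"])
    fix x show "cnorm A (f x \<odot> \<alpha> (- x) a) \<le> K * cnorm A a"
      using a K by (simp add: norm_smult mult_right_mono)
  next
    fix e :: real assume e: "e > 0"
    show "\<forall>\<^sub>F s in nhds 0. \<forall>x. cnorm A (f (s + x) \<odot> \<alpha> (- (s + x)) a \<ominus> f x \<odot> \<alpha> (- x) a) \<le> (K + cnorm A a) * e"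
      using ucb_cont_0[OF f e] act_cont[OF a e]
    proof eventually_elim
      case (elim s)
      show ?case
      proof
        fix x
        define b where "b = \<alpha> (- x) (\<alpha> (- s) a)"
        define c where "c = \<alpha> (- x) a"
        have bc: "b \<in> carrier A" "c \<in> carrier A" using a by (auto simp: b_def c_def)
        have b: "\<alpha> (- (s + x)) a = b"
          using act_add[OF a, of "- x" "- s"] unfolding group_add_class.minus_add b_def .
        \<comment> \<open>Since \<open>\<alpha> (- x)\<close> is isometric, continuity of the orbit
          of \<open>a\<close> at 0 gives an estimate uniform in \<open>x\<close>.\<close>
        have "b \<ominus> c = \<alpha> (- x) (\<alpha> (- s) a \<ominus> a)" using a by (simp add: b_def c_def act.hom_diff)
        then have 1: "cnorm A (b \<ominus> c) \<le> e" using a elim by simp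
        have "f (s + x) \<odot> b \<ominus> f x \<odot> c = f (s + x) \<odot> (b \<ominus> c) \<oplus> (f (s + x) - f x) \<odot> c"
          using bc by (simp add: smult_diff_l smult_diff_r diff_add_diff)
        then have "cnorm A (f (s + x) \<odot> b \<ominus> f x \<odot> c) \<le>
            cmod (f (s + x)) * cnorm A (b \<ominus> c) + cmod (f (s + x) - f x) * cnorm A c"
          using norm_triangle[of "f (s + x) \<odot> (b \<ominus> c)" "(f (s + x) - f x) \<odot> c"] bc
          by (simp add: norm_smult)
        also have "\<dots> \<le> K * e + e * cnorm A a"
          using K[of "s + x"] K0 1 elim(1) bc a e
          by (intro add_mono mult_mono) (auto simp: c_def less_imp_le)
        finally show "cnorm A (f (s + x) \<odot> \<alpha> (- (s + x)) a \<ominus> f x \<odot> \<alpha> (- x) a) \<le> (K + cnorm A a) * e"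
          by (simp add: b c_def algebra_simps)
      qed
    qed
  qed (use a in auto)
qed

lemma tensor_closed: "f \<in> UCB \<Longrightarrow> a \<in> carrier A \<Longrightarrow> tensor f a \<in> carrier (ucb_algebra A)"
  by (simp add: tensor_def tensor_ucb)

text \<open>Both factors move. An invariant functional therefore relates the translate of
  \<open>f\<close> paired with \<open>\<alpha> g a\<close> to \<open>f\<close> paired with
  \<open>a\<close>; invariance of the mean follows only because the choice of \<open>a\<close> is
  immaterial in the limit.\<close>

lemma translate_tensor:
  assumes a: "a \<in> carrier A"
  shows "translate g (tensor f a) = tensor (\<lambda>x. f (- g + x)) (\<alpha> g a)"
proof -
  have "\<alpha> (- (- g + x)) a = \<alpha> (- x) (\<alpha> g a)" for x
    using act_add[OF a, of "- x" g] group_add_class.minus_add[of "- g" x] by simp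
  then show ?thesis by (simp add: tensor_def)
qed

lemma star_hom_tensor_1: "star_hom A (ucb_algebra A) (tensor (\<lambda>x. 1))"
  unfolding star_hom_def linear_map_def
proof (intro conjI ballI allI)
  show "tensor (\<lambda>x. 1) a \<in> carrier (ucb_algebra A)" if "a \<in> carrier A" for a
    by (rule tensor_closed[OF UCB_const that])
qed (simp_all add: tensor_def act.hom_add act.hom_mult act.hom_adj act.hom_smult)

lemma inj_tensor_1: "inj_on (tensor (\<lambda>x. 1)) (carrier A)"
proof (rule inj_onI)
  fix a b assume ab: "a \<in> carrier A" "b \<in> carrier A" and "tensor (\<lambda>x. 1) a = tensor (\<lambda>x. 1) b"
  then have "ungraph (tensor (\<lambda>x. 1) a) 0 = ungraph (tensor (\<lambda>x. 1) b) 0" by simp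
  then show "a = b" using ab by (simp add: tensor_def)
qed

lemma equivariant_tensor_1: "equivariant A \<alpha> translate (tensor (\<lambda>x. 1))"
  by (simp add: equivariant_def translate_tensor)

end

section \<open>Bounded functionals, their norms, and evaluation of bidual elements\<close>

lemma cdualD:
  assumes "\<phi> \<in> cdual A"
  shows "x \<in> carrier A \<Longrightarrow> y \<in> carrier A \<Longrightarrow> \<phi> (x \<oplus>\<^bsub>A\<^esub> y) = \<phi> x + \<phi> y"
    "x \<in> carrier A \<Longrightarrow> \<phi> (c \<odot>\<^bsub>A\<^esub> x) = c * \<phi> x"
    "\<exists>K. \<forall>x\<in>carrier A. cmod (\<phi> x) \<le> K * cnorm A x"
    "z \<notin> carrier A \<Longrightarrow> \<phi> z = 0"
  using assms by (auto simp: cdual_def)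

lemma cdual_scale:
  assumes "\<phi> \<in> cdual A" shows "(\<lambda>x. c * \<phi> x) \<in> cdual A"
proof -
  obtain K where "\<And>x. x \<in> carrier A \<Longrightarrow> cmod (\<phi> x) \<le> K * cnorm A x"
    using cdualD(3)[OF assms] by blast
  then have "\<forall>x\<in>carrier A. cmod (c * \<phi> x) \<le> (cmod c * K) * cnorm A x"
    by (simp add: norm_mult mult.assoc mult_left_mono)
  then have "\<exists>K. \<forall>x\<in>carrier A. cmod (c * \<phi> x) \<le> K * cnorm A x" by blast
  then show ?thesis
    using cdualD(1,2,4)[OF assms] unfolding cdual_def by (simp add: distrib_left mult.left_commute)
qed

context cstar
begin

lemma cdual_zero: "\<phi> \<in> cdual A \<Longrightarrow> \<phi> \<zero> = 0"
  using cdualD(2)[of \<phi> A \<zero> 0] by simp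

lemma dual_norm_bdd_above:
  assumes "\<phi> \<in> cdual A"
  shows "bdd_above {cmod (\<phi> x) | x. x \<in> carrier A \<and> cnorm A x \<le> 1}"
proof -
  obtain K where K: "\<And>x. x \<in> carrier A \<Longrightarrow> cmod (\<phi> x) \<le> K * cnorm A x"
    using cdualD(3)[OF assms] by blast
  have "cmod (\<phi> x) \<le> \<bar>K\<bar>" if "x \<in> carrier A" "cnorm A x \<le> 1" for x
  proof -
    have "K * cnorm A x \<le> \<bar>K\<bar> * 1" using that by (intro mult_mono) auto
    then show ?thesis using K[OF that(1)] by simp
  qed
  then show ?thesis by (auto intro!: bdd_aboveI)
qed

lemma norm_le_dual_norm:
  assumes \<phi>: "\<phi> \<in> cdual A" and x: "x \<in> carrier A"
  shows "cmod (\<phi> x) \<le> dual_norm A \<phi> * cnorm A x"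
proof (cases "cnorm A x = 0")
  case True then show ?thesis using x cdual_zero[OF \<phi>] by simp
next
  case False
  then have pos: "cnorm A x > 0" using x norm_ge_0[of x] by linarith
  then have ne: "x \<noteq> \<zero>" by auto
  let ?y = "of_real (1 / cnorm A x) \<odot> x"
  have "cnorm A ?y = 1" using x ne by (simp add: norm_smult norm_divide)
  then have "cmod (\<phi> ?y) \<le> dual_norm A \<phi>"
    unfolding dual_norm_def using x by (intro cSup_upper dual_norm_bdd_above[OF \<phi>]) auto
  then show ?thesis using pos ne x cdualD(2)[OF \<phi> x]
    by (simp add: Real_Vector_Spaces.norm_mult norm_divide field_simps)
qed

lemma dual_norm_nonneg: "\<phi> \<in> cdual A \<Longrightarrow> 0 \<le> dual_norm A \<phi>"
  unfolding dual_norm_def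
  by (rule cSup_upper2[of 0]) (auto intro: dual_norm_bdd_above exI[of _ \<zero>] simp: cdual_zero)

lemma dual_norm_le:
  assumes "\<And>x. x \<in> carrier A \<Longrightarrow> cnorm A x \<le> 1 \<Longrightarrow> cmod (\<phi> x) \<le> K"
  shows "dual_norm A \<phi> \<le> K"
  unfolding dual_norm_def using assms by (intro cSup_least) (auto intro: exI[of _ \<zero>])

lemma bidual_norm_upper:
  assumes \<Phi>: "\<Phi> \<in> carrier (bidual A)" and \<phi>: "\<phi> \<in> cdual A" "dual_norm A \<phi> \<le> 1"
  shows "cmod (\<Phi> \<phi>) \<le> cnorm (bidual A) \<Phi>"
proof -
  obtain K where K: "\<And>\<phi>. \<phi> \<in> cdual A \<Longrightarrow> cmod (\<Phi> \<phi>) \<le> K * dual_norm A \<phi>"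
    using \<Phi> unfolding bidual_def bidual_carrier_def by simp blast
  have "cmod (\<Phi> \<phi>) \<le> \<bar>K\<bar>" if "\<phi> \<in> cdual A" "dual_norm A \<phi> \<le> 1" for \<phi>
  proof -
    have "K * dual_norm A \<phi> \<le> \<bar>K\<bar> * 1"
      using that dual_norm_nonneg by (intro mult_mono) auto
    then show ?thesis using K[OF that(1)] by simp
  qed
  then have "bdd_above {cmod (\<Phi> \<phi>) | \<phi>. \<phi> \<in> cdual A \<and> dual_norm A \<phi> \<le> 1}"
    by (auto intro!: bdd_aboveI)
  then show ?thesis unfolding bidual_def using \<phi> by (auto intro!: cSup_upper)
qed

end

context G_cstar
begin

text \<open>The hypotheses \<open>contr\<close> and \<open>norming\<close> together say that
  \<open>\<psi>\<close> has norm 1, without requiring the norm to be attained. The mean is a limit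
  along contractions that almost attain it.\<close>

lemma amenable_of_equivariant_contraction:
  assumes \<psi>: "\<psi> \<in> cdual A" and inv: "\<And>g a. a \<in> carrier A \<Longrightarrow> \<psi> (\<alpha> g a) = \<psi> a"
    and contr: "\<And>a. a \<in> carrier A \<Longrightarrow> cmod (\<psi> a) \<le> cnorm A a"
    and norming: "\<And>e. e > 0 \<Longrightarrow> \<exists>a\<in>carrier A. cnorm A a \<le> 1 \<and> 1 - e \<le> cmod (\<psi> a)"
    and lin: "linear_map (ucb_algebra A) (bidual A) E"
    and contrE: "contraction (ucb_algebra A) (bidual A) E"
    and equiv: "equivariant (ucb_algebra A) translate (bidual_action A \<alpha>) E"
    and ext: "\<And>a. a \<in> carrier A \<Longrightarrow> E (tensor (\<lambda>x. 1) a) = bidual_emb A a"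
  shows "amenable TYPE('g)"
proof -
  define T where "T = (\<lambda>f a. E (tensor f a) \<psi>)"
  have Ec: "E S \<in> carrier (bidual A)" if "S \<in> carrier (ucb_algebra A)" for S
    using lin that unfolding linear_map_def by blast
  have "dual_norm A \<psi> \<le> 1"
    by (rule dual_norm_le) (use contr in fastforce)
  then have norm_E: "cmod (E S \<psi>) \<le> cnorm (ucb_algebra A) S" if "S \<in> carrier (ucb_algebra A)" for S
    using bidual_norm_upper[OF Ec[OF that] \<psi>] contrE that unfolding contraction_def
    by (meson order_trans)
  have E_add: "E (S \<oplus>\<^bsub>ucb_algebra A\<^esub> S') \<psi> = E S \<psi> + E S' \<psi>"
    if "S \<in> carrier (ucb_algebra A)" "S' \<in> carrier (ucb_algebra A)" for S S'
  proof -
    have "E (S \<oplus>\<^bsub>ucb_algebra A\<^esub> S') = E S \<oplus>\<^bsub>bidual A\<^esub> E S'"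
      using lin that unfolding linear_map_def by blast
    then show ?thesis by (simp add: bidual_def)
  qed
  have E_smult: "E (c \<odot>\<^bsub>ucb_algebra A\<^esub> S) \<psi> = c * E S \<psi>" if "S \<in> carrier (ucb_algebra A)" for S c
  proof -
    have "E (c \<odot>\<^bsub>ucb_algebra A\<^esub> S) = c \<odot>\<^bsub>bidual A\<^esub> E S"
      using lin that unfolding linear_map_def by blast
    then show ?thesis by (simp add: bidual_def)
  qed
  have \<psi>_inv: "on_carrier A (\<lambda>a. \<psi> (\<alpha> g a)) = \<psi>" for g
    using inv cdualD(4)[OF \<psi>] by (auto simp: on_carrier_def)
  have E_inv: "E (translate g S) \<psi> = E S \<psi>" if "S \<in> carrier (ucb_algebra A)" for g S
  proof -
    have "E (translate g S) = bidual_action A \<alpha> g (E S)"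
      using equiv that unfolding equivariant_def by blast
    then show ?thesis using \<psi> by (simp add: bidual_action_def on_dual_def \<psi>_inv)
  qed
  have T_add: "T (\<lambda>x. f x + h x) a = T f a + T h a" if "f \<in> UCB" "h \<in> UCB" "a \<in> carrier A" for f h a
    using E_add[OF tensor_closed[OF that(1,3)] tensor_closed[OF that(2,3)]] that
    by (simp add: T_def tensor_def smult_add_l)
  have T_scale: "T (\<lambda>x. c * f x) a = c * T f a" if "f \<in> UCB" "a \<in> carrier A" for f c a
    using E_smult[OF tensor_closed[OF that]] that
    by (simp add: T_def tensor_def smult_smult)
  have T_1: "T (\<lambda>x. 1) a = \<psi> a" if "a \<in> carrier A" for a
    using ext[OF that] \<psi> by (simp add: T_def bidual_emb_def on_dual_def)
  have T_translate: "T (\<lambda>x. f (- g + x)) (\<alpha> g a) = T f a" if "f \<in> UCB" "a \<in> carrier A" for f g a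
    using E_inv[OF tensor_closed[OF that], of g] that by (simp add: T_def translate_tensor)
  \<comment> \<open>The norm of \<open>f a + h b\<close> is estimated at each point \<open>x\<close>
    separately, so only the sum of the two moduli counts. With \<open>h = 1 - f\<close> and
    \<open>f\<close> valued in the unit interval the bound is 1.\<close>
  have T_bound2: "cmod (T f a + T h b) \<le> K"
    if fh: "f \<in> UCB" "h \<in> UCB" and a: "a \<in> carrier A" "cnorm A a \<le> 1"
      and b: "b \<in> carrier A" "cnorm A b \<le> 1" and K: "\<And>x. cmod (f x) + cmod (h x) \<le> K" for f h a b K
  proof -
    let ?S = "tensor f a \<oplus>\<^bsub>ucb_algebra A\<^esub> tensor h b"
    have S: "?S = graph (\<lambda>x. f x \<odot> \<alpha> (- x) a \<oplus> h x \<odot> \<alpha> (- x) b)"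
      by (simp add: tensor_def)
    have Sc: "?S \<in> carrier (ucb_algebra A)"
      unfolding S using tensor_ucb[OF fh(1) a(1)] tensor_ucb[OF fh(2) b(1)] by simp
    have "cmod (T f a + T h b) \<le> cnorm (ucb_algebra A) ?S"
      using norm_E[OF Sc] E_add[OF tensor_closed[OF fh(1) a(1)] tensor_closed[OF fh(2) b(1)]]
      by (simp add: T_def)
    also have "\<dots> \<le> K"
      unfolding S ucb_algebra_simps
    proof (rule ucb_norm_least)
      fix x
      have "cnorm A (f x \<odot> \<alpha> (- x) a \<oplus> h x \<odot> \<alpha> (- x) b) \<le> cmod (f x) * cnorm A a + cmod (h x) * cnorm A b"
        using norm_triangle[of "f x \<odot> \<alpha> (- x) a" "h x \<odot> \<alpha> (- x) b"] a b by (simp add: norm_smult)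
      also have "\<dots> \<le> cmod (f x) + cmod (h x)"
        using a b by (intro add_mono mult_left_le) auto
      finally show "cnorm A (f x \<odot> \<alpha> (- x) a \<oplus> h x \<odot> \<alpha> (- x) b) \<le> K" using K[of x] by linarith
    qed
    finally show ?thesis .
  qed
  have T_bound: "cmod (T f a) \<le> K"
    if "f \<in> UCB" "a \<in> carrier A" "cnorm A a \<le> 1" "\<And>x. cmod (f x) \<le> K" for f a K
  proof -
    have "T (\<lambda>x. 0) a = 0" using T_scale[of "\<lambda>x. 1" a 0] that by simp
    then show ?thesis using T_bound2[of f "\<lambda>x. 0" a a K] that by simp
  qed

  \<comment> \<open>\<open>good\<close> elements almost attain the norm of \<open>\<psi>\<close>
    with a real value. The action preserves them, as \<open>\<psi>\<close> is invariant and
    \<open>\<alpha> g\<close> isometric.\<close>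
  define good where "good = (\<lambda>\<delta> a. a \<in> carrier A \<and> cnorm A a \<le> 1 \<and> Im (\<psi> a) = 0 \<and> 1 - \<delta> \<le> Re (\<psi> a))"
  have good_le_1: "Re (\<psi> a) \<le> 1" if "good \<delta> a" for a \<delta>
    using that contr[of a] complex_Re_le_cmod[of "\<psi> a"] by (auto simp: good_def)
  have good_mono: "good \<delta> a \<Longrightarrow> \<delta> \<le> \<delta>' \<Longrightarrow> good \<delta>' a" for \<delta> \<delta>' a
    by (auto simp: good_def)
  have good_act: "good \<delta> a \<Longrightarrow> good \<delta> (\<alpha> g a)" for \<delta> a g
    by (auto simp: good_def inv)
  have good_ex: "\<exists>a. good \<delta> a" if \<delta>: "\<delta> > 0" for \<delta>
  proof -
    obtain a where a: "a \<in> carrier A" "cnorm A a \<le> 1" "1 - \<delta> \<le> cmod (\<psi> a)"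
      using norming[OF \<delta>] by blast
    \<comment> \<open>A phase that rotates \<open>\<psi> a\<close> onto the nonnegative real
      axis.\<close>
    define c where "c = (if \<psi> a = 0 then 1 else cnj (\<psi> a) / of_real (cmod (\<psi> a)))"
    have c: "cmod c = 1" by (simp add: c_def norm_divide)
    have "c * \<psi> a = of_real (cmod (\<psi> a))"
      by (simp add: c_def mult.commute[of "cnj _"] complex_norm_square[symmetric] power2_eq_square)
    then have "\<psi> (c \<odot> a) = of_real (cmod (\<psi> a))" using cdualD(2)[OF \<psi> a(1)] by simp
    then have "good \<delta> (c \<odot> a)" using a c by (simp add: good_def norm_smult)
    then show ?thesis by blast
  qed

  \<comment> \<open>\<open>Q f\<close> is the Cauchy condition for \<open>T f\<close> along good
    elements as the tolerance tends to 0. It is proved for \<open>f\<close> with values in the unit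
    interval and carried to all of \<open>UCB\<close> by linearity.\<close>
  define Q where "Q = (\<lambda>f. \<forall>e>0. \<exists>\<delta>>0. \<forall>a b. good \<delta> a \<longrightarrow> good \<delta> b \<longrightarrow> cmod (T f a - T f b) < e)"
  have Q_1: "Q (\<lambda>x. 1)"
    unfolding Q_def
  proof (intro allI impI)
    fix e :: real assume e: "e > 0"
    have "cmod (T (\<lambda>x. 1) a - T (\<lambda>x. 1) b) < e" if ab: "good (e/2) a" "good (e/2) b" for a b
    proof -
      have "\<psi> a - \<psi> b = of_real (Re (\<psi> a) - Re (\<psi> b))"
        using ab by (simp add: good_def complex_eq_iff)
      then have "cmod (\<psi> a - \<psi> b) = \<bar>Re (\<psi> a) - Re (\<psi> b)\<bar>" by (metis norm_of_real)
      moreover have "1 - e/2 \<le> Re (\<psi> a)" "1 - e/2 \<le> Re (\<psi> b)" using ab by (auto simp: good_def)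
      ultimately show ?thesis
        using e ab T_1 good_le_1[OF ab(1)] good_le_1[OF ab(2)] by (simp add: good_def)
    qed
    then show "\<exists>\<delta>>0. \<forall>a b. good \<delta> a \<longrightarrow> good \<delta> b \<longrightarrow> cmod (T (\<lambda>x. 1) a - T (\<lambda>x. 1) b) < e"
      using e by (intro exI[of _ "e/2"]) auto
  qed
  have Q_add: "Q (\<lambda>x. f x + h x)" if Q: "Q f" "Q h" and fh: "f \<in> UCB" "h \<in> UCB" for f h
    unfolding Q_def
  proof (intro allI impI)
    fix e :: real assume e: "e > 0"
    then have e2: "e / 2 > 0" by simp
    obtain d where d: "d > 0" "\<And>a b. good d a \<Longrightarrow> good d b \<Longrightarrow> cmod (T f a - T f b) < e/2"
      using Q(1) e2 unfolding Q_def by metis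
    obtain d' where d': "d' > 0" "\<And>a b. good d' a \<Longrightarrow> good d' b \<Longrightarrow> cmod (T h a - T h b) < e/2"
      using Q(2) e2 unfolding Q_def by metis
    have "cmod (T (\<lambda>x. f x + h x) a - T (\<lambda>x. f x + h x) b) < e"
      if "good (min d d') a" "good (min d d') b" for a b
    proof -
      have "cmod (T f a - T f b) < e/2" "cmod (T h a - T h b) < e/2"
        using that good_mono d d' by (meson min.cobounded1 min.cobounded2)+
      moreover have "T (\<lambda>x. f x + h x) a - T (\<lambda>x. f x + h x) b = (T f a - T f b) + (T h a - T h b)"
        using T_add[OF fh] that by (simp add: good_def)
      ultimately show ?thesis using norm_triangle_ineq[of "T f a - T f b" "T h a - T h b"] by simp
    qed
    then show "\<exists>\<delta>>0. \<forall>a b. good \<delta> a \<longrightarrow> good \<delta> b \<longrightarrow>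
        cmod (T (\<lambda>x. f x + h x) a - T (\<lambda>x. f x + h x) b) < e"
      using d(1) d'(1) by (intro exI[of _ "min d d'"]) auto
  qed
  have Q_scale: "Q (\<lambda>x. c * f x)" if Q: "Q f" and f: "f \<in> UCB" for f c
    unfolding Q_def
  proof (intro allI impI)
    fix e :: real assume e: "e > 0"
    have pos: "e / (cmod c + 1) > 0" using e by (simp add: add_nonneg_pos)
    obtain d where d: "d > 0" "\<And>a b. good d a \<Longrightarrow> good d b \<Longrightarrow> cmod (T f a - T f b) < e / (cmod c + 1)"
      using Q pos unfolding Q_def by metis
    have "cmod (T (\<lambda>x. c * f x) a - T (\<lambda>x. c * f x) b) < e" if ab: "good d a" "good d b" for a b
    proof -
      have "cmod (T (\<lambda>x. c * f x) a - T (\<lambda>x. c * f x) b) = cmod c * cmod (T f a - T f b)"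
        using T_scale[OF f] ab by (simp add: good_def right_diff_distrib[symmetric] Real_Vector_Spaces.norm_mult)
      also have "\<dots> \<le> cmod c * (e / (cmod c + 1))" using d(2)[OF ab] by (intro mult_left_mono) auto
      also have "\<dots> < e" using e by (simp add: pos_divide_less_eq add_pos_nonneg algebra_simps)
      finally show ?thesis .
    qed
    then show "\<exists>\<delta>>0. \<forall>a b. good \<delta> a \<longrightarrow> good \<delta> b \<longrightarrow> cmod (T (\<lambda>x. c * f x) a - T (\<lambda>x. c * f x) b) < e"
      using d(1) by blast
  qed
  have Q_unit: "Q f" if f: "f \<in> UCB" and unit: "\<And>x. Im (f x) = 0" "\<And>x. 0 \<le> Re (f x)" "\<And>x. Re (f x) \<le> 1" for f
    unfolding Q_def
  proof (intro allI impI)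
    fix e :: real assume e: "e > 0"
    \<comment> \<open>The estimates below give \<open>(Re z)\<^sup>2 <= \<delta>\<close> and
      \<open>(Im z)\<^sup>2 <= 4 * \<delta>\<close>; their sum is less than
      \<open>6 * \<delta>\<close>, hence less than \<open>e\<^sup>2\<close>. The bound 1/2 keeps
      \<open>1 - 2 * \<delta>\<close> nonnegative, so that it may be squared.\<close>
    define \<delta> where "\<delta> = min (1/2) (e\<^sup>2 / 6)"
    have \<delta>: "0 < \<delta>" "\<delta> \<le> 1/2" "6 * \<delta> \<le> e\<^sup>2" using e by (auto simp: \<delta>_def)
    have f': "(\<lambda>x. 1 + (-1) * f x) \<in> UCB" using f by (intro UCB_add UCB_const UCB_mult_const)
    have conv: "cmod (\<psi> b + (T f a - T f b)) \<le> 1" if ab: "good \<delta> a" "good \<delta> b" for a b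
    proof -
      have "T (\<lambda>x. 1 + (-1) * f x) b = \<psi> b - T f b"
        using T_add[OF UCB_const UCB_mult_const[OF f], of b 1 "-1"] T_scale[OF f, of b "-1"] T_1 ab
        by (simp add: good_def)
      moreover have "cmod (f x) + cmod (1 + (-1) * f x) \<le> 1" for x
        using unit[of x] by (simp add: cmod_def)
      ultimately have "cmod (T f a + (\<psi> b - T f b)) \<le> 1"
        using T_bound2[OF f f', of a b 1] ab unfolding good_def by metis
      then show ?thesis by (simp add: algebra_simps)
    qed
    have "cmod (T f a - T f b) < e" if ab: "good \<delta> a" "good \<delta> b" for a b
    proof -
      define z where "z = T f a - T f b"
      \<comment> \<open>The second inequality is the first with \<open>a\<close> and
        \<open>b\<close> exchanged, which changes the sign of \<open>z\<close>. As
        \<open>\<psi> a\<close> and \<open>\<psi> b\<close> lie within \<open>\<delta>\<close> of 1,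
        the two bound \<open>Re z\<close> from above and below, and the first leaves little room for
        \<open>Im z\<close>.\<close>
      have *: "(Re (\<psi> b) + Re z)\<^sup>2 + (Im z)\<^sup>2 \<le> 1" "(Re (\<psi> a) - Re z)\<^sup>2 + (Im z)\<^sup>2 \<le> 1"
        using conv[OF ab] conv[OF ab(2,1)] ab
        by (simp_all add: z_def cmod_def good_def algebra_simps power2_commute)
      have ra: "1 - \<delta> \<le> Re (\<psi> a)" "1 - \<delta> \<le> Re (\<psi> b)" using ab by (auto simp: good_def)
      have "\<bar>Re (\<psi> b) + Re z\<bar> \<le> 1" "\<bar>Re (\<psi> a) - Re z\<bar> \<le> 1"
        using * by (auto simp: abs_square_le_1[symmetric] intro: order_trans[rotated])
      then have Rez: "\<bar>Re z\<bar> \<le> \<delta>" using ra by linarith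
      have "(1 - 2 * \<delta>)\<^sup>2 \<le> (Re (\<psi> b) + Re z)\<^sup>2"
        using Rez ra \<delta> by (intro power_mono) linarith+
      then have "(Im z)\<^sup>2 \<le> 4 * \<delta>" using *(1) by (simp add: power2_eq_square algebra_simps) (smt (verit) \<delta>(1) zero_le_mult_iff)
      moreover have "(Re z)\<^sup>2 \<le> \<delta>\<^sup>2" using Rez by (metis abs_ge_zero power2_abs power_mono)
      moreover have "\<delta>\<^sup>2 \<le> \<delta>" using \<delta> by (simp add: power2_eq_square mult_left_le)
      ultimately have "(cmod z)\<^sup>2 < e\<^sup>2" using \<delta> by (simp add: cmod_power2)
      then show ?thesis using e by (simp add: z_def power_less_imp_less_base)
    qed
    then show "\<exists>\<delta>>0. \<forall>a b. good \<delta> a \<longrightarrow> good \<delta> b \<longrightarrow> cmod (T f a - T f b) < e"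
      using \<delta>(1) by blast
  qed
  have Q_const: "Q (\<lambda>x. c)" for c using Q_scale[OF Q_1, of c] by simp
  have Q_real: "Q f" if f: "f \<in> UCB" and re: "\<And>x. Im (f x) = 0" for f
  proof -
    obtain K0 where K0: "\<And>x. cmod (f x) \<le> K0" using UCB_bounded[OF f] by blast
    define K where "K = \<bar>K0\<bar> + 1"
    have K: "K > 0" "\<bar>Re (f x)\<bar> \<le> K" for x
      using K0[of x] abs_Re_le_cmod[of "f x"] by (auto simp: K_def)
    \<comment> \<open>The affine map that carries the interval from \<open>- K\<close> to
      \<open>K\<close> onto the unit interval.\<close>
    define p where "p = (\<lambda>x. of_real (1 / (2 * K)) * f x + 1/2)"
    have p: "p \<in> UCB" unfolding p_def by (intro UCB_add UCB_mult_const f UCB_const)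
    have Rep: "Re (p x) = (Re (f x) + K) / (2 * K)" for x
      using K(1) by (simp add: p_def add_divide_distrib)
    have "Q p"
    proof (rule Q_unit[OF p])
      fix x show "Im (p x) = 0" using re[of x] by (simp add: p_def)
      show "0 \<le> Re (p x)" "Re (p x) \<le> 1"
        using K(1) K(2)[of x] unfolding Rep by (simp_all add: divide_le_eq)
    qed
    then have "Q (\<lambda>x. of_real (2 * K) * p x + of_real (- K))"
      by (intro Q_add Q_scale Q_const UCB_mult_const UCB_const p)
    moreover have "(\<lambda>x. of_real (2 * K) * p x + of_real (- K)) = f"
      using K(1) by (auto simp: p_def fun_eq_iff field_simps)
    ultimately show ?thesis by simp
  qed
  have Q: "Q f" if f: "f \<in> UCB" for f
  proof -
    have "Q (\<lambda>x. of_real (Re (f x)) + \<i> * of_real (Im (f x)))"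
      using f by (intro Q_add Q_scale Q_real UCB_mult_const UCB_Re UCB_Im) auto
    then show ?thesis by (simp add: complex_eq[symmetric])
  qed

  define X where "X = (\<lambda>n::nat. SOME a. good (inverse (real (Suc n))) a)"
  have X: "good (inverse (real (Suc n))) (X n)" for n
    unfolding X_def by (rule someI_ex, rule good_ex) simp
  have Xc: "X n \<in> carrier A" "cnorm A (X n) \<le> 1" for n using X[of n] by (auto simp: good_def)
  have X_ev: "\<exists>N. \<forall>n\<ge>N. good \<delta> (X n)" if pos: "\<delta> > 0" for \<delta>
  proof -
    obtain N where N: "inverse (real (Suc N)) < \<delta>" using reals_Archimedean[OF pos] by blast
    have "good \<delta> (X n)" if "n \<ge> N" for n
    proof (rule good_mono[OF X])
      have "inverse (real (Suc n)) \<le> inverse (real (Suc N))" using that by (intro le_imp_inverse_le) auto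
      then show "inverse (real (Suc n)) \<le> \<delta>" using N by linarith
    qed
    then show ?thesis by blast
  qed
  define m where "m = (\<lambda>f. lim (\<lambda>n. T f (X n)))"
  have m: "(\<lambda>n. T f (X n)) \<longlonglongrightarrow> m f" if f: "f \<in> UCB" for f
  proof -
    have "Cauchy (\<lambda>n. T f (X n))"
    proof (rule CauchyI)
      fix e :: real assume "e > 0"
      then obtain \<delta> where \<delta>: "\<delta> > 0" "\<And>a b. good \<delta> a \<Longrightarrow> good \<delta> b \<Longrightarrow> cmod (T f a - T f b) < e"
        using Q[OF f] unfolding Q_def by metis
      then show "\<exists>M. \<forall>m\<ge>M. \<forall>n\<ge>M. norm (T f (X m) - T f (X n)) < e"
        using X_ev[OF \<delta>(1)] by blast
    qed
    then show ?thesis unfolding m_def using Cauchy_convergent_iff convergent_LIMSEQ_iff by blast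
  qed
  show ?thesis
  proof (rule amenableI[of m])
    fix f h :: "'g \<Rightarrow> complex" assume fh: "f \<in> UCB" "h \<in> UCB"
    show "m (\<lambda>x. f x + h x) = m f + m h"
      using LIMSEQ_unique[OF m[OF UCB_add[OF fh]]] tendsto_add[OF m[OF fh(1)] m[OF fh(2)]]
      by (simp add: T_add fh Xc)
  next
    fix c and f :: "'g \<Rightarrow> complex" assume f: "f \<in> UCB"
    show "m (\<lambda>x. c * f x) = c * m f"
      using LIMSEQ_unique[OF m[OF UCB_mult_const[OF f]]] tendsto_mult_left[OF m[OF f], of c]
      by (simp add: T_scale f Xc)
  next
    fix f :: "'g \<Rightarrow> complex" and K assume f: "f \<in> UCB" "\<And>x. cmod (f x) \<le> K"
    then have "cmod (T f (X n)) \<le> K" for n using T_bound Xc by blast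
    then show "cmod (m f) \<le> K"
      by (intro LIMSEQ_le_const2[OF tendsto_norm[OF m[OF f(1)]]]) auto
  next
    have "(\<lambda>n. T (\<lambda>x. 1) (X n)) \<longlonglongrightarrow> 1"
    proof (rule LIMSEQ_I)
      fix e :: real assume e: "e > 0"
      then obtain N where N: "\<And>n. n \<ge> N \<Longrightarrow> good (e/2) (X n)" using X_ev[of "e/2"] by auto
      have "norm (T (\<lambda>x. 1) (X n) - 1) < e" if "n \<ge> N" for n
      proof -
        have "\<psi> (X n) - 1 = of_real (Re (\<psi> (X n)) - 1)"
          using N[OF that] by (simp add: good_def complex_eq_iff)
        then have "cmod (\<psi> (X n) - 1) = \<bar>Re (\<psi> (X n)) - 1\<bar>" by (metis norm_of_real)
        then show ?thesis using N[OF that] good_le_1[OF N[OF that]] e T_1[OF Xc(1)] by (simp add: good_def)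
      qed
      then show "\<exists>N. \<forall>n\<ge>N. norm (T (\<lambda>x. 1) (X n) - 1) < e" by blast
    qed
    then show "m (\<lambda>x. 1) = 1" using LIMSEQ_unique m[OF UCB_const] by blast
  next
    fix g :: 'g and f :: "'g \<Rightarrow> complex" assume f: "f \<in> UCB"
    \<comment> \<open>Translating \<open>f\<close> by \<open>g\<close> amounts to moving the good
      element \<open>X n\<close> by \<open>- g\<close>. The result is equally good, so the limit
      does not change.\<close>
    have eq: "T (\<lambda>x. f (- g + x)) (X n) = T f (\<alpha> (- g) (X n))" for n
      using T_translate[OF f, of "\<alpha> (- g) (X n)" g] act_add[OF Xc(1), of g "- g" n] Xc by simp
    have "(\<lambda>n. T f (\<alpha> (- g) (X n)) - T f (X n)) \<longlonglongrightarrow> 0"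
    proof (rule LIMSEQ_I)
      fix e :: real assume "e > 0"
      then obtain \<delta> where \<delta>: "\<delta> > 0" "\<And>a b. good \<delta> a \<Longrightarrow> good \<delta> b \<Longrightarrow> cmod (T f a - T f b) < e"
        using Q[OF f] unfolding Q_def by metis
      then show "\<exists>N. \<forall>n\<ge>N. norm (T f (\<alpha> (- g) (X n)) - T f (X n) - 0) < e"
        using X_ev[OF \<delta>(1)] good_act by (metis diff_zero)
    qed
    then have "m (\<lambda>x. f (- g + x)) - m f = 0"
      using LIMSEQ_unique tendsto_diff[OF m[OF UCB_translate[OF f, of g]] m[OF f]] unfolding eq by blast
    then show "m (\<lambda>x. f (- g + x)) = m f" by simp
  qed
qed

end

text \<open>Stated for a nonzero bounded invariant functional, so that it covers invariant states
  and the trivial character of the group algebra alike.\<close>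

lemma amenable_of_G_QWEP:
  fixes A :: "'a cstar_alg" and \<alpha> :: "'g::topological_group_add \<Rightarrow> 'a \<Rightarrow> 'a"
  assumes A: "cstar_algebra A" and \<phi>: "\<phi> \<in> cdual A"
    and inv: "\<And>g a. a \<in> carrier A \<Longrightarrow> \<phi> (\<alpha> g a) = \<phi> a"
    and x0: "x0 \<in> carrier A" "\<phi> x0 \<noteq> 0"
    and qwep: "G_QWEP TYPE('d) A \<alpha>"
  shows "amenable TYPE('g)"
proof -
  obtain D :: "'d cstar_alg" and \<delta> q where wep: "G_WEP D \<delta>" and q: "star_hom D A q"
    and eqv: "equivariant D \<delta> \<alpha> q" and surj: "q ` carrier D = carrier A"
    using qwep unfolding G_QWEP_def by blast
  have GD: "G_cstar_algebra D \<delta>" using wep by (simp add: G_WEP_def)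
  interpret D: G_cstar D \<delta> by unfold_locales (use GD in \<open>auto simp: G_cstar_algebra_def\<close>)
  interpret q: cstar_hom D A q by unfold_locales (use A q in auto)
  obtain K where K: "\<And>x. x \<in> carrier A \<Longrightarrow> cmod (\<phi> x) \<le> K * cnorm A x" using cdualD(3)[OF \<phi>] by blast
  define \<psi>0 where "\<psi>0 = (\<lambda>x. if x \<in> carrier D then \<phi> (q x) else 0)"
  have b0: "cmod (\<psi>0 x) \<le> \<bar>K\<bar> * cnorm D x" if x: "x \<in> carrier D" for x
  proof -
    have "K * cnorm A (q x) \<le> \<bar>K\<bar> * cnorm D x"
      using x q.hom_contractive[OF x] by (intro mult_mono) auto
    then show ?thesis using K[of "q x"] x by (simp add: \<psi>0_def)
  qed
  have \<psi>0: "\<psi>0 \<in> cdual D"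
    using b0 unfolding cdual_def
    by (auto simp: \<psi>0_def q.hom_add q.hom_smult cdualD(1,2)[OF \<phi>])
  define N where "N = dual_norm D \<psi>0"
  \<comment> \<open>Surjectivity of \<open>q\<close> keeps the pulled-back functional nonzero, which
    permits dividing by its norm \<open>N\<close>.\<close>
  obtain y0 where y0: "y0 \<in> carrier D" "q y0 = x0"
    using x0(1) unfolding surj[symmetric] by (elim imageE) metis
  have N: "N > 0"
  proof (rule ccontr)
    assume "\<not> N > 0"
    then have "N = 0" using D.dual_norm_nonneg[OF \<psi>0] by (simp add: N_def)
    then show False using D.norm_le_dual_norm[OF \<psi>0 y0(1)] x0 y0 by (simp add: N_def \<psi>0_def)
  qed
  define \<psi> where "\<psi> = (\<lambda>x. of_real (1 / N) * \<psi>0 x)"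
  obtain E where E: "completely_positive (ucb_algebra D) (bidual D) E"
    "contraction (ucb_algebra D) (bidual D) E"
    "equivariant (ucb_algebra D) translate (bidual_action D \<delta>) E"
    "\<And>a. a \<in> carrier D \<Longrightarrow> E (D.tensor (\<lambda>x. 1) a) = bidual_emb D a"
    using conjunct2[OF wep[unfolded G_WEP_def], rule_format, OF conjI[OF D.G_cstar_algebra_ucb_algebra
        conjI[OF D.star_hom_tensor_1 conjI[OF D.inj_tensor_1 D.equivariant_tensor_1]]]]
    by blast
  show ?thesis
  proof (rule D.amenable_of_equivariant_contraction[where \<psi> = \<psi> and E = E])
    show "\<psi> \<in> cdual D"
      unfolding \<psi>_def by (rule cdual_scale[OF \<psi>0])
    show "\<psi> (\<delta> g a) = \<psi> a" if "a \<in> carrier D" for g a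
      using eqv inv that by (simp add: \<psi>_def \<psi>0_def equivariant_def)
    show "cmod (\<psi> a) \<le> cnorm D a" if "a \<in> carrier D" for a
      using D.norm_le_dual_norm[OF \<psi>0 that] N
      by (simp add: \<psi>_def norm_mult norm_divide divide_le_eq N_def[symmetric] mult.commute)
    show "\<exists>a\<in>carrier D. cnorm D a \<le> 1 \<and> 1 - e \<le> cmod (\<psi> a)" if e: "e > 0" for e
    proof (rule ccontr)
      assume neg: "\<not> ?thesis"
      have "N \<le> (1 - e) * N"
        unfolding N_def
      proof (rule D.dual_norm_le)
        fix a assume "a \<in> carrier D" "cnorm D a \<le> 1"
        then have "cmod (\<psi> a) < 1 - e" using neg by force
        then show "cmod (\<psi>0 a) \<le> (1 - e) * dual_norm D \<psi>0"
          using N by (simp add: \<psi>_def norm_mult norm_divide divide_less_eq N_def[symmetric])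
      qed
      then show False using N e mult_pos_pos[OF N e] by (simp add: algebra_simps)
    qed
  qed (use E in \<open>auto simp: completely_positive_def\<close>)
qed

section \<open>Haar integration\<close>

locale haar =
  fixes \<mu> :: "'g::{topological_group_add, t2_space} measure"
  assumes haar: "left_haar_measure \<mu>"
begin

lemma sets_haar [simp, measurable_cong]: "sets \<mu> = sets borel"
  using haar by (simp add: left_haar_measure_def)

lemma space_haar [simp]: "space \<mu> = UNIV"
  using sets_eq_imp_space_eq[OF sets_haar] by simp

lemma borel_measurable_haar [simp]: "borel_measurable \<mu> = borel_measurable borel"
  by (rule measurable_cong_sets) simp_all

lemma compact_finite: "compact K \<Longrightarrow> emeasure \<mu> K < \<infinity>"
  using haar by (simp add: left_haar_measure_def)

lemma compact_borel [simp]: "compact (K :: 'g set) \<Longrightarrow> K \<in> sets borel"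
  by (simp add: borel_closed compact_imp_closed)

lemma subset_finite:
  assumes "compact K" "A \<subseteq> K"
  shows "emeasure \<mu> A < \<infinity>"
proof -
  have "emeasure \<mu> A \<le> emeasure \<mu> K" using assms by (intro emeasure_mono) auto
  then show ?thesis using compact_finite[OF assms(1)] by (rule le_less_trans)
qed

lemma integrable_indicator_bounded:
  fixes f :: "'g \<Rightarrow> complex"
  assumes f: "f \<in> borel_measurable borel" and A: "A \<in> sets borel" "emeasure \<mu> A < \<infinity>"
    and B: "\<And>x. x \<in> A \<Longrightarrow> cmod (f x) \<le> B"
  shows "integrable \<mu> (\<lambda>x. indicator A x *\<^sub>R f x)"
  by (rule integrableI_bounded_set_indicator[where B = B]) (use assms in auto)

lemma continuous_bounded_on_compact:
  fixes f :: "'g \<Rightarrow> complex"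
  assumes "continuous_on UNIV f" "compact K"
  obtains B where "B \<ge> 0" "\<And>x. x \<in> K \<Longrightarrow> cmod (f x) \<le> B"
proof -
  have "bounded (f ` K)"
    using assms by (intro compact_imp_bounded compact_continuous_image continuous_on_subset[OF assms(1)]) auto
  then show ?thesis using that by (metis bounded_pos image_eqI less_imp_le)
qed

lemma integrable_compact_support:
  fixes f :: "'g \<Rightarrow> complex"
  assumes f: "continuous_on UNIV f" and K: "compact K" and supp: "\<And>x. x \<notin> K \<Longrightarrow> f x = 0"
  shows "integrable \<mu> f"
proof -
  obtain B where "\<And>x. x \<in> K \<Longrightarrow> cmod (f x) \<le> B" using continuous_bounded_on_compact[OF f K] by blast
  then have "integrable \<mu> (\<lambda>x. indicator K x *\<^sub>R f x)"
    using K compact_finite[OF K] borel_measurable_continuous_onI[OF f]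
    by (intro integrable_indicator_bounded) auto
  also have "(\<lambda>x. indicator K x *\<^sub>R f x) = f"
    using supp by (auto simp: indicator_def)
  finally show ?thesis .
qed

lemma norm_integral_le:
  fixes f :: "'g \<Rightarrow> complex"
  assumes A: "A \<in> sets borel" "emeasure \<mu> A < \<infinity>"
    and le: "\<And>x. cmod (f x) \<le> B * indicator A x"
  shows "cmod (LINT x|\<mu>. f x) \<le> B * measure \<mu> A"
proof -
  have iA: "integrable \<mu> (indicator A :: 'g \<Rightarrow> real)"
    by (rule integrable_real_indicator) (use A in auto)
  have int: "integrable \<mu> (\<lambda>x. B * indicator A x)"
    by (rule integrable_mult_right[OF iA])
  have "cmod (LINT x|\<mu>. f x) \<le> (LINT x|\<mu>. cmod (f x))" by (rule integral_norm_bound)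
  also have "\<dots> \<le> (LINT x|\<mu>. B * indicator A x)"
    by (rule integral_mono'[OF int le order_trans[OF norm_ge_zero le]])
  also have "\<dots> = B * measure \<mu> A" by simp
  finally show ?thesis .
qed

text \<open>Fubini's theorem from the product measure is not at hand: \<open>\<mu>\<close> need not be
  \<open>\<sigma>\<close>-finite, and the Borel sets of \<open>G \<times> G\<close> need not be generated by rectangles.\<close>

context
  fixes F :: "'g \<Rightarrow> 'g \<Rightarrow> complex" and K L :: "'g set"
  assumes cont: "continuous_on UNIV (\<lambda>(s, t). F s t)"
    and K: "compact K" and L: "compact L"
    and supp: "\<And>s t. s \<notin> K \<or> t \<notin> L \<Longrightarrow> F s t = 0"
begin

text \<open>Compactness of \<open>L\<close> makes continuity in \<open>s\<close> uniform in
  \<open>t\<close>: the tube lemma handles \<open>t\<close> in \<open>L\<close>, and for other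
  \<open>t\<close> both values are 0.\<close>

lemma tube:
  assumes e: "e > 0"
  shows "\<exists>V. open V \<and> s0 \<in> V \<and> (\<forall>s\<in>V. \<forall>t. cmod (F s t - F s0 t) < e)"
proof -
  let ?h = "\<lambda>(s, t). cmod (F s t - F s0 t)"
  have 1: "continuous_on UNIV (\<lambda>p. F (fst p) (snd p))" using cont by (simp add: case_prod_unfold)
  have "continuous_on UNIV (\<lambda>p :: 'g \<times> 'g. (s0, snd p))" by (intro continuous_intros)
  from continuous_on_compose2[OF 1 this]
  have 2: "continuous_on UNIV (\<lambda>p :: 'g \<times> 'g. F s0 (snd p))" by simp
  have "continuous_on UNIV ?h"
    unfolding case_prod_unfold by (intro continuous_on_norm continuous_on_diff 1 2)
  then have op: "open (?h -` {..<e})" by (intro open_vimage) auto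
  have "{s0} \<times> L \<subseteq> ?h -` {..<e}" using e by auto
  from Elementary_Topology.tube_lemma[OF L op this]
  obtain V where V: "s0 \<in> V" "open V" "V \<times> L \<subseteq> ?h -` {..<e}" by blast
  have "cmod (F s t - F s0 t) < e" if "s \<in> V" for s t
    using V(3) that supp e by (cases "t \<in> L") auto
  then show ?thesis using V by blast
qed

lemma continuous_section: "continuous_on UNIV (\<lambda>t. F s t)"
proof -
  have "continuous_on UNIV (\<lambda>t. (s, t))" by (intro continuous_intros)
  from continuous_on_compose2[OF cont this] show ?thesis by simp
qed

lemma integrable_section: "integrable \<mu> (\<lambda>t. F s t)"
  using integrable_compact_support[OF continuous_section L] supp by simp

lemma integral_section_outside: "s \<notin> K \<Longrightarrow> (LINT t|\<mu>. F s t) = 0"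
proof -
  assume "s \<notin> K"
  then have "F s = (\<lambda>_. 0)" using supp by auto
  then show ?thesis by simp
qed

lemma continuous_on_integral_section: "continuous_on UNIV (\<lambda>s. LINT t|\<mu>. F s t)"
  unfolding continuous_on_def
proof (intro ballI tendstoI)
  fix s0 :: 'g and e :: real assume e: "e > 0"
  \<comment> \<open>Adding 1 allows for \<open>measure \<mu> L = 0\<close> and makes the final
    estimate strict.\<close>
  define d where "d = e / (measure \<mu> L + 1)"
  have m: "measure \<mu> L + 1 > 0" using measure_nonneg[of \<mu> L] by linarith
  have d: "d > 0" unfolding d_def by (rule divide_pos_pos[OF e m])
  obtain V where V: "open V" "s0 \<in> V" "\<And>s t. s \<in> V \<Longrightarrow> cmod (F s t - F s0 t) < d"
    using tube[OF d, of s0] by auto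
  have "dist (LINT t|\<mu>. F s t) (LINT t|\<mu>. F s0 t) < e" if s: "s \<in> V" for s
  proof -
    have "cmod (LINT t|\<mu>. F s t - F s0 t) \<le> d * measure \<mu> L"
      using V(3)[OF s, THEN less_imp_le] supp L compact_finite[OF L]
      by (intro norm_integral_le) (auto simp: indicator_def)
    also have "\<dots> < e"
      using d e m by (simp add: d_def field_simps)
    finally show ?thesis using integrable_section by (simp add: dist_norm)
  qed
  then show "\<forall>\<^sub>F s in at s0 within UNIV. dist (LINT t|\<mu>. F s t) (LINT t|\<mu>. F s0 t) < e"
    using V(1,2) unfolding eventually_at_topological by blast
qed

end

lemma continuous_swap:
  fixes F :: "'g \<Rightarrow> 'g \<Rightarrow> complex"
  assumes "continuous_on UNIV (\<lambda>(s, t). F s t)"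
  shows "continuous_on UNIV (\<lambda>(t, s). F s t)"
proof -
  have "continuous_on UNIV (\<lambda>p. (\<lambda>(s, t). F s t) (prod.swap p))"
    by (rule continuous_on_compose2[OF assms]) (auto intro: continuous_on_swap)
  then show ?thesis by (simp add: case_prod_unfold)
qed

text \<open>Restrict both iterated integrals to \<open>s\<close> in a Borel set \<open>A\<close>;
  each is additive in \<open>A\<close>. If \<open>F s\<close> stays within \<open>e\<close> of
  \<open>F p\<close> on \<open>A\<close>, both are close to the measure of \<open>A\<close> times
  the integral of \<open>F p\<close>, so they differ by at most
  \<open>2 * e * measure \<mu> L * measure \<mu> A\<close>. Finitely many such sets cover
  \<open>K\<close>; cut into disjoint pieces, they bound the difference on \<open>K\<close> by a
  fixed multiple of \<open>e\<close>.\<close>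

lemma Fubini_Cc:
  fixes F :: "'g \<Rightarrow> 'g \<Rightarrow> complex"
  assumes cont: "continuous_on UNIV (\<lambda>(s, t). F s t)"
    and K: "compact K" and L: "compact L"
    and supp: "\<And>s t. s \<notin> K \<or> t \<notin> L \<Longrightarrow> F s t = 0"
  shows "(LINT s|\<mu>. LINT t|\<mu>. F s t) = (LINT t|\<mu>. LINT s|\<mu>. F s t)"
proof -
  note ci = continuous_on_integral_section[OF cont K L supp]
  note isec = integrable_section[OF cont K L supp]
  have supp': "\<And>t s. t \<notin> L \<or> s \<notin> K \<Longrightarrow> F s t = 0" using supp by blast
  note cont' = continuous_swap[OF cont]
  note isec' = integrable_section[OF cont' L K supp']
  have fin: "emeasure \<mu> A < \<infinity>" if "A \<subseteq> K" for A by (rule subset_finite[OF K that])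
  have iA: "integrable \<mu> (\<lambda>s. indicator A s *\<^sub>R F s t)" if "A \<in> sets borel" for A t
    using integrable_mult_indicator[OF _ isec'] that by simp
  have iA1: "integrable \<mu> (\<lambda>s. indicator A s *\<^sub>R (LINT t|\<mu>. F s t))" if "A \<in> sets borel" for A
  proof -
    have "integrable \<mu> (\<lambda>s. LINT t|\<mu>. F s t)"
        using integral_section_outside[OF cont K L supp] by (intro integrable_compact_support[OF ci K]) blast
    then show ?thesis using that by (intro integrable_mult_indicator) auto
  qed
  \<comment> \<open>The indicator of a Borel set is discontinuous in \<open>s\<close>, so
    \<open>continuous_on_integral_section\<close> does not apply. Its argument is repeated with the
    tube lemma in the variable \<open>t\<close>, where the integrand is still continuous.\<close>
  have cA: "continuous_on UNIV (\<lambda>t. LINT s|\<mu>. indicator A s *\<^sub>R F s t)"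
    if A: "A \<in> sets borel" "A \<subseteq> K" for A
    unfolding continuous_on_def
  proof (intro ballI tendstoI)
    fix t0 :: 'g and e :: real assume e: "e > 0"
    define d where "d = e / (measure \<mu> A + 1)"
    have m: "measure \<mu> A + 1 > 0" using measure_nonneg[of \<mu> A] by linarith
    have d: "d > 0" unfolding d_def by (rule divide_pos_pos[OF e m])
    obtain V where V: "open V" "t0 \<in> V" "\<And>t s. t \<in> V \<Longrightarrow> cmod (F s t - F s t0) < d"
      using tube[OF cont' L K supp' d, of t0] by auto
    have "dist (LINT s|\<mu>. indicator A s *\<^sub>R F s t) (LINT s|\<mu>. indicator A s *\<^sub>R F s t0) < e"
      if t: "t \<in> V" for t
    proof -
      have "cmod (LINT s|\<mu>. indicator A s *\<^sub>R F s t - indicator A s *\<^sub>R F s t0) \<le> d * measure \<mu> A"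
        using V(3)[OF t, THEN less_imp_le] A fin[OF A(2)]
        by (intro norm_integral_le) (auto simp: indicator_def)
      also have "\<dots> < e"
        using d e m by (simp add: d_def field_simps)
      finally show ?thesis using iA[OF A(1)] by (simp add: dist_norm)
    qed
    then show "\<forall>\<^sub>F t in at t0 within UNIV. dist (LINT s|\<mu>. indicator A s *\<^sub>R F s t)
        (LINT s|\<mu>. indicator A s *\<^sub>R F s t0) < e"
      using V(1,2) unfolding eventually_at_topological by blast
  qed
  have iA2: "integrable \<mu> (\<lambda>t. LINT s|\<mu>. indicator A s *\<^sub>R F s t)"
    if A: "A \<in> sets borel" "A \<subseteq> K" for A
    by (rule integrable_compact_support[OF cA[OF A] L]) (simp add: supp)
  define I1 where "I1 = (\<lambda>A. LINT s|\<mu>. indicator A s *\<^sub>R (LINT t|\<mu>. F s t))"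
  define I2 where "I2 = (\<lambda>A. LINT t|\<mu>. LINT s|\<mu>. indicator A s *\<^sub>R F s t)"
  have ind: "indicator (A \<union> B) s = (indicator A s + indicator B s :: real)" if "A \<inter> B = {}" for A B and s :: 'g
    using that by (auto simp: indicator_def)
  have I1_Un: "I1 (A \<union> B) = I1 A + I1 B"
    if "A \<in> sets borel" "B \<in> sets borel" "A \<inter> B = {}" for A B
    using that iA1 by (simp add: I1_def ind scaleR_add_left)
  have I2_Un: "I2 (A \<union> B) = I2 A + I2 B"
    if "A \<in> sets borel" "B \<in> sets borel" "A \<inter> B = {}" "A \<subseteq> K" "B \<subseteq> K" for A B
    using that iA iA2 by (simp add: I2_def ind scaleR_add_left)
  have loc: "cmod (I1 A - I2 A) \<le> 2 * e * measure \<mu> L * measure \<mu> A"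
    if A: "A \<in> sets borel" "A \<subseteq> K" and e: "\<And>s t. s \<in> A \<Longrightarrow> cmod (F s t - F p t) \<le> e" and e0: "e > 0" for A p e
  proof -
    \<comment> \<open>\<open>m *\<^sub>R c\<close> is the common value that both integrals would
      have if \<open>F s\<close> were equal to \<open>F p\<close> throughout
      \<open>A\<close>.\<close>
    define c where "c = (LINT t|\<mu>. F p t)"
    define m where "m = measure \<mu> A"
    have mA: "(LINT s|\<mu>. indicator A s *\<^sub>R z) = m *\<^sub>R z" for z :: complex
      using A fin[OF A(2)] by (simp add: m_def)
    have iz: "integrable \<mu> (\<lambda>s. indicator A s *\<^sub>R z)" for z :: complex
      using A fin[OF A(2)] by (intro integrable_indicator_bounded[where B = "cmod z"]) auto
    have "I1 A - m *\<^sub>R c = (LINT s|\<mu>. indicator A s *\<^sub>R (LINT t|\<mu>. F s t) - indicator A s *\<^sub>R c)"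
      using iA1[OF A(1)] iz by (simp add: I1_def mA)
    also have "cmod \<dots> \<le> (e * measure \<mu> L) * measure \<mu> A"
    proof (rule norm_integral_le)
      fix s
      have "cmod ((LINT t|\<mu>. F s t) - c) \<le> e * measure \<mu> L" if s: "s \<in> A"
      proof -
        have "cmod (LINT t|\<mu>. F s t - F p t) \<le> e * measure \<mu> L"
          using e[OF s] e0 supp L compact_finite[OF L]
          by (intro norm_integral_le) (auto simp: indicator_def)
        then show ?thesis using isec by (simp add: c_def)
      qed
      then show "cmod (indicator A s *\<^sub>R (LINT t|\<mu>. F s t) - indicator A s *\<^sub>R c) \<le> e * measure \<mu> L * indicator A s"
        by (auto simp: indicator_def)
    qed (use A fin in auto)
    finally have 1: "cmod (I1 A - m *\<^sub>R c) \<le> e * measure \<mu> L * measure \<mu> A" .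
    have "I2 A - m *\<^sub>R c = (LINT t|\<mu>. (LINT s|\<mu>. indicator A s *\<^sub>R F s t) - m *\<^sub>R F p t)"
      using iA2[OF A] isec by (simp add: I2_def c_def)
    also have "cmod \<dots> \<le> (e * measure \<mu> A) * measure \<mu> L"
    proof (rule norm_integral_le)
      fix t
      have "(LINT s|\<mu>. indicator A s *\<^sub>R F s t) - m *\<^sub>R F p t
          = (LINT s|\<mu>. indicator A s *\<^sub>R F s t - indicator A s *\<^sub>R F p t)"
        using iA[OF A(1)] iz by (simp add: mA)
      also have "cmod \<dots> \<le> e * measure \<mu> A"
        using e e0 A fin[OF A(2)] by (intro norm_integral_le) (auto simp: indicator_def)
      finally show "cmod ((LINT s|\<mu>. indicator A s *\<^sub>R F s t) - m *\<^sub>R F p t) \<le> e * measure \<mu> A * indicator L t"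
        using supp by (cases "t \<in> L") auto
    qed (use L compact_finite in auto)
    finally have 2: "cmod (I2 A - m *\<^sub>R c) \<le> e * measure \<mu> A * measure \<mu> L" .
    have "cmod (I1 A - I2 A) \<le> cmod (I1 A - m *\<^sub>R c) + cmod (I2 A - m *\<^sub>R c)"
      using norm_triangle_ineq4[of "I1 A - m *\<^sub>R c" "I2 A - m *\<^sub>R c"] by simp
    then show ?thesis using 1 2 by (simp add: mult_ac)
  qed
  have le: "cmod (I1 K - I2 K) \<le> e * (2 * measure \<mu> L * measure \<mu> K)" if e: "e > 0" for e
  proof -
    have "\<exists>V. \<forall>s0. open (V s0) \<and> s0 \<in> V s0 \<and> (\<forall>s\<in>V s0. \<forall>t. cmod (F s t - F s0 t) < e)"
      by (intro choice allI tube[OF cont K L supp e])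
    then obtain V where V: "\<And>s. open (V s)" "\<And>s. s \<in> V s"
        "\<And>s0 s t. s \<in> V s0 \<Longrightarrow> cmod (F s t - F s0 t) < e"
      by auto
    have "K \<subseteq> (\<Union>p\<in>UNIV. V p)" using V(2) by auto
    then obtain P where P: "finite P" "K \<subseteq> (\<Union>p\<in>P. V p)"
      using compactE_image[OF K, of UNIV V] V(1) by metis
    have "cmod (I1 A - I2 A) \<le> 2 * e * measure \<mu> L * measure \<mu> A"
      if "finite P" "A \<subseteq> (\<Union>p\<in>P. V p)" "A \<in> sets borel" "A \<subseteq> K" for P A
      using that
    proof (induct P arbitrary: A)
      case empty
      then have "A = {}" by simp
      then show ?case by (simp add: I1_def I2_def)
    next
      case (insert p P)
      \<comment> \<open>Cutting along \<open>V p\<close> makes the pieces disjoint, so their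
        measures, and with them the errors, add up exactly. \<open>V p\<close> controls
        \<open>F\<close> on \<open>B\<close>, and the remaining sets cover \<open>C\<close>.\<close>
      define B where "B = A \<inter> V p"
      define C where "C = A - V p"
      have Vp: "V p \<in> sets borel" using V(1) by simp
      have BC: "B \<in> sets borel" "C \<in> sets borel" "B \<inter> C = {}" "B \<subseteq> K" "C \<subseteq> K" "A = B \<union> C"
        using insert.prems(2,3) Vp by (auto simp: B_def C_def)
      have b: "cmod (I1 B - I2 B) \<le> 2 * e * measure \<mu> L * measure \<mu> B"
        using V(3)[THEN less_imp_le] e by (intro loc[OF BC(1,4), of p]) (auto simp: B_def)
      have c: "cmod (I1 C - I2 C) \<le> 2 * e * measure \<mu> L * measure \<mu> C"
      proof (rule insert.hyps(3))
        show "C \<subseteq> (\<Union>p\<in>P. V p)" using insert.prems(1) by (auto simp: C_def)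
      qed (rule BC)+
      have m: "measure \<mu> A = measure \<mu> B + measure \<mu> C"
        unfolding BC(6) using BC(1-3) fin[OF BC(4)] fin[OF BC(5)]
        by (intro measure_Union) auto
      have "I1 A - I2 A = (I1 B - I2 B) + (I1 C - I2 C)"
        unfolding BC(6) I1_Un[OF BC(1-3)] I2_Un[OF BC(1-5)] by simp
      then have "cmod (I1 A - I2 A) \<le> cmod (I1 B - I2 B) + cmod (I1 C - I2 C)"
        using norm_triangle_ineq[of "I1 B - I2 B" "I1 C - I2 C"] by simp
      then show ?case unfolding m distrib_left using b c by linarith
    qed
    from this[OF P] K show ?thesis by (simp add: mult_ac)
  qed
  have "cmod (I1 K - I2 K) \<le> 0"
  proof (rule field_le_epsilon)
    fix e :: real assume e: "e > 0"
    define c where "c = 2 * measure \<mu> L * measure \<mu> K"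
    have c: "c \<ge> 0" by (simp add: c_def)
    have "cmod (I1 K - I2 K) \<le> e / (c + 1) * c"
      using le[of "e / (c + 1)"] e c by (simp add: c_def[symmetric])
    also have "\<dots> \<le> 0 + e" using e c by (simp add: field_simps)
    finally show "cmod (I1 K - I2 K) \<le> 0 + e" .
  qed
  then have "I1 K = I2 K" by simp
  moreover have "(\<lambda>s. indicator K s *\<^sub>R (LINT t|\<mu>. F s t)) = (\<lambda>s. LINT t|\<mu>. F s t)"
    using integral_section_outside[OF cont K L supp] by (auto simp: indicator_def fun_eq_iff)
  moreover have "indicator K s *\<^sub>R F s t = F s t" for s t
    using supp by (auto simp: indicator_def)
  ultimately show ?thesis by (simp add: I1_def I2_def)
qed

end

section \<open>Continuous functions with compact support\<close>

lemma Cc_cont: "f \<in> Cc \<Longrightarrow> continuous_on UNIV f"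
  by (simp add: Cc_def)

lemma Cc_support:
  assumes "f \<in> Cc" shows "\<exists>K. compact K \<and> (\<forall>x. f x \<noteq> 0 \<longrightarrow> x \<in> K)"
proof (intro exI conjI allI impI)
  show "compact (closure {x. f x \<noteq> 0})" using assms by (simp add: Cc_def)
  show "x \<in> closure {x. f x \<noteq> 0}" if "f x \<noteq> 0" for x
    by (rule subsetD[OF closure_subset]) (use that in simp)
qed

lemma CcI:
  fixes f :: "'a::t2_space \<Rightarrow> complex"
  assumes "continuous_on UNIV f" "compact K" "\<And>x. x \<notin> K \<Longrightarrow> f x = 0"
  shows "f \<in> Cc"
proof -
  have "closure {x. f x \<noteq> 0} \<subseteq> K"
    by (rule closure_minimal) (use assms(3) compact_imp_closed[OF assms(2)] in auto)
  then have "K \<inter> closure {x. f x \<noteq> 0} = closure {x. f x \<noteq> 0}" by blast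
  then have "compact (closure {x. f x \<noteq> 0})"
    using compact_Int_closed[OF assms(2) closed_closure, of "{x. f x \<noteq> 0}"] by simp
  then show ?thesis using assms(1) by (simp add: Cc_def)
qed

lemma Cc_zero: "(\<lambda>_. 0) \<in> Cc"
  by (simp add: Cc_def)

lemma Cc_add:
  fixes f :: "'a::t2_space \<Rightarrow> complex"
  assumes f: "f \<in> Cc" and h: "h \<in> Cc"
  shows "(\<lambda>x. f x + h x) \<in> Cc"
proof -
  obtain K where K: "compact K" "\<And>x. f x \<noteq> 0 \<Longrightarrow> x \<in> K" using Cc_support[OF f] by auto
  obtain L where L: "compact L" "\<And>x. h x \<noteq> 0 \<Longrightarrow> x \<in> L" using Cc_support[OF h] by auto
  show ?thesis
  proof (rule CcI[OF continuous_on_add[OF Cc_cont[OF f] Cc_cont[OF h]] compact_Un[OF K(1) L(1)]])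
    fix x assume "x \<notin> K \<union> L"
    then have "f x = 0" "h x = 0" using K(2)[of x] L(2)[of x] by auto
    then show "f x + h x = 0" by simp
  qed
qed

lemma Cc_comp:
  fixes f :: "'a::t2_space \<Rightarrow> complex"
  assumes f: "f \<in> Cc" and g: "continuous_on UNIV (\<lambda>x. g (f x))" "g 0 = (0 :: complex)"
  shows "(\<lambda>x. g (f x)) \<in> Cc"
proof -
  obtain K where K: "compact K" "\<And>x. f x \<noteq> 0 \<Longrightarrow> x \<in> K" using Cc_support[OF f] by auto
  show ?thesis by (rule CcI[OF g(1) K(1)]) (metis K(2) g(2))
qed

lemma Cc_scale:
  fixes f :: "'a::t2_space \<Rightarrow> complex"
  shows "f \<in> Cc \<Longrightarrow> (\<lambda>x. c * f x) \<in> Cc"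
  by (rule Cc_comp[where g = "\<lambda>z. c * z"]) (simp_all add: continuous_on_mult_left Cc_cont)

lemma Cc_cnj:
  fixes f :: "'a::t2_space \<Rightarrow> complex"
  shows "f \<in> Cc \<Longrightarrow> (\<lambda>x. cnj (f x)) \<in> Cc"
  by (rule Cc_comp[where g = cnj]) (simp_all add: continuous_on_cnj Cc_cont)

lemma Cc_compose:
  "f \<in> Cc \<Longrightarrow> continuous_on UNIV g \<Longrightarrow> continuous_on UNIV (\<lambda>x. f (g x))"
  by (rule continuous_on_compose2[OF Cc_cont _ subset_UNIV])

lemma Cc_translate:
  fixes f :: "'g::{topological_group_add, t2_space} \<Rightarrow> complex"
  assumes f: "f \<in> Cc"
  shows "(\<lambda>x. f (- g + x)) \<in> Cc"
proof -
  obtain K where K: "compact K" "\<And>x. f x \<noteq> 0 \<Longrightarrow> x \<in> K" using Cc_support[OF f] by auto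
  show ?thesis
  proof (rule CcI)
    show "continuous_on UNIV (\<lambda>x. f (- g + x))"
      by (intro Cc_compose[OF f] continuous_intros)
    show "compact ((\<lambda>x. g + x) ` K)"
      by (intro compact_continuous_image continuous_intros K(1))
    fix x assume x: "x \<notin> (\<lambda>x. g + x) ` K"
    have "x = g + (- g + x)" by (simp add: add.assoc[symmetric])
    then have "- g + x \<notin> K" using x by blast
    then show "f (- g + x) = 0" using K(2) by blast
  qed
qed

section \<open>Convolution, involution and the Haar integral\<close>

context haar
begin

lemma Cc_integrable: assumes f: "f \<in> Cc" shows "integrable \<mu> f"
proof -
  obtain K where K: "compact K" "\<And>x. f x \<noteq> 0 \<Longrightarrow> x \<in> K" using Cc_support[OF f] by auto
  show ?thesis by (rule integrable_compact_support[OF Cc_cont[OF f] K(1)]) (use K(2) in blast)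
qed

lemma left_translation:
  fixes f :: "'g \<Rightarrow> complex"
  assumes f: "f \<in> borel_measurable borel"
  shows "(LINT x|\<mu>. f (g + x)) = (LINT x|\<mu>. f x)"
proof -
  have meas: "(\<lambda>x. g + x) \<in> measurable \<mu> borel"
    unfolding borel_measurable_haar by (intro borel_measurable_continuous_onI continuous_intros)
  have "distr \<mu> borel (\<lambda>x. g + x) = \<mu>"
  proof (rule measure_eqI)
    fix S assume "S \<in> sets (distr \<mu> borel (\<lambda>x. g + x))"
    then have S: "S \<in> sets borel" by simp
    have "(\<lambda>x. g + x) -` S = (\<lambda>x. - g + x) ` S"
      by (auto simp: image_iff add.assoc[symmetric] intro!: bexI[of _ "g + _"])
    then show "emeasure (distr \<mu> borel (\<lambda>x. g + x)) S = emeasure \<mu> S"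
      using haar S meas by (simp add: emeasure_distr left_haar_measure_def)
  qed simp
  then show ?thesis using integral_distr[OF meas f] by simp
qed

text \<open>The sign in \<open>\<Delta> (- s)\<close> arises because a push-forward measures
  preimages, and the preimage of \<open>S\<close> under right translation by \<open>s\<close> is its
  right translate by \<open>- s\<close>.\<close>

lemma right_translation:
  fixes f :: "'g \<Rightarrow> complex"
  assumes \<Delta>: "modular_function \<mu> \<Delta>" and f: "f \<in> borel_measurable borel"
  shows "(LINT x|\<mu>. f (x + s)) = \<Delta> (- s) *\<^sub>R (LINT x|\<mu>. f x)"
proof -
  have meas: "(\<lambda>x. x + s) \<in> measurable \<mu> borel"
    unfolding borel_measurable_haar by (intro borel_measurable_continuous_onI continuous_intros)
  have "distr \<mu> borel (\<lambda>x. x + s) = density \<mu> (\<lambda>_. ennreal (\<Delta> (- s)))"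
  proof (rule measure_eqI)
    fix S assume "S \<in> sets (distr \<mu> borel (\<lambda>x. x + s))"
    then have S: "S \<in> sets borel" by simp
    have "(\<lambda>x. x + s) -` S = (\<lambda>x. x + - s) ` S"
      by (auto simp: image_iff add.assoc intro!: bexI[of _ "_ + s"])
    moreover have "emeasure \<mu> ((\<lambda>x. x + - s) ` S) = ennreal (\<Delta> (- s)) * emeasure \<mu> S"
      using \<Delta> S unfolding modular_function_def by blast
    ultimately show "emeasure (distr \<mu> borel (\<lambda>x. x + s)) S = emeasure (density \<mu> (\<lambda>_. ennreal (\<Delta> (- s)))) S"
      using S meas by (simp add: emeasure_distr emeasure_density_const)
  qed simp
  then have "(LINT x|\<mu>. f (x + s)) = (LINT x|density \<mu> (\<lambda>_. ennreal (\<Delta> (- s))). f x)"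
    using integral_distr[OF meas f] by simp
  also have "\<dots> = (LINT x|\<mu>. \<Delta> (- s) *\<^sub>R f x)"
    using \<Delta> f by (intro integral_density) (auto simp: modular_function_def less_imp_le)
  finally show ?thesis by simp
qed

lemma Cc_borel: "f \<in> Cc \<Longrightarrow> f \<in> borel_measurable borel"
  by (simp add: borel_measurable_continuous_onI Cc_cont)

lemma integral_left_translate: "f \<in> Cc \<Longrightarrow> (LINT x|\<mu>. f (- g + x)) = (LINT x|\<mu>. f x)"
  by (rule left_translation[OF Cc_borel])

lemma compact_plus:
  fixes K L :: "'g set"
  assumes "compact K" "compact L"
  shows "compact ((\<lambda>(x, y). x + y) ` (K \<times> L))"
  unfolding case_prod_unfold using assms
  by (intro compact_continuous_image compact_Times continuous_intros)

lemma compact_uminus: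
  fixes K :: "'g set"
  assumes "compact K"
  shows "compact (uminus ` K)"
  using assms by (intro compact_continuous_image continuous_intros)

text \<open>The integrand \<open>f t * h (- t + s)\<close> is continuous with compact support in
  both variables, \<open>s\<close> lying in the sum of the two supports. Integrating over
  \<open>s\<close> first, left invariance removes \<open>t\<close> from the inner integral.\<close>

lemma convolution_Cc_and_integral:
  assumes f: "f \<in> Cc" and h: "h \<in> Cc"
  shows "convolution \<mu> f h \<in> Cc"
    and "(LINT s|\<mu>. convolution \<mu> f h s) = (LINT s|\<mu>. f s) * (LINT s|\<mu>. h s)"
proof -
  obtain K where K: "compact K" "\<And>x. f x \<noteq> 0 \<Longrightarrow> x \<in> K" using Cc_support[OF f] by auto
  obtain L where L: "compact L" "\<And>x. h x \<noteq> 0 \<Longrightarrow> x \<in> L" using Cc_support[OF h] by auto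
  let ?M = "(\<lambda>(x, y). x + y) ` (K \<times> L)"
  define F where "F = (\<lambda>s t. f t * h (- t + s))"
  have M: "compact ?M" by (intro compact_plus K L)
  have supp: "F s t = 0" if "s \<notin> ?M \<or> t \<notin> K" for s t
  proof (rule ccontr)
    assume "F s t \<noteq> 0"
    then have "f t \<noteq> 0" "h (- t + s) \<noteq> 0" by (simp_all add: F_def)
    then have 1: "t \<in> K" "- t + s \<in> L" by (simp_all add: K(2) L(2))
    have "s = (\<lambda>(x, y). x + y) (t, - t + s)" by (simp add: add.assoc[symmetric])
    then have "s \<in> ?M" by (rule image_eqI) (use 1 in simp)
    then show False using that 1 by blast
  qed
  have cont: "continuous_on UNIV (\<lambda>(s, t). F s t)"
    unfolding F_def case_prod_unfold
    by (intro continuous_on_mult Cc_compose[OF f] Cc_compose[OF h] continuous_intros)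
  have conv: "convolution \<mu> f h = (\<lambda>s. LINT t|\<mu>. F s t)" by (simp add: convolution_def F_def)
  show "convolution \<mu> f h \<in> Cc"
    unfolding conv
  proof (rule CcI[OF continuous_on_integral_section[OF cont M K(1) supp] M])
    show "(LINT t|\<mu>. F s t) = 0" if "s \<notin> ?M" for s
      by (rule integral_section_outside[OF cont M K(1) supp that])
  qed
  have "(LINT s|\<mu>. convolution \<mu> f h s) = (LINT t|\<mu>. LINT s|\<mu>. F s t)"
    unfolding conv by (rule Fubini_Cc[OF cont M K(1) supp])
  also have "\<dots> = (LINT t|\<mu>. f t * (LINT s|\<mu>. h s))"
    using integral_left_translate[OF h] by (simp add: F_def)
  finally show "(LINT s|\<mu>. convolution \<mu> f h s) = (LINT s|\<mu>. f s) * (LINT s|\<mu>. h s)" by simp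
qed

text \<open>Both sides come from integrating \<open>f(s + r) k(- r)\<close> over \<open>s\<close> and \<open>r\<close>: the substitution
  \<open>r \<mapsto> - s + r\<close> turns it into a convolution, integrating over \<open>s\<close> first gives the modular function.\<close>

lemma
  assumes \<Delta>: "modular_function \<mu> \<Delta>" and f: "f \<in> Cc" and k: "k \<in> Cc"
  shows modular_times_reflection_Cc: "(\<lambda>r. (\<Delta> (- r) *\<^sub>R (LINT s|\<mu>. f s)) * k (- r)) \<in> Cc"
    and integral_modular_times_reflection:
      "(LINT r|\<mu>. (\<Delta> (- r) *\<^sub>R (LINT s|\<mu>. f s)) * k (- r)) = (LINT s|\<mu>. f s) * (LINT s|\<mu>. k s)"
proof -
  obtain K0 where K0: "compact K0" "\<And>x. k x \<noteq> 0 \<Longrightarrow> x \<in> K0" using Cc_support[OF k] by auto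
  obtain L where L: "compact L" "\<And>x. f x \<noteq> 0 \<Longrightarrow> x \<in> L" using Cc_support[OF f] by auto
  let ?K = "uminus ` K0" and ?M = "(\<lambda>(x, y). x + y) ` (L \<times> K0)"
  define F where "F = (\<lambda>r s. f (s + r) * k (- r))"
  have K: "compact ?K" by (intro compact_uminus K0)
  have M: "compact ?M" by (intro compact_plus K0 L)
  have supp: "F r s = 0" if "r \<notin> ?K \<or> s \<notin> ?M" for r s
  proof (rule ccontr)
    assume "F r s \<noteq> 0"
    then have "f (s + r) \<noteq> 0" "k (- r) \<noteq> 0" by (simp_all add: F_def)
    then have 1: "s + r \<in> L" "- r \<in> K0" by (simp_all add: K0(2) L(2))
    have "s = (\<lambda>(x, y). x + y) (s + r, - r)" by (simp add: add.assoc)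
    then have "s \<in> ?M" by (rule image_eqI) (use 1 in simp)
    moreover have "- (- r) \<in> ?K" using 1(2) by (rule imageI)
    ultimately show False using that by simp
  qed
  have cont: "continuous_on UNIV (\<lambda>(r, s). F r s)"
    unfolding F_def case_prod_unfold
    by (intro continuous_on_mult Cc_compose[OF f] Cc_compose[OF k] continuous_intros)
  have inner: "(LINT s|\<mu>. F r s) = (\<Delta> (- r) *\<^sub>R (LINT s|\<mu>. f s)) * k (- r)" for r
    using right_translation[OF \<Delta> Cc_borel[OF f], of r] by (simp add: F_def)
  show "(\<lambda>r. (\<Delta> (- r) *\<^sub>R (LINT s|\<mu>. f s)) * k (- r)) \<in> Cc"
    unfolding inner[symmetric]
  proof (rule CcI[OF continuous_on_integral_section[OF cont K M supp] K])
    show "(LINT s|\<mu>. F r s) = 0" if "r \<notin> ?K" for r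
      by (rule integral_section_outside[OF cont K M supp that])
  qed
  have "(LINT r|\<mu>. F r s) = convolution \<mu> f k s" for s
  proof -
    have "(\<lambda>t. f t * k (- t + s)) \<in> borel_measurable borel"
      by (intro borel_measurable_continuous_onI continuous_on_mult Cc_cont[OF f] Cc_compose[OF k] continuous_intros)
    from left_translation[OF this, of s] show ?thesis
      by (simp add: F_def convolution_def group_add_class.minus_add add.assoc del: add_uminus_conv_diff)
  qed
  then have "(LINT r|\<mu>. LINT s|\<mu>. F r s) = (LINT s|\<mu>. convolution \<mu> f k s)"
    using Fubini_Cc[OF cont K M supp] by simp
  then show "(LINT r|\<mu>. (\<Delta> (- r) *\<^sub>R (LINT s|\<mu>. f s)) * k (- r)) = (LINT s|\<mu>. f s) * (LINT s|\<mu>. k s)"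
    unfolding inner convolution_Cc_and_integral(2)[OF f k] .
qed

text \<open>\<open>modular_function\<close> does not mention continuity of \<open>\<Delta>\<close>.
  It enters through \<open>f0\<close>: the integral of \<open>f0 (s + r)\<close> over
  \<open>s\<close> is \<open>\<Delta> (- r)\<close> times a nonzero constant, and its product with a
  reflected \<open>C_c\<close> function is already known to lie in \<open>Cc\<close>.\<close>

lemma
  assumes \<Delta>: "modular_function \<mu> \<Delta>" and f: "f \<in> Cc" and f0: "f0 \<in> Cc" "(LINT s|\<mu>. f0 s) \<noteq> 0"
  shows involution_Cc: "involution \<Delta> f \<in> Cc"
    and integral_involution: "(LINT s|\<mu>. involution \<Delta> f s) = cnj (LINT s|\<mu>. f s)"
proof -
  define c where "c = (LINT s|\<mu>. f0 s)"
  have c: "c \<noteq> 0" using f0 by (simp add: c_def)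
  have inv: "involution \<Delta> f = (\<lambda>r. (1 / c) * ((\<Delta> (- r) *\<^sub>R (LINT s|\<mu>. f0 s)) * cnj (f (- r))))"
    using c by (simp add: involution_def c_def[symmetric] scaleR_conv_of_real fun_eq_iff)
  show "involution \<Delta> f \<in> Cc"
    unfolding inv by (rule Cc_scale[OF modular_times_reflection_Cc[OF \<Delta> f0(1) Cc_cnj[OF f]]])
  show "(LINT s|\<mu>. involution \<Delta> f s) = cnj (LINT s|\<mu>. f s)"
    unfolding inv integral_mult_right_zero integral_modular_times_reflection[OF \<Delta> f0(1) Cc_cnj[OF f]]
    using c by (simp add: c_def[symmetric])
qed

end

section \<open>The modulus of the integral as a C*-seminorm\<close>

context haar
begin

text \<open>Inner regularity of the whole space yields a compact \<open>K\<close> of positive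
  measure. Local compactness encloses it in an open \<open>U\<close> inside a compact
  \<open>L\<close>, and a Urysohn function that is 1 on \<open>K\<close> and 0 off \<open>U\<close>
  has integral at least the measure of \<open>K\<close>.\<close>

lemma exists_Cc_integral_neq_0:
  assumes lc: "locally_compact_space (euclidean :: 'g topology)"
  shows "\<exists>f\<in>Cc. (LINT s|\<mu>. f s) \<noteq> 0"
proof -
  have Haus: "Hausdorff_space (euclidean :: 'g topology)"
    unfolding Hausdorff_space_def disjnt_def
  proof (intro allI impI)
    fix x y :: 'g assume "x \<in> topspace euclidean \<and> y \<in> topspace euclidean \<and> x \<noteq> y"
    then have "x \<noteq> y" by simp
    from hausdorff[OF this] show "\<exists>U V. openin euclidean U \<and> openin euclidean V \<and> x \<in> U \<and> y \<in> V \<and> U \<inter> V = {}"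
      by (simp only: open_openin[symmetric])
  qed
  have SUP: "emeasure \<mu> UNIV = (SUP K\<in>{K. compact K \<and> K \<subseteq> UNIV}. emeasure \<mu> K)"
    using haar open_UNIV unfolding left_haar_measure_def by blast
  have "\<exists>K. compact K \<and> emeasure \<mu> K \<noteq> 0"
  proof (rule ccontr)
    assume "\<not> ?thesis"
    then have "emeasure \<mu> UNIV \<le> 0" unfolding SUP by (intro SUP_least) auto
    then show False using haar by (simp add: left_haar_measure_def)
  qed
  then obtain K where K: "compact K" "emeasure \<mu> K \<noteq> 0" by blast
  have "\<exists>U L. openin euclidean U \<and> compactin euclidean L \<and> closedin euclidean L \<and> K \<subseteq> U \<and> U \<subseteq> L"
    using iffD1[OF locally_compact_space_compact_closed_compact[OF disjI1[OF Haus]] lc] K(1) by simp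
  then obtain U L where UL: "open U" "compact L" "K \<subseteq> U" "U \<subseteq> L" by (auto simp: open_openin[symmetric])
  have creg: "completely_regular_space (euclidean :: 'g topology)"
    by (rule locally_compact_regular_imp_completely_regular_space[OF lc disjI1[OF Haus]])
  obtain h :: "'g \<Rightarrow> real" where h: "continuous_map euclidean (top_of_set {0..1}) h"
    "h ` (- U) \<subseteq> {0}" "h ` K \<subseteq> {1}"
  proof (rule Urysohn_completely_regular_compact_closed[of 0 1 "euclidean :: 'g topology" K "- U"])
    show "compactin euclidean K" using K(1) by simp
    show "closedin euclidean (- U)" using UL(1) by (simp add: closed_Compl flip: closed_closedin)
    show "disjnt K (- U)" using UL(3) by (auto simp: disjnt_def)
  qed (use creg in auto)
  have hc: "continuous_on UNIV h" and h0: "\<And>x. 0 \<le> h x"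
    using h(1) by (auto simp: continuous_map_in_subtopology image_subset_iff)
  have hL: "h x = 0" if "x \<notin> L" for x
  proof -
    have "h x \<in> h ` (- U)" using that UL(4) by blast
    then show ?thesis using h(2) by blast
  qed
  define f where "f = (\<lambda>x. complex_of_real (h x))"
  have f: "f \<in> Cc"
    unfolding f_def by (rule CcI[OF continuous_on_of_real[OF hc] UL(2)]) (simp add: hL)
  have int: "integrable \<mu> h"
    using integrable_Re[OF Cc_integrable[OF f]] by (simp add: f_def)
  have "measure \<mu> K = (LINT x|\<mu>. indicator K x)" using K by simp
  also have "\<dots> \<le> (LINT x|\<mu>. h x)"
    using h(3) h0 by (intro integral_mono'[OF int]) (auto simp: indicator_def)
  finally have "measure \<mu> K \<le> (LINT x|\<mu>. h x)" .
  moreover have "measure \<mu> K > 0"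
    using K compact_finite[OF K(1)] by (simp add: measure_def enn2real_positive_iff zero_less_iff_neq_zero)
  moreover have "(LINT x|\<mu>. f x) = of_real (LINT x|\<mu>. h x)"
    unfolding f_def by simp
  ultimately have "(LINT x|\<mu>. f x) \<noteq> 0" by simp
  then show ?thesis using f by blast
qed

text \<open>The seminorm given by the trivial one-dimensional representation. Being among the
  competitors in the supremum, it bounds the full norm from below.\<close>

lemma Cc_cstar_seminorm_trivial:
  assumes lc: "locally_compact_space (euclidean :: 'g topology)" and \<Delta>: "modular_function \<mu> \<Delta>"
  shows "Cc_cstar_seminorm \<mu> \<Delta> (\<lambda>f. cmod (LINT s|\<mu>. f s))"
proof -
  obtain f0 where f0: "f0 \<in> Cc" "(LINT s|\<mu>. f0 s) \<noteq> 0" using exists_Cc_integral_neq_0[OF lc] by blast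
  have "cmod (LINT s|\<mu>. convolution \<mu> (involution \<Delta> f) f s) = (cmod (LINT s|\<mu>. f s))\<^sup>2" if f: "f \<in> Cc" for f
    using convolution_Cc_and_integral(2)[OF involution_Cc[OF \<Delta> f f0] f] integral_involution[OF \<Delta> f f0]
    by (simp add: norm_mult power2_eq_square)
  moreover have "cmod (LINT s|\<mu>. f s + h s) \<le> cmod (LINT s|\<mu>. f s) + cmod (LINT s|\<mu>. h s)"
    if "f \<in> Cc" "h \<in> Cc" for f h
    using that Cc_integrable by (simp add: norm_triangle_ineq)
  ultimately show ?thesis
    unfolding Cc_cstar_seminorm_def
    by (auto simp: norm_mult convolution_Cc_and_integral(2) intro: integral_norm_bound)
qed

lemma integral_le_full_group_norm:
  assumes lc: "locally_compact_space (euclidean :: 'g topology)" and \<Delta>: "modular_function \<mu> \<Delta>" and f: "f \<in> Cc"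
  shows "cmod (LINT s|\<mu>. f s) \<le> full_group_norm \<mu> \<Delta> f"
  unfolding full_group_norm_def
proof (rule cSup_upper)
  show "cmod (LINT s|\<mu>. f s) \<in> {p f | p. Cc_cstar_seminorm \<mu> \<Delta> p}"
    by (intro CollectI exI[of _ "\<lambda>f. cmod (LINT s|\<mu>. f s)"] conjI refl Cc_cstar_seminorm_trivial[OF lc \<Delta>])
  \<comment> \<open>The domination by the L1-norm built into \<open>Cc_cstar_seminorm\<close> makes
    the real supremum meaningful.\<close>
  show "bdd_above {p f | p. Cc_cstar_seminorm \<mu> \<Delta> p}"
    using f by (auto simp: Cc_cstar_seminorm_def intro!: bdd_aboveI)
qed

end

section \<open>The trivial character of the full group algebra\<close>

locale group_cstar = haar \<mu> + C: cstar C
  for \<mu> :: "'g::{topological_group_add, t2_space} measure" and C :: "'c cstar_alg" +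
  fixes \<Delta> :: "'g \<Rightarrow> real" and \<iota> :: "('g \<Rightarrow> complex) \<Rightarrow> 'c"
  assumes lc: "locally_compact_space (euclidean :: 'g topology)"
    and modular: "modular_function \<mu> \<Delta>"
    and full: "full_group_cstar_algebra \<mu> \<Delta> C \<iota>"
begin

lemma emb_closed [simp]: "f \<in> Cc \<Longrightarrow> \<iota> f \<in> carrier C"
  and emb_add: "f \<in> Cc \<Longrightarrow> h \<in> Cc \<Longrightarrow> \<iota> (\<lambda>s. f s + h s) = \<iota> f \<oplus>\<^bsub>C\<^esub> \<iota> h"
  and emb_scale: "f \<in> Cc \<Longrightarrow> \<iota> (\<lambda>s. c * f s) = c \<odot>\<^bsub>C\<^esub> \<iota> f"
  and emb_involution: "f \<in> Cc \<Longrightarrow> \<iota> (involution \<Delta> f) = adj C (\<iota> f)"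
  and norm_emb: "f \<in> Cc \<Longrightarrow> cnorm C (\<iota> f) = full_group_norm \<mu> \<Delta> f"
  using full by (simp_all add: full_group_cstar_algebra_def)

lemma emb_dense: "x \<in> carrier C \<Longrightarrow> e > 0 \<Longrightarrow> \<exists>f\<in>Cc. cnorm C (x \<ominus>\<^bsub>C\<^esub> \<iota> f) < e"
  using full by (simp add: full_group_cstar_algebra_def)

lemma emb_diff: "f \<in> Cc \<Longrightarrow> h \<in> Cc \<Longrightarrow> \<iota> (\<lambda>s. f s + (-1) * h s) = \<iota> f \<ominus>\<^bsub>C\<^esub> \<iota> h"
  using emb_add[OF _ Cc_scale[of h "-1"], of f] emb_scale[of h "-1"]
  by (simp add: a_minus_def C.minus_smult)

abbreviation I :: "('g \<Rightarrow> complex) \<Rightarrow> complex" where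
  "I f \<equiv> (LINT s|\<mu>. f s)"

lemma I_diff_le:
  assumes f: "f \<in> Cc" and h: "h \<in> Cc"
  shows "cmod (I f - I h) \<le> cnorm C (\<iota> f \<ominus>\<^bsub>C\<^esub> \<iota> h)"
proof -
  have fh: "(\<lambda>s. f s + (-1) * h s) \<in> Cc" by (rule Cc_add[OF f Cc_scale[OF h]])
  have "I (\<lambda>s. f s + (-1) * h s) = I f - I h"
    using Cc_integrable[OF f] Cc_integrable[OF h] by simp
  then show ?thesis
    using integral_le_full_group_norm[OF lc modular fh] norm_emb[OF fh] emb_diff[OF f h] by metis
qed

text \<open>The integral is 1-Lipschitz for the norm of \<open>C\<close> on a dense subspace, so it
  extends by limits. The limit is recorded as an inequality against every \<open>f\<close>, which is
  free of the approximating sequence.\<close>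

lemma trivial_character_value:
  assumes x: "x \<in> carrier C"
  shows "\<exists>z. \<forall>f\<in>Cc. cmod (z - I f) \<le> cnorm C (x \<ominus>\<^bsub>C\<^esub> \<iota> f)"
proof -
  have "\<exists>f. f \<in> Cc \<and> cnorm C (x \<ominus>\<^bsub>C\<^esub> \<iota> f) < inverse (real (Suc n))" for n
    using emb_dense[OF x, of "inverse (real (Suc n))"] by auto
  then obtain F where F: "\<And>n. F n \<in> Cc" "\<And>n. cnorm C (x \<ominus>\<^bsub>C\<^esub> \<iota> (F n)) < inverse (real (Suc n))"
    by metis
  have lim: "(\<lambda>n. cnorm C (x \<ominus>\<^bsub>C\<^esub> \<iota> (F n))) \<longlonglongrightarrow> 0"
    using F x by (intro Lim_null_comparison[OF _ LIMSEQ_inverse_real_of_nat]) (simp add: less_imp_le)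
  have I_dist: "cmod (I (F n) - I f) \<le> cnorm C (x \<ominus>\<^bsub>C\<^esub> \<iota> (F n)) + cnorm C (x \<ominus>\<^bsub>C\<^esub> \<iota> f)" if f: "f \<in> Cc" for f n
    using I_diff_le[OF F(1) f, of n] C.norm_diff_triangle[of "\<iota> (F n)" x "\<iota> f"]
      C.norm_diff_commute[of "\<iota> (F n)" x] F(1)[of n] f x by simp
  have "Cauchy (\<lambda>n. I (F n))"
  proof (rule CauchyI)
    fix e :: real assume e: "e > 0"
    then have "\<forall>\<^sub>F n in sequentially. cnorm C (x \<ominus>\<^bsub>C\<^esub> \<iota> (F n)) < e / 2"
      by (intro order_tendstoD(2)[OF lim]) simp
    then obtain N where N: "\<And>n. n \<ge> N \<Longrightarrow> cnorm C (x \<ominus>\<^bsub>C\<^esub> \<iota> (F n)) < e / 2"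
      unfolding eventually_sequentially by blast
    have "norm (I (F m) - I (F n)) < e" if "m \<ge> N" "n \<ge> N" for m n
      using I_dist[OF F(1), of m n] N[OF that(1)] N[OF that(2)] by linarith
    then show "\<exists>M. \<forall>m\<ge>M. \<forall>n\<ge>M. norm (I (F m) - I (F n)) < e" by blast
  qed
  then obtain z where z: "(\<lambda>n. I (F n)) \<longlonglongrightarrow> z"
    using Cauchy_convergent_iff convergent_def by blast
  have "cmod (z - I f) \<le> cnorm C (x \<ominus>\<^bsub>C\<^esub> \<iota> f)" if f: "f \<in> Cc" for f
  proof (rule LIMSEQ_le)
    show "(\<lambda>n. cmod (I (F n) - I f)) \<longlonglongrightarrow> cmod (z - I f)"
      by (intro tendsto_norm tendsto_diff z tendsto_const)
    show "(\<lambda>n. cnorm C (x \<ominus>\<^bsub>C\<^esub> \<iota> (F n)) + cnorm C (x \<ominus>\<^bsub>C\<^esub> \<iota> f)) \<longlonglongrightarrow> cnorm C (x \<ominus>\<^bsub>C\<^esub> \<iota> f)"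
      using tendsto_add[OF lim tendsto_const] by simp
  qed (use I_dist[OF f] in blast)
  then show ?thesis by blast
qed

text \<open>By density the inequality has only one solution. The value 0 off the carrier is what
  \<open>cdual\<close> demands.\<close>

definition trivial_character :: "'c \<Rightarrow> complex" where
  "trivial_character x =
     (if x \<in> carrier C then SOME z. \<forall>f\<in>Cc. cmod (z - I f) \<le> cnorm C (x \<ominus>\<^bsub>C\<^esub> \<iota> f) else 0)"

lemma trivial_character_diff_le:
  assumes x: "x \<in> carrier C" and f: "f \<in> Cc"
  shows "cmod (trivial_character x - I f) \<le> cnorm C (x \<ominus>\<^bsub>C\<^esub> \<iota> f)"
  using someI_ex[OF trivial_character_value[OF x]] x f by (simp add: trivial_character_def)

lemma trivial_character_emb: "f \<in> Cc \<Longrightarrow> trivial_character (\<iota> f) = I f"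
  using trivial_character_diff_le[of "\<iota> f" f] by (simp add: a_minus_def C.r_neg)

text \<open>Properties of the extension reduce to estimates against the dense subspace. The
  arbitrary factor \<open>K\<close> leaves room for multipliers, which come with an unspecified
  bound.\<close>

lemma trivial_character_eqI:
  assumes x: "x \<in> carrier C"
    and approx: "\<And>f. f \<in> Cc \<Longrightarrow> cmod (z - I f) \<le> K * cnorm C (x \<ominus>\<^bsub>C\<^esub> \<iota> f)"
  shows "trivial_character x = z"
proof -
  have "cmod (trivial_character x - z) \<le> 0"
  proof (rule field_le_epsilon)
    fix e :: real assume e: "e > 0"
    define d where "d = e / (\<bar>K\<bar> + 1)"
    have K: "\<bar>K\<bar> + 1 > 0" by simp
    have d: "d > 0" unfolding d_def by (rule divide_pos_pos[OF e K])
    obtain f where f: "f \<in> Cc" "cnorm C (x \<ominus>\<^bsub>C\<^esub> \<iota> f) < d" using emb_dense[OF x d] by blast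
    have n: "0 \<le> cnorm C (x \<ominus>\<^bsub>C\<^esub> \<iota> f)" using x f by simp
    have "cmod (trivial_character x - z) \<le> cmod (trivial_character x - I f) + cmod (z - I f)"
      using norm_triangle_ineq4[of "trivial_character x - I f" "z - I f"] by simp
    also have "\<dots> \<le> cnorm C (x \<ominus>\<^bsub>C\<^esub> \<iota> f) + \<bar>K\<bar> * cnorm C (x \<ominus>\<^bsub>C\<^esub> \<iota> f)"
      using trivial_character_diff_le[OF x f(1)] approx[OF f(1)] mult_right_mono[OF abs_ge_self[of K] n] by linarith
    also have "\<dots> = (\<bar>K\<bar> + 1) * cnorm C (x \<ominus>\<^bsub>C\<^esub> \<iota> f)" by (simp add: distrib_right)
    also have "\<dots> \<le> (\<bar>K\<bar> + 1) * d" using f(2) by (intro mult_left_mono) auto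
    also have "\<dots> = 0 + e" using K by (simp add: d_def)
    finally show "cmod (trivial_character x - z) \<le> 0 + e" .
  qed
  then show ?thesis by simp
qed

lemma trivial_character_lipschitz:
  assumes u: "u \<in> carrier C" and v: "v \<in> carrier C"
  shows "cmod (trivial_character u - trivial_character v) \<le> cnorm C (u \<ominus>\<^bsub>C\<^esub> v)"
proof (rule field_le_epsilon)
  fix e :: real assume e: "e > 0"
  then obtain h where h: "h \<in> Cc" "cnorm C (v \<ominus>\<^bsub>C\<^esub> \<iota> h) < e / 2"
    using emb_dense[OF v, of "e/2"] by auto
  have "cmod (trivial_character u - trivial_character v) \<le>
      cmod (trivial_character u - I h) + cmod (trivial_character v - I h)"
    using norm_triangle_ineq4[of "trivial_character u - I h" "trivial_character v - I h"] by simp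
  also have "\<dots> \<le> cnorm C (u \<ominus>\<^bsub>C\<^esub> \<iota> h) + cnorm C (v \<ominus>\<^bsub>C\<^esub> \<iota> h)"
    by (intro add_mono trivial_character_diff_le u v h)
  also have "\<dots> \<le> cnorm C (u \<ominus>\<^bsub>C\<^esub> v) + e"
    using C.norm_diff_triangle[OF u v emb_closed[OF h(1)]] h(2) by linarith
  finally show "cmod (trivial_character u - trivial_character v) \<le> cnorm C (u \<ominus>\<^bsub>C\<^esub> v) + e" .
qed

text \<open>Approximation is done in one variable at a time: first with \<open>x\<close> replaced by
  an embedded function, then for general \<open>x\<close> by the Lipschitz bound.\<close>

lemma trivial_character_add:
  assumes x: "x \<in> carrier C" and y: "y \<in> carrier C"
  shows "trivial_character (x \<oplus>\<^bsub>C\<^esub> y) = trivial_character x + trivial_character y"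
proof -
  have fixed: "trivial_character (\<iota> f \<oplus>\<^bsub>C\<^esub> y) = I f + trivial_character y" if f: "f \<in> Cc" for f
  proof (rule trivial_character_eqI[where K = 1])
    fix h :: "'g \<Rightarrow> complex" assume h: "h \<in> Cc"
    have hf: "(\<lambda>s. h s + (-1) * f s) \<in> Cc" by (rule Cc_add[OF h Cc_scale[OF f]])
    have e1: "I (\<lambda>s. h s + (-1) * f s) = I h - I f"
      using Cc_integrable[OF f] Cc_integrable[OF h] by simp
    have e2: "y \<ominus>\<^bsub>C\<^esub> (\<iota> h \<ominus>\<^bsub>C\<^esub> \<iota> f) = (\<iota> f \<oplus>\<^bsub>C\<^esub> y) \<ominus>\<^bsub>C\<^esub> \<iota> h"
      using y f h by (simp add: a_minus_def C.minus_add C.a_ac)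
    show "cmod (I f + trivial_character y - I h) \<le> 1 * cnorm C ((\<iota> f \<oplus>\<^bsub>C\<^esub> y) \<ominus>\<^bsub>C\<^esub> \<iota> h)"
      using trivial_character_diff_le[OF y hf] unfolding e1 emb_diff[OF h f] e2
      by (simp add: algebra_simps)
  qed (use y f in simp)
  have "trivial_character x = trivial_character (x \<oplus>\<^bsub>C\<^esub> y) - trivial_character y"
  proof (rule trivial_character_eqI[OF x, where K = 1])
    fix f :: "'g \<Rightarrow> complex" assume f: "f \<in> Cc"
    have "(x \<oplus>\<^bsub>C\<^esub> y) \<ominus>\<^bsub>C\<^esub> (\<iota> f \<oplus>\<^bsub>C\<^esub> y) = x \<ominus>\<^bsub>C\<^esub> \<iota> f"
      using C.add_diff_add[of x y "\<iota> f" y] x y f by (simp add: a_minus_def C.r_neg)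
    then show "cmod (trivial_character (x \<oplus>\<^bsub>C\<^esub> y) - trivial_character y - I f) \<le> 1 * cnorm C (x \<ominus>\<^bsub>C\<^esub> \<iota> f)"
      using trivial_character_lipschitz[of "x \<oplus>\<^bsub>C\<^esub> y" "\<iota> f \<oplus>\<^bsub>C\<^esub> y"] x y f by (simp add: fixed algebra_simps)
  qed
  then show ?thesis by simp
qed

lemma trivial_character_smult:
  assumes x: "x \<in> carrier C"
  shows "trivial_character (c \<odot>\<^bsub>C\<^esub> x) = c * trivial_character x"
proof (cases "c = 0")
  case True
  have "trivial_character \<zero>\<^bsub>C\<^esub> = 0"
    using trivial_character_add[OF C.zero_closed C.zero_closed] by simp
  then show ?thesis using True x by simp
next
  case False
  have "trivial_character x = trivial_character (c \<odot>\<^bsub>C\<^esub> x) / c"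
  proof (rule trivial_character_eqI[OF x, where K = 1])
    fix f :: "'g \<Rightarrow> complex" assume f: "f \<in> Cc"
    have "cmod (trivial_character (c \<odot>\<^bsub>C\<^esub> x) - I (\<lambda>s. c * f s)) \<le> cnorm C (c \<odot>\<^bsub>C\<^esub> x \<ominus>\<^bsub>C\<^esub> \<iota> (\<lambda>s. c * f s))"
      by (rule trivial_character_diff_le[OF _ Cc_scale[OF f]]) (use x in simp)
    then have "cmod (trivial_character (c \<odot>\<^bsub>C\<^esub> x) - c * I f) \<le> cmod c * cnorm C (x \<ominus>\<^bsub>C\<^esub> \<iota> f)"
      using x f by (simp add: emb_scale C.smult_diff_r[symmetric] C.norm_smult)
    moreover have "trivial_character (c \<odot>\<^bsub>C\<^esub> x) / c - I f = (trivial_character (c \<odot>\<^bsub>C\<^esub> x) - c * I f) / c"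
      using False by (simp add: diff_divide_distrib)
    ultimately show "cmod (trivial_character (c \<odot>\<^bsub>C\<^esub> x) / c - I f) \<le> 1 * cnorm C (x \<ominus>\<^bsub>C\<^esub> \<iota> f)"
      using False by (simp add: norm_divide pos_divide_le_eq mult.commute)
  qed
  then show ?thesis using False by simp
qed

lemma trivial_character_bound: assumes x: "x \<in> carrier C" shows "cmod (trivial_character x) \<le> cnorm C x"
proof -
  have "\<iota> (\<lambda>_. 0) = \<zero>\<^bsub>C\<^esub>" using emb_scale[OF Cc_zero, of 0] by (simp add: Cc_zero)
  then show ?thesis
    using trivial_character_diff_le[OF x Cc_zero] C.norm_diff_le[OF x C.zero_closed] by simp
qed

lemma trivial_character_cdual: "trivial_character \<in> cdual C"
proof -
  have "\<exists>K. \<forall>x\<in>carrier C. cmod (trivial_character x) \<le> K * cnorm C x"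
    using trivial_character_bound by (intro exI[of _ 1]) simp
  moreover have "trivial_character x = 0" if "x \<notin> carrier C" for x
    using that by (simp add: trivial_character_def)
  ultimately show ?thesis
    unfolding cdual_def by (simp add: trivial_character_add trivial_character_smult)
qed

lemma trivial_character_adj:
  assumes x: "x \<in> carrier C"
  shows "trivial_character (adj C x) = cnj (trivial_character x)"
proof -
  obtain f0 where f0: "f0 \<in> Cc" "I f0 \<noteq> 0" using exists_Cc_integral_neq_0[OF lc] by blast
  have "trivial_character x = cnj (trivial_character (adj C x))"
  proof (rule trivial_character_eqI[OF x, where K = 1])
    fix f :: "'g \<Rightarrow> complex" assume f: "f \<in> Cc"
    have "cmod (trivial_character (adj C x) - I (involution \<Delta> f)) \<le> cnorm C (adj C x \<ominus>\<^bsub>C\<^esub> \<iota> (involution \<Delta> f))"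
      by (rule trivial_character_diff_le[OF _ involution_Cc[OF modular f f0]]) (use x in simp)
    also have "\<dots> = cnorm C (x \<ominus>\<^bsub>C\<^esub> \<iota> f)"
      using x f by (simp add: emb_involution C.adj_diff[symmetric])
    also have "trivial_character (adj C x) - I (involution \<Delta> f) = cnj (cnj (trivial_character (adj C x)) - I f)"
      by (simp add: integral_involution[OF modular f f0])
    finally show "cmod (cnj (trivial_character (adj C x)) - I f) \<le> 1 * cnorm C (x \<ominus>\<^bsub>C\<^esub> \<iota> f)"
      by (simp only: complex_mod_cnj mult_1)
  qed
  then show ?thesis by simp
qed

text \<open>On embedded functions the canonical unitary is left translation, which preserves the
  integral; boundedness of the multiplier carries this to all of \<open>C\<close>.\<close>

lemma trivial_character_unitary:
  assumes u: "canonical_unitaries C \<iota> u" and x: "x \<in> carrier C"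
  shows "fst (u g) x \<in> carrier C" "trivial_character (fst (u g) x) = trivial_character x"
proof -
  have m: "multiplier C (u g)" and ug: "\<And>f. f \<in> Cc \<Longrightarrow> fst (u g) (\<iota> f) = \<iota> (\<lambda>s. f (- g + s))"
    using u by (auto simp: canonical_unitaries_def unitary_multiplier_def)
  have lin: "linear_map C C (fst (u g))" using m by (simp add: multiplier_def)
  have closed: "fst (u g) y \<in> carrier C" if "y \<in> carrier C" for y
    using lin that by (simp add: linear_map_def)
  then show "fst (u g) x \<in> carrier C" using x .
  obtain K where K: "\<And>y. y \<in> carrier C \<Longrightarrow> cnorm C (fst (u g) y) \<le> K * cnorm C y"
    using m unfolding multiplier_def by blast
  have "trivial_character x = trivial_character (fst (u g) x)"
  proof (rule trivial_character_eqI[OF x, where K = K])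
    fix f :: "'g \<Rightarrow> complex" assume f: "f \<in> Cc"
    have "cmod (trivial_character (fst (u g) x) - I (\<lambda>s. f (- g + s))) \<le>
        cnorm C (fst (u g) x \<ominus>\<^bsub>C\<^esub> \<iota> (\<lambda>s. f (- g + s)))"
      by (rule trivial_character_diff_le[OF closed[OF x] Cc_translate[OF f]])
    also have "fst (u g) x \<ominus>\<^bsub>C\<^esub> \<iota> (\<lambda>s. f (- g + s)) = fst (u g) (x \<ominus>\<^bsub>C\<^esub> \<iota> f)"
    proof -
      have "fst (u g) (x \<oplus>\<^bsub>C\<^esub> (-1) \<odot>\<^bsub>C\<^esub> \<iota> f) = fst (u g) x \<oplus>\<^bsub>C\<^esub> (-1) \<odot>\<^bsub>C\<^esub> fst (u g) (\<iota> f)"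
        using lin x f by (simp add: linear_map_def)
      then show ?thesis using x f closed[of "\<iota> f"] by (simp add: a_minus_def C.minus_smult ug[OF f])
    qed
    also have "cnorm C \<dots> \<le> K * cnorm C (x \<ominus>\<^bsub>C\<^esub> \<iota> f)" using x f by (intro K) simp
    finally show "cmod (trivial_character (fst (u g) x) - I f) \<le> K * cnorm C (x \<ominus>\<^bsub>C\<^esub> \<iota> f)"
      by (simp add: integral_left_translate[OF f])
  qed
  then show "trivial_character (fst (u g) x) = trivial_character x" by simp
qed

lemma trivial_character_conjugation:
  assumes u: "canonical_unitaries C \<iota> u" and x: "x \<in> carrier C"
  shows "trivial_character (conjugation_action C u g x) = trivial_character x"
proof -
  note U = trivial_character_unitary[OF u]
  show ?thesis
    using x U(1)[OF x, of g] U(1)[of "adj C (fst (u g) x)" g]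
    by (simp add: conjugation_action_def multiplier_adj_def trivial_character_adj U(2))
qed

end

theorem proposition4p6:
  assumes "locally_compact_space (euclidean :: 'g::{topological_group_add, t2_space} topology)"
    and "\<not> amenable TYPE('g)"
  shows "(\<forall>(A :: 'a cstar_alg) (\<alpha> :: 'g \<Rightarrow> 'a \<Rightarrow> 'a).
            G_cstar_algebra A \<alpha> \<and> (\<exists>\<phi>. invariant_state A \<alpha> \<phi>) \<longrightarrow> \<not> G_QWEP TYPE('d) A \<alpha>) \<and>
         (\<forall>(\<mu> :: 'g measure) \<Delta> (C :: 'c cstar_alg) \<iota> u.
            left_haar_measure \<mu> \<and> modular_function \<mu> \<Delta> \<and>
            full_group_cstar_algebra \<mu> \<Delta> C \<iota> \<and> canonical_unitaries C \<iota> u \<longrightarrow>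
            \<not> G_QWEP TYPE('d) C (conjugation_action C u))"
proof (intro conjI allI impI notI)
  fix A :: "'a cstar_alg" and \<alpha> :: "'g \<Rightarrow> 'a \<Rightarrow> 'a"
  assume A: "G_cstar_algebra A \<alpha> \<and> (\<exists>\<phi>. invariant_state A \<alpha> \<phi>)" and qwep: "G_QWEP TYPE('d) A \<alpha>"
  then obtain \<phi> where \<phi>: "\<phi> \<in> cdual A" "dual_norm A \<phi> = 1"
      and inv: "\<And>g a. a \<in> carrier A \<Longrightarrow> \<phi> (\<alpha> g a) = \<phi> a"
    unfolding invariant_state_def state_def by blast
  have cA: "cstar_algebra A" using A by (simp add: G_cstar_algebra_def)
  interpret A: cstar A by (rule cstar.intro[OF cA])
  \<comment> \<open>A functional of norm 1 cannot vanish identically.\<close>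
  have "\<exists>x0\<in>carrier A. \<phi> x0 \<noteq> 0"
  proof (rule ccontr)
    assume "\<not> ?thesis"
    then have "dual_norm A \<phi> \<le> 0" by (intro A.dual_norm_le) simp
    then show False using \<phi>(2) by simp
  qed
  then show False using amenable_of_G_QWEP[OF cA \<phi>(1) inv _ _ qwep] assms(2) by blast
next
  fix \<mu> :: "'g measure" and \<Delta> and C :: "'c cstar_alg" and \<iota> u
  assume H: "left_haar_measure \<mu> \<and> modular_function \<mu> \<Delta> \<and>
      full_group_cstar_algebra \<mu> \<Delta> C \<iota> \<and> canonical_unitaries C \<iota> u"
    and qwep: "G_QWEP TYPE('d) C (conjugation_action C u)"
  then have cC: "cstar_algebra C" by (simp add: full_group_cstar_algebra_def)
  interpret group_cstar \<mu> C \<Delta> \<iota>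
    by unfold_locales (use H cC assms(1) in simp_all)
  obtain f0 where f0: "f0 \<in> Cc" "I f0 \<noteq> 0" using exists_Cc_integral_neq_0[OF assms(1)] by blast
  have "trivial_character (\<iota> f0) \<noteq> 0" using f0 by (simp add: trivial_character_emb)
  then show False
    using amenable_of_G_QWEP[OF cC trivial_character_cdual _ emb_closed[OF f0(1)] _ qwep]
      trivial_character_conjugation H assms(2) by blast
qed

end
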